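(* Let $m,n,r,d$ be integers with $m,n\ge2$, $d\ge1$, $0<r<\min\{m,n\}$, and for $0\le a\le rd$ let $d_R=\lfloor a/r\rfloor$, $t_R=a\bmod r$, $\alpha=\lfloor a/(n-r)\rfloor$, $s=a\bmod(n-r)$, $\beta=\lfloor (rd-a)/(m-r)\rfloor$, $t=(rd-a)\bmod(m-r)$. All factors below are $L\in\mathbb{C}[\lambda]^{m\times r}$, $R\in\mathbb{C}[\lambda]^{r\times n}$. Define: $\mathcal{A}_a$: products $LR$ with $\deg(L_{*i})+\deg(R_{i*})=d$ for all $i$ and $\sum_i\deg(R_{i*})=a$; $\mathcal{B}_a$: products $LR$ with $\deg(R_{i*})=d_R+1$ ($i\le t_R$), $\deg(R_{i*})=d_R$ ($i>t_R$), $\deg(L_{*i})=d-\deg(R_{i*})$ (all $i$); $\mathcal{M}_a$: products $LR$ whose factors satisfy the conditions of $\mathcal{B}_a$ and the columns of $L$ and the rows of $R$ are minimal bases; $\mathcal{MH}_a$: products $LR$ whose factors satisfy the conditions of $\mathcal{M}_a$ and $\mathcal{N}_\ell(L)$ has minimal indices $\beta+1$ ($t$ times), $\beta$ ($m-r-t$ times), and $\mathcal{N}_r(R)$ has minimal indices $\alpha+1$ ($s$ times), $\alpha$ ($n-r-s$ times); $\mathcal{C}_a$: products $LR$ with $\deg(R_{i*})\le d_R+1$ and $\deg(L_{*i})\le d-d_R-1$ for $i\le t_R$, and $\deg(R_{i*})\le d_R$ and $\deg(L_{*i})\le d-d_R$ for $t_R<i\le r$. Let $\mathcal{O}_a$ be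 the set of all $P\in\mathbb{C}[\lambda]^{m\times n}_d$ of normal rank $r$ whose $r$ invariant polynomials are all equal to $1$, whose partial multiplicity sequence at $\infty$ (with respect to $d$) consists of zeros, whose left nullspace $\mathcal{N}_\ell(P)$ has minimal indices $\beta+1$ ($t$ times) and $\beta$ ($m-r-t$ times), and whose right nullspace $\mathcal{N}_r(P)$ has minimal indices $\alpha+1$ ($s$ times) and $\alpha$ ($n-r-s$ times). Then for every $a=0,1,\dots,rd$: (i) $\mathcal{O}_a\subseteq\mathcal{A}_a$; (ii) $\mathcal{MH}_a\subseteq\mathcal{O}_a$; (iii) $\overline{\mathcal{O}_a}=\overline{\mathcal{MH}_a}=\overline{\mathcal{M}_a}=\overline{\mathcal{B}_a}=\overline{\mathcal{C}_a}=\overline{\mathcal{A}_a}$.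
   Context: $\mathbb{C}[\lambda]^{m\times n}_d$: complex $m\times n$ polynomial matrices of degree at most $d$; degree of a polynomial vector/matrix is the maximum degree of its entries, $\deg0=-\infty$; $L_{*i}$ is the $i$th column and $R_{i*}$ the $i$th row. Normal rank is rank over $\mathbb{C}(\lambda)$. A minimal basis of a subspace of $\mathbb{C}(\lambda)^k$ is a basis of polynomial vectors with minimal sum of degrees; its degrees (the minimal indices) are independent of the choice. $\mathcal{N}_\ell(X)=\{y:yX=0\}$, $\mathcal{N}_r(X)=\{x:Xx=0\}$ over $\mathbb{C}(\lambda)$. Invariant polynomials are the nonzero diagonal entries of the Smith form. The partial multiplicity sequence of $P$ at $\alpha_0\in\mathbb{C}$ is the list of exponents $\sigma_j$ of $(\lambda-\alpha_0)$ in the invariant polynomials $e_1,\dots,e_r$; the partial multiplicity sequence at $\infty$ (with respect to $d$) is that of $\lambda^dP(1/\lambda)$ at $0$. Closures are taken in $\mathbb{C}[\lambda]^{m\times n}_d$ with the metric $\mathrm{dist}(P,Q)=(\sum_{i=0}^d\|P_i-Q_i\|_F^2)^{1/2}$, $P_i,Q_i$ the coefficients of $\lambda^i$. *)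

theory Defs
  imports "Jordan_Normal_Form.Matrix" "Jordan_Normal_Form.DL_Rank" "Jordan_Normal_Form.Determinant"
    "HOL-Computational_Algebra.Polynomial" "HOL-Computational_Algebra.Fraction_Field"
    "HOL-Library.Extended_Real" "HOL-Library.Multiset"
begin

definition fvec :: "complex poly vec \<Rightarrow> complex poly fract vec" where
  "fvec v = map_vec to_fract v"

definition fmat :: "complex poly mat \<Rightarrow> complex poly fract mat" where
  "fmat A = map_mat to_fract A"

text \<open>Degree of a polynomial vector: max degree of entries, degree of 0 is minus infinity.\<close>
definition vdeg :: "complex poly vec \<Rightarrow> ereal" where
  "vdeg v = (SUP i \<in> {i. i < dim_vec v \<and> v $ i \<noteq> 0}. ereal (real (degree (v $ i))))"

definition pmats :: "nat \<Rightarrow> nat \<Rightarrow> nat \<Rightarrow> complex poly mat set" where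
  "pmats m n d = {P \<in> carrier_mat m n. \<forall>i<m. \<forall>j<n. degree (P $$ (i,j)) \<le> d}"

definition pm_dist :: "nat \<Rightarrow> complex poly mat \<Rightarrow> complex poly mat \<Rightarrow> real" where
  "pm_dist d P Q = sqrt (\<Sum>k\<le>d. \<Sum>i<dim_row P. \<Sum>j<dim_col P.
      (cmod (coeff (P $$ (i,j)) k - coeff (Q $$ (i,j)) k))\<^sup>2)"

definition pm_closure :: "nat \<Rightarrow> nat \<Rightarrow> nat \<Rightarrow> complex poly mat set \<Rightarrow> complex poly mat set" where
  "pm_closure m n d S = {P \<in> pmats m n d. \<forall>e>0. \<exists>Q\<in>S. pm_dist d P Q < e}"

definition normal_rank :: "complex poly mat \<Rightarrow> nat" where
  "normal_rank P = vec_space.rank (dim_row P) (fmat P)"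

definition lincomb :: "nat \<Rightarrow> 'a::field list \<Rightarrow> 'a vec list \<Rightarrow> 'a vec" where
  "lincomb k cs vs = vec k (\<lambda>j. \<Sum>i<length vs. cs ! i * (vs ! i) $ j)"

definition lin_indep_list :: "nat \<Rightarrow> 'a::field vec list \<Rightarrow> bool" where
  "lin_indep_list k vs \<longleftrightarrow>
     (\<forall>cs. length cs = length vs \<and> lincomb k cs vs = 0\<^sub>v k \<longrightarrow> (\<forall>c\<in>set cs. c = 0))"

definition span_list :: "nat \<Rightarrow> 'a::field vec list \<Rightarrow> 'a vec set" where
  "span_list k vs = {lincomb k cs vs | cs. length cs = length vs}"

definition is_poly_basis :: "nat \<Rightarrow> complex poly fract vec set \<Rightarrow> complex poly vec list \<Rightarrow> bool" where
  "is_poly_basis k V bs \<longleftrightarrow> set bs \<subseteq> carrier_vec k \<and>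
     lin_indep_list k (map fvec bs) \<and> span_list k (map fvec bs) = V"

definition is_minimal_basis :: "nat \<Rightarrow> complex poly fract vec set \<Rightarrow> complex poly vec list \<Rightarrow> bool" where
  "is_minimal_basis k V bs \<longleftrightarrow> is_poly_basis k V bs \<and>
     (\<forall>bs'. is_poly_basis k V bs' \<longrightarrow> sum_list (map vdeg bs) \<le> sum_list (map vdeg bs'))"

definition has_minimal_indices :: "nat \<Rightarrow> complex poly fract vec set \<Rightarrow> ereal multiset \<Rightarrow> bool" where
  "has_minimal_indices k V M \<longleftrightarrow> (\<exists>bs. is_minimal_basis k V bs \<and> mset (map vdeg bs) = M)"

definition is_minimal_basis_list :: "nat \<Rightarrow> complex poly vec list \<Rightarrow> bool" where
  "is_minimal_basis_list k bs \<longleftrightarrow> is_minimal_basis k (span_list k (map fvec bs)) bs"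

definition left_nullspace :: "complex poly mat \<Rightarrow> complex poly fract vec set" where
  "left_nullspace X = {y \<in> carrier_vec (dim_row X). transpose_mat (fmat X) *\<^sub>v y = 0\<^sub>v (dim_col X)}"

definition right_nullspace :: "complex poly mat \<Rightarrow> complex poly fract vec set" where
  "right_nullspace X = {x \<in> carrier_vec (dim_col X). fmat X *\<^sub>v x = 0\<^sub>v (dim_row X)}"

definition invariant_polys :: "complex poly mat \<Rightarrow> complex poly list \<Rightarrow> bool" where
  "invariant_polys P es \<longleftrightarrow>
     length es \<le> min (dim_row P) (dim_col P) \<and>
     (\<forall>e\<in>set es. e \<noteq> 0 \<and> lead_coeff e = 1) \<and>
     (\<forall>i. Suc i < length es \<longrightarrow> es ! i dvd es ! Suc i) \<and>
     (\<exists>U V. U \<in> carrier_mat (dim_row P) (dim_row P) \<and> V \<in> carrier_mat (dim_col P) (dim_col P) \<and>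
        is_unit (det U) \<and> is_unit (det V) \<and>
        U * P * V = mat (dim_row P) (dim_col P) (\<lambda>(i,j). if i = j \<and> i < length es then es ! i else 0))"

definition partial_mults :: "complex poly mat \<Rightarrow> complex \<Rightarrow> nat list \<Rightarrow> bool" where
  "partial_mults P \<alpha>0 ms \<longleftrightarrow> (\<exists>es. invariant_polys P es \<and> ms = map (order \<alpha>0) es)"

text \<open>lambda^d p(1/lambda) entrywise, i.e. the d-reversal.\<close>
definition rev_poly :: "nat \<Rightarrow> complex poly \<Rightarrow> complex poly" where
  "rev_poly d p = (\<Sum>i\<le>d. monom (coeff p i) (d - i))"

definition pm_rev :: "nat \<Rightarrow> complex poly mat \<Rightarrow> complex poly mat" where
  "pm_rev d P = map_mat (rev_poly d) P"

definition partial_mults_infty :: "nat \<Rightarrow> complex poly mat \<Rightarrow> nat list \<Rightarrow> bool" where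
  "partial_mults_infty d P ms \<longleftrightarrow> partial_mults (pm_rev d P) 0 ms"

section \<open>The sets of the theorem (0-based indices: paper's i \<le> t_R is i < t_R here)\<close>

definition mi_spec :: "nat \<Rightarrow> nat \<Rightarrow> nat \<Rightarrow> ereal multiset" where
  "mi_spec cnt q rm = replicate_mset rm (ereal (real (q + 1))) + replicate_mset (cnt - rm) (ereal (real q))"

definition conds_B :: "nat \<Rightarrow> nat \<Rightarrow> nat \<Rightarrow> nat \<Rightarrow> nat \<Rightarrow> complex poly mat \<Rightarrow> complex poly mat \<Rightarrow> bool" where
  "conds_B m n r d a L R \<longleftrightarrow> L \<in> carrier_mat m r \<and> R \<in> carrier_mat r n \<and>
     (\<forall>i<r. vdeg (row R i) = ereal (real (if i < a mod r then a div r + 1 else a div r)) \<and>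
            vdeg (col L i) = ereal (real d) - vdeg (row R i))"

definition conds_M :: "nat \<Rightarrow> nat \<Rightarrow> nat \<Rightarrow> nat \<Rightarrow> nat \<Rightarrow> complex poly mat \<Rightarrow> complex poly mat \<Rightarrow> bool" where
  "conds_M m n r d a L R \<longleftrightarrow> conds_B m n r d a L R \<and>
     is_minimal_basis_list m (cols L) \<and> is_minimal_basis_list n (rows R)"

definition conds_MH :: "nat \<Rightarrow> nat \<Rightarrow> nat \<Rightarrow> nat \<Rightarrow> nat \<Rightarrow> complex poly mat \<Rightarrow> complex poly mat \<Rightarrow> bool" where
  "conds_MH m n r d a L R \<longleftrightarrow> conds_M m n r d a L R \<and>
     has_minimal_indices m (left_nullspace L)
        (mi_spec (m - r) ((r * d - a) div (m - r)) ((r * d - a) mod (m - r))) \<and>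
     has_minimal_indices n (right_nullspace R)
        (mi_spec (n - r) (a div (n - r)) (a mod (n - r)))"

definition setA :: "nat \<Rightarrow> nat \<Rightarrow> nat \<Rightarrow> nat \<Rightarrow> nat \<Rightarrow> complex poly mat set" where
  "setA m n r d a = {L * R | L R. L \<in> carrier_mat m r \<and> R \<in> carrier_mat r n \<and>
     (\<forall>i<r. vdeg (col L i) + vdeg (row R i) = ereal (real d)) \<and>
     (\<Sum>i<r. vdeg (row R i)) = ereal (real a)}"

definition setB :: "nat \<Rightarrow> nat \<Rightarrow> nat \<Rightarrow> nat \<Rightarrow> nat \<Rightarrow> complex poly mat set" where
  "setB m n r d a = {L * R | L R. conds_B m n r d a L R}"

definition setM :: "nat \<Rightarrow> nat \<Rightarrow> nat \<Rightarrow> nat \<Rightarrow> nat \<Rightarrow> complex poly mat set" where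
  "setM m n r d a = {L * R | L R. conds_M m n r d a L R}"

definition setMH :: "nat \<Rightarrow> nat \<Rightarrow> nat \<Rightarrow> nat \<Rightarrow> nat \<Rightarrow> complex poly mat set" where
  "setMH m n r d a = {L * R | L R. conds_MH m n r d a L R}"

definition setC :: "nat \<Rightarrow> nat \<Rightarrow> nat \<Rightarrow> nat \<Rightarrow> nat \<Rightarrow> complex poly mat set" where
  "setC m n r d a = {L * R | L R. L \<in> carrier_mat m r \<and> R \<in> carrier_mat r n \<and>
     (\<forall>i<r. (i < a mod r \<longrightarrow> vdeg (row R i) \<le> ereal (real (a div r + 1)) \<and>
                               vdeg (col L i) \<le> ereal (real d - real (a div r) - 1)) \<and>
            (a mod r \<le> i \<longrightarrow> vdeg (row R i) \<le> ereal (real (a div r)) \<and>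
                               vdeg (col L i) \<le> ereal (real d - real (a div r))))}"

definition setO :: "nat \<Rightarrow> nat \<Rightarrow> nat \<Rightarrow> nat \<Rightarrow> nat \<Rightarrow> complex poly mat set" where
  "setO m n r d a = {P \<in> pmats m n d. normal_rank P = r \<and>
     invariant_polys P (replicate r 1) \<and>
     (\<exists>ms. partial_mults_infty d P ms \<and> (\<forall>x\<in>set ms. x = 0)) \<and>
     has_minimal_indices m (left_nullspace P)
        (mi_spec (m - r) ((r * d - a) div (m - r)) ((r * d - a) mod (m - r))) \<and>
     has_minimal_indices n (right_nullspace P)
        (mi_spec (n - r) (a div (n - r)) (a mod (n - r)))}"

end

theory Submission
  imports Defs "Jordan_Normal_Form.Spectral_Radius"
begin

text \<open>
  A matrix \<open>P\<close> of \<open>\<O>\<close> factors as \<open>L * R\<close> with \<open>R\<close> a minimal basis of its row space; since \<open>P\<close> has no finite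
  or infinite multiplicities, the columns of \<open>L\<close> have independent leading coefficients with respect to the degrees
  complementary to those of \<open>R\<close>. A dimension count bounds the degree sum of a polynomial kernel basis of a minimal
  basis from below by the degree sum of that basis. Applied to \<open>R\<close> and to the transpose of \<open>L\<close>, it pins down the
  degree sum \<open>a\<close>; applied to a minimal basis and its dual, it shows that the two degree sums agree.

  Call \<open>R\<close> with row degrees bounded by \<open>d\<^sub>i\<close>, of sum \<open>a\<close>, generic if \<open>x \<mapsto> R x\<close> maps vectors of degree at most
  \<open>\<alpha>\<close> onto all vectors with \<open>i\<close>-th degree at most \<open>d\<^sub>i + \<alpha>\<close> and is injective on vectors of degree below \<open>\<alpha>\<close>.
  Then \<open>R\<close> is a minimal basis and the indices of its null space are forced to be \<open>\<alpha>\<close> and \<open>\<alpha> + 1\<close>. Genericity holds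
  for an explicit matrix, hence for all but finitely many members of a suitable affine line through any given
  matrix. Unbalanced degrees are balanced by a small perturbation that moves one degree between two rows.
\<close>
section \<open>Linear systems\<close>

text \<open>Being a minimal basis is an optimum over all bases and cannot be tested directly. The
  proof works with Forney's local criterion, \<open>minimal_rows\<close>: full rank at every point
  (\<open>primitive_rows\<close>) and independent coefficients at the row degrees
  (\<open>leading_independent\<close>). Reversal turns the second condition into full rank at 0,
  which is how the hypothesis at infinity enters. The number \<alpha> = a div (n - r) comes from
  comparing dimensions. Vectors of degree at most \<alpha> form a space of dimension n(\<alpha> +
  1), their targets one of dimension a + r(\<alpha> + 1), so surjectivity is possible because (n -
  r)(\<alpha> + 1) > a; below degree \<alpha>, injectivity is possible because (n - r)\<alpha> \<le>
  a. Genericity says that both happen. Density rests on linear algebra alone: composing with a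
  one-sided inverse at the explicit example turns failure at \<epsilon> into an eigenvalue
  condition. For the closures it is enough to approximate the products of \<open>setA\<close> and
  \<open>setC\<close>, since \<open>setMH\<close> is contained in all the other sets.\<close>

lemma homogeneous_system_nontrivial:
  fixes v :: "'i \<Rightarrow> 'a \<Rightarrow> 'b::idom"
  assumes "finite A" and "finite I" and "card A < card I"
  shows "\<exists>c. (\<exists>i\<in>I. c i \<noteq> 0) \<and> (\<forall>a\<in>A. (\<Sum>i\<in>I. c i * v i a) = 0)"
  using assms
proof (induction A arbitrary: I v rule: finite_induct)
  case empty
  then obtain i where "i \<in> I" by fastforce
  then show ?case by (intro exI[of _ "\<lambda>_. 1"]) auto
next
  case (insert a A)
  show ?case
  proof (cases "\<forall>i\<in>I. v i a = 0")
    case True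
    moreover obtain c where "(\<exists>i\<in>I. c i \<noteq> 0) \<and> (\<forall>a\<in>A. (\<Sum>i\<in>I. c i * v i a) = 0)"
      using insert.IH[of I v] insert.prems insert.hyps by auto
    ultimately show ?thesis by (intro exI[of _ c]) auto
  next
    case False
    then obtain i0 where i0: "i0 \<in> I" "v i0 a \<noteq> 0" by blast
    \<comment> \<open>Equation \<open>a\<close> is eliminated with pivot \<open>v i0 a\<close> by
      cross-multiplication, because the coefficients lie only in an integral domain.\<close>
    define w where "w i b = v i0 a * v i b - v i a * v i0 b" for i b
    have "card A < card (I - {i0})" using insert i0 by simp
    then obtain c where c: "\<exists>i\<in>I - {i0}. c i \<noteq> 0"
        "\<And>b. b \<in> A \<Longrightarrow> (\<Sum>i\<in>I - {i0}. c i * w i b) = 0"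
      using insert.IH[of "I - {i0}" w] insert.prems by auto
    \<comment> \<open>\<open>c' i0\<close> is chosen to make equation \<open>a\<close> hold; the
      other coefficients are scaled by the nonzero pivot, so a nonzero one stays nonzero.\<close>
    define c' where "c' i = (if i = i0 then - (\<Sum>i\<in>I - {i0}. c i * v i a) else c i * v i0 a)" for i
    have key: "(\<Sum>i\<in>I. c' i * v i b) = (\<Sum>i\<in>I - {i0}. c i * w i b)" for b
    proof -
      have "(\<Sum>i\<in>I. c' i * v i b) = c' i0 * v i0 b + (\<Sum>i\<in>I - {i0}. c' i * v i b)"
        by (rule sum.remove) (use insert.prems i0 in auto)
      also have "(\<Sum>i\<in>I - {i0}. c' i * v i b) = (\<Sum>i\<in>I - {i0}. c i * v i0 a * v i b)"
        by (rule sum.cong) (auto simp: c'_def)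
      also have "c' i0 * v i0 b + \<dots> = (\<Sum>i\<in>I - {i0}. c i * w i b)"
        by (simp add: c'_def w_def algebra_simps sum_subtractf sum_distrib_left)
      finally show ?thesis .
    qed
    have "w i a = 0" for i by (simp add: w_def)
    then have "\<forall>b\<in>insert a A. (\<Sum>i\<in>I. c' i * v i b) = 0" using c(2) key by auto
    moreover have "\<exists>i\<in>I. c' i \<noteq> 0" using c(1) i0 by (auto simp: c'_def)
    ultimately show ?thesis by blast
  qed
qed

text \<open>The columns of \<open>M\<close> together with \<open>y\<close> are one vector too many,
  hence dependent. Injectivity makes the coefficient of \<open>y\<close> nonzero, and dividing by it
  solves the system.\<close>

lemma injective_square_surjective:
  fixes M :: "'a \<Rightarrow> 'a \<Rightarrow> 'b::field"
  assumes "finite A"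
    and inj: "\<And>c. (\<And>a. a \<in> A \<Longrightarrow> (\<Sum>b\<in>A. M a b * c b) = 0) \<Longrightarrow> (\<And>a. a \<in> A \<Longrightarrow> c a = 0)"
  shows "\<exists>c. \<forall>a\<in>A. (\<Sum>b\<in>A. M a b * c b) = y a"
proof -
  \<comment> \<open>\<open>None\<close> stands for the right-hand side \<open>y\<close>,
    \<open>Some b\<close> for column \<open>b\<close> of \<open>M\<close>.\<close>
  define I where "I = insert None (Some ` A)"
  define v where "v i a = (case i of None \<Rightarrow> y a | Some b \<Rightarrow> M a b)" for i a
  have "card I = Suc (card A)" unfolding I_def using assms(1)
    by (subst card_insert_disjoint) (auto simp: card_image)
  then obtain c where c: "\<exists>i\<in>I. c i \<noteq> 0" "\<And>a. a \<in> A \<Longrightarrow> (\<Sum>i\<in>I. c i * v i a) = 0"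
    using homogeneous_system_nontrivial[of A I v] assms(1) by (auto simp: I_def)
  have eq: "c None * y a + (\<Sum>b\<in>A. M a b * c (Some b)) = 0" if "a \<in> A" for a
    using c(2)[OF that] assms(1)
    by (simp add: I_def sum.reindex v_def mult.commute)
  have nz: "c None \<noteq> 0"
  proof
    assume "c None = 0"
    then have "(\<Sum>b\<in>A. M a b * c (Some b)) = 0" if "a \<in> A" for a using eq[OF that] by simp
    then have "c (Some a) = 0" if "a \<in> A" for a by (rule inj) (use that in auto)
    then show False using c(1) \<open>c None = 0\<close> by (auto simp: I_def)
  qed
  show ?thesis
  proof (intro exI ballI)
    fix a assume "a \<in> A"
    have "(\<Sum>b\<in>A. M a b * (- c (Some b) / c None)) = - (\<Sum>b\<in>A. M a b * c (Some b)) / c None"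
      by (simp add: sum_divide_distrib sum_negf)
    also have "- (\<Sum>b\<in>A. M a b * c (Some b)) = c None * y a"
      by (rule minus_unique) (use eq[OF \<open>a \<in> A\<close>] in \<open>simp add: add.commute\<close>)
    also have "c None * y a / c None = y a" using nz by simp
    finally show "(\<Sum>b\<in>A. M a b * (- c (Some b) / c None)) = y a" .
  qed
qed

text \<open>The right inverse is obtained from the Gram matrix of the rows.\<close>
lemma independent_rows_right_inverse:
  fixes T :: "'a \<Rightarrow> 'b \<Rightarrow> complex"
  assumes "finite A" and "finite B"
    and ind: "\<And>c. (\<And>b. b \<in> B \<Longrightarrow> (\<Sum>a\<in>A. c a * T a b) = 0) \<Longrightarrow> (\<And>a. a \<in> A \<Longrightarrow> c a = 0)"
  shows "\<exists>Y. \<forall>a\<in>A. \<forall>a'\<in>A. (\<Sum>b\<in>B. T a b * Y b a') = of_bool (a = a')"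
proof -
  define G where "G a a' = (\<Sum>b\<in>B. T a b * cnj (T a' b))" for a a'
  have swap: "(\<Sum>a'\<in>A. G a a' * c a') = (\<Sum>b\<in>B. T a b * (\<Sum>a'\<in>A. cnj (T a' b) * c a'))" for a c
    unfolding G_def sum_distrib_left sum_distrib_right by (subst sum.swap) (simp add: mult.assoc)
  have G_inj: "c a = 0"
    if z: "\<And>a. a \<in> A \<Longrightarrow> (\<Sum>a'\<in>A. G a a' * c a') = 0" and a: "a \<in> A" for c a
  proof -
    define s where "s b = (\<Sum>a'\<in>A. cnj (T a' b) * c a')" for b
    have cs: "cnj (s b) = (\<Sum>a\<in>A. cnj (c a) * T a b)" for b by (simp add: s_def mult.commute)
    \<comment> \<open>The squared norm of \<open>s\<close> is the Hermitian form of \<open>G\<close>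
      at \<open>c\<close>, which vanishes; this is where the conjugation in \<open>G\<close>
      matters.\<close>
    have "(\<Sum>b\<in>B. of_real ((cmod (s b))\<^sup>2)) = (\<Sum>b\<in>B. cnj (s b) * s b)"
      by (intro sum.cong refl) (simp only: complex_norm_square mult.commute)
    also have "\<dots> = (\<Sum>b\<in>B. (\<Sum>a\<in>A. cnj (c a) * (T a b * s b)))"
      by (simp only: cs sum_distrib_right mult.assoc)
    also have "\<dots> = (\<Sum>a\<in>A. cnj (c a) * (\<Sum>b\<in>B. T a b * s b))"
      by (subst sum.swap) (simp only: sum_distrib_left)
    also have "\<dots> = 0" using z swap by (intro sum.neutral) (simp add: s_def)
    finally have "complex_of_real (\<Sum>b\<in>B. (cmod (s b))\<^sup>2) = 0" by simp
    then have "(\<Sum>b\<in>B. (cmod (s b))\<^sup>2) = 0" using of_real_eq_0_iff by blast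
    then have "s b = 0" if "b \<in> B" for b
      using that assms(2) by (subst (asm) sum_nonneg_eq_0_iff) auto
    then have "cnj (s b) = 0" if "b \<in> B" for b using that by simp
    then have "(\<Sum>a\<in>A. cnj (c a) * T a b) = 0" if "b \<in> B" for b
      using that by (simp add: s_def mult.commute)
    then have "cnj (c a) = 0" using ind[of "\<lambda>a. cnj (c a)"] a by blast
    then show ?thesis by simp
  qed
  have "\<exists>c. \<forall>a\<in>A. (\<Sum>b\<in>A. G a b * c b) = of_bool (a = a')" for a'
    by (rule injective_square_surjective[OF assms(1)]) (use G_inj in blast)
  then obtain H where H: "\<And>a' a. a \<in> A \<Longrightarrow> (\<Sum>b\<in>A. G a b * H a' b) = of_bool (a = a')"
    by metis
  show ?thesis
    by (intro exI[of _ "\<lambda>b a'. \<Sum>a''\<in>A. cnj (T a'' b) * H a' a''"])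
       (use H swap in auto)
qed

text \<open>The exceptional \<epsilon> are negatives of eigenvalues of \<open>M\<close>, hence
  finite in number. The index set is arbitrary because the systems met later are indexed by
  pairs.\<close>

lemma finite_singular_shifts:
  fixes M :: "'a \<Rightarrow> 'a \<Rightarrow> complex"
  assumes "finite B"
  shows "finite {\<epsilon>. \<exists>c. (\<exists>b\<in>B. c b \<noteq> 0) \<and> (\<forall>b\<in>B. (\<Sum>b'\<in>B. M b b' * c b') + \<epsilon> * c b = 0)}"
proof -
  obtain N f where f: "bij_betw f {..<N::nat} B"
    using ex_bij_betw_nat_finite[OF assms] atLeast0LessThan by auto
  define MM where "MM = mat N N (\<lambda>(p,q). M (f p) (f q))"
  have MM: "MM \<in> carrier_mat N N" by (simp add: MM_def)
  have "- \<epsilon> \<in> spectrum MM"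
    if c: "b0 \<in> B" "c b0 \<noteq> 0" "\<And>b. b \<in> B \<Longrightarrow> (\<Sum>b'\<in>B. M b b' * c b') + \<epsilon> * c b = 0" for \<epsilon> c b0
  proof -
    define v where "v = vec N (\<lambda>p. c (f p))"
    obtain p0 where "p0 < N" "f p0 = b0" using c(1) f unfolding bij_betw_def by blast
    then have "v \<noteq> 0\<^sub>v N" using c(2) unfolding v_def by (metis index_vec index_zero_vec(1))
    moreover have "MM *\<^sub>v v = (- \<epsilon>) \<cdot>\<^sub>v v"
    proof (rule eq_vecI)
      fix p assume "p < dim_vec ((- \<epsilon>) \<cdot>\<^sub>v v)"
      then have p: "p < N" by (simp add: v_def)
      then have fp: "f p \<in> B" using f by (auto simp: bij_betw_def)
      have "(MM *\<^sub>v v) $ p = (\<Sum>q<N. M (f p) (f q) * c (f q))"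
        using p by (simp add: MM_def v_def scalar_prod_def atLeast0LessThan)
      also have "\<dots> = (\<Sum>b'\<in>B. M (f p) b' * c b')" by (rule sum.reindex_bij_betw[OF f])
      also have "\<dots> = - \<epsilon> * c (f p)" using c(3)[OF fp] by (simp add: eq_neg_iff_add_eq_0)
      finally show "(MM *\<^sub>v v) $ p = ((- \<epsilon>) \<cdot>\<^sub>v v) $ p" using p by (simp add: v_def)
    qed (simp add: MM_def v_def)
    ultimately have "eigenvalue MM (- \<epsilon>)"
      unfolding eigenvalue_def eigenvector_def by (intro exI[of _ v]) (auto simp: MM_def v_def)
    then show ?thesis by (simp add: spectrum_def)
  qed
  then have "{\<epsilon>. \<exists>c. (\<exists>b\<in>B. c b \<noteq> 0) \<and> (\<forall>b\<in>B. (\<Sum>b'\<in>B. M b b' * c b') + \<epsilon> * c b = 0)}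
      \<subseteq> uminus -` spectrum MM"
    by blast
  moreover have "finite (uminus -` spectrum MM)"
    using card_finite_spectrum[OF MM] by (intro finite_vimageI) auto
  ultimately show ?thesis using finite_subset by blast
qed

section \<open>Unimodular completion of primitive rows\<close>

text \<open>No zero at any complex point. The pointwise form lets the fundamental theorem of algebra
  act on a pivot; \<open>primitive_rows_right_inverse\<close> and
  \<open>right_inverse_primitive\<close> show it equivalent to having a polynomial right
  inverse.\<close>

definition primitive_rows :: "nat \<Rightarrow> nat \<Rightarrow> (nat \<Rightarrow> nat \<Rightarrow> complex poly) \<Rightarrow> bool" where
  "primitive_rows r n R \<longleftrightarrow>
     (\<forall>z c. (\<forall>j<n. (\<Sum>i<r. c i * poly (R i j) z) = 0) \<longrightarrow> (\<forall>i<r. c i = 0))"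

text \<open>Right multiplication by a unimodular matrix. The inverse is part of the data because
  both are needed later: columns of \<open>V\<close> span null spaces, rows of \<open>W\<close>
  complete the given rows.\<close>

definition col_equiv :: "nat \<Rightarrow> 'a::comm_ring_1 mat \<Rightarrow> 'a mat \<Rightarrow> bool" where
  "col_equiv n A B \<longleftrightarrow> (\<exists>V W. V \<in> carrier_mat n n \<and> W \<in> carrier_mat n n \<and>
     V * W = 1\<^sub>m n \<and> W * V = 1\<^sub>m n \<and> B = A * V)"

lemma col_equiv_refl: "A \<in> carrier_mat m n \<Longrightarrow> col_equiv n A A"
  unfolding col_equiv_def by (intro exI[of _ "1\<^sub>m n"]) auto

lemma col_equiv_trans:
  assumes A: "A \<in> carrier_mat m n" and "col_equiv n A B" and "col_equiv n B C"
  shows "col_equiv n A C"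
proof -
  obtain V W V' W' where V: "V \<in> carrier_mat n n" "W \<in> carrier_mat n n" "V * W = 1\<^sub>m n" "W * V = 1\<^sub>m n"
      "B = A * V"
    and V': "V' \<in> carrier_mat n n" "W' \<in> carrier_mat n n" "V' * W' = 1\<^sub>m n" "W' * V' = 1\<^sub>m n"
      "C = B * V'"
    using assms unfolding col_equiv_def by auto
  have "V' * (W' * W) = V' * W' * W" by (rule assoc_mult_mat[symmetric]) (use V V' in auto)
  moreover have "W * (V * V') = W * V * V'" by (rule assoc_mult_mat[symmetric]) (use V V' in auto)
  ultimately have "V * V' * (W' * W) = 1\<^sub>m n" and "W' * W * (V * V') = 1\<^sub>m n"
    using V V' by (simp_all add: assoc_mult_mat[of _ n n _ n _ n])
  moreover have "C = A * (V * V')" using A V V' by (simp add: assoc_mult_mat[of _ m n _ n _ n])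
  ultimately show ?thesis unfolding col_equiv_def using V V'
    by (intro exI[of _ "V * V'"] exI[of _ "W' * W"]) auto
qed

lemma col_equiv_carrier: "col_equiv n A B \<Longrightarrow> A \<in> carrier_mat m n \<Longrightarrow> B \<in> carrier_mat m n"
  unfolding col_equiv_def by auto

lemma col_equiv_addcol:
  fixes A :: "'a::comm_ring_1 mat"
  assumes "A \<in> carrier_mat m n" and "k < n" and "l < n" and "k \<noteq> l"
  shows "col_equiv n A (addcol a k l A)"
  unfolding col_equiv_def
  using addrow_mat_inv[of l n k a] addrow_mat_inv[of l n k "- a"] assms addcol_mat[of A m n l a k]
  by (intro exI[of _ "addrow_mat n a l k"] exI[of _ "addrow_mat n (- a) l k"]) auto

lemma col_equiv_swapcols:
  fixes A :: "'a::comm_ring_1 mat"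
  assumes "A \<in> carrier_mat m n" and "k < n" and "l < n"
  shows "col_equiv n A (swapcols k l A)"
  unfolding col_equiv_def
  using swaprows_mat_inv[of k n l] assms swapcols_mat[of A m n k l]
  by (intro exI[of _ "swaprows_mat n k l"]) auto

lemma col_equiv_multcol:
  fixes A :: "'a::comm_ring_1 mat"
  assumes A: "A \<in> carrier_mat m n" and "k < n" and ab: "a * b = 1"
  shows "col_equiv n A (multcol k a A)"
proof -
  have inv: "multrow_mat n k a' * multrow_mat n k b' = (1\<^sub>m n :: 'a mat)" if "a' * b' = 1" for a' b'
    using that by (subst multrow_mat[symmetric, of _ n n]) (auto intro!: eq_matI)
  show ?thesis unfolding col_equiv_def
    using inv[of a b] inv[of b a] ab multcol_mat[OF A, of k a]
    by (intro exI[of _ "multrow_mat n k a"] exI[of _ "multrow_mat n k b"]) (auto simp: mult.commute)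
qed

lemma index_mult_mat_sum:
  "A \<in> carrier_mat m k \<Longrightarrow> B \<in> carrier_mat k n \<Longrightarrow> i < m \<Longrightarrow> j < n \<Longrightarrow>
    (A * B) $$ (i,j) = (\<Sum>l<k. A $$ (i,l) * B $$ (l,j))"
  by (simp add: scalar_prod_def atLeast0LessThan)

lemma primitive_rows_col_equiv:
  assumes A: "A \<in> carrier_mat r n" and p: "primitive_rows r n (\<lambda>i j. A $$ (i,j))" and eq: "col_equiv n A B"
  shows "primitive_rows r n (\<lambda>i j. B $$ (i,j))"
proof -
  obtain V W where V: "V \<in> carrier_mat n n" "W \<in> carrier_mat n n" "V * W = 1\<^sub>m n" "B = A * V"
    using eq unfolding col_equiv_def by auto
  have B: "B \<in> carrier_mat r n" using A V by auto
  have "A = B * W" using A V by (simp add: assoc_mult_mat[of _ r n _ n _ n])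
  then have Aij: "A $$ (i,j) = (\<Sum>k<n. B $$ (i,k) * W $$ (k,j))" if "i < r" "j < n" for i j
    using index_mult_mat_sum[OF B V(2) that] by metis
  show ?thesis unfolding primitive_rows_def
  proof (intro allI impI)
    fix z and c :: "nat \<Rightarrow> complex" and i
    assume z: "\<forall>j<n. (\<Sum>i<r. c i * poly (B $$ (i,j)) z) = 0" and i: "i < r"
    have "(\<Sum>i<r. c i * poly (A $$ (i,j)) z) = 0" if j: "j < n" for j
    proof -
      have "(\<Sum>i<r. c i * poly (A $$ (i,j)) z)
          = (\<Sum>i<r. \<Sum>k<n. c i * poly (B $$ (i,k)) z * poly (W $$ (k,j)) z)"
        using j by (intro sum.cong) (auto simp: Aij poly_sum sum_distrib_left mult.assoc)
      also have "\<dots> = (\<Sum>k<n. (\<Sum>i<r. c i * poly (B $$ (i,k)) z) * poly (W $$ (k,j)) z)"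
        by (subst sum.swap) (simp add: sum_distrib_right)
      finally show ?thesis using z by simp
    qed
    then show "c i = 0" using p i unfolding primitive_rows_def by blast
  qed
qed

text \<open>Euclid's algorithm on row \<open>k\<close>, using only columns from \<open>k\<close> on.
  The preceding unit rows are zero there and stay intact. If the row is cleared entirely, the index
  \<open>l\<close> of the surviving entry says nothing and may even lie outside the range.\<close>

lemma row_reduction_step:
  fixes S :: "complex poly mat"
  assumes "S \<in> carrier_mat r n" and "k < r"
    and "\<And>i j. i < k \<Longrightarrow> j < n \<Longrightarrow> S $$ (i,j) = of_bool (i = j)"
  shows "\<exists>S'. col_equiv n S S' \<and> (\<forall>i<k. \<forall>j<n. S' $$ (i,j) = of_bool (i = j)) \<and>
     (\<exists>l. \<forall>j. k \<le> j \<longrightarrow> j < n \<longrightarrow> j \<noteq> l \<longrightarrow> S' $$ (k,j) = 0)"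
  using assms
\<comment> \<open>Counting \<open>Suc\<close> of the degree makes the passage from a nonzero
  constant to 0 count as progress.\<close>
proof (induction "\<Sum>j\<in>{k..<n}. if S $$ (k,j) = 0 then 0 else Suc (degree (S $$ (k,j)))"
       arbitrary: S rule: less_induct)
  case less
  note S = less.prems
  show ?case
  proof (cases "\<exists>l. \<forall>j. k \<le> j \<longrightarrow> j < n \<longrightarrow> j \<noteq> l \<longrightarrow> S $$ (k,j) = 0")
    case True
    then show ?thesis using S col_equiv_refl[OF S(1)] by (intro exI[of _ S]) blast
  next
    case False
    then obtain p where p: "k \<le> p" "p < n" "S $$ (k,p) \<noteq> 0" by blast
    obtain q where q: "k \<le> q" "q < n" "q \<noteq> p" "S $$ (k,q) \<noteq> 0" using False by blast
    obtain u v where uv: "k \<le> u" "u < n" "k \<le> v" "v < n" "u \<noteq> v" "S $$ (k,u) \<noteq> 0" "S $$ (k,v) \<noteq> 0"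
        "degree (S $$ (k,v)) \<le> degree (S $$ (k,u))"
      using p q by (metis nat_le_linear)
    define T where "T = addcol (- (S $$ (k,u) div S $$ (k,v))) u v S"
    have T: "T \<in> carrier_mat r n" using S(1) by (simp add: T_def mat_addcol_def)
    have eq: "col_equiv n S T" unfolding T_def by (rule col_equiv_addcol) (use S uv in auto)
    have Tku: "T $$ (k,u) = S $$ (k,u) mod S $$ (k,v)"
      using S uv by (simp add: T_def minus_div_mult_eq_mod[symmetric])
    have Tk: "T $$ (k,j) = S $$ (k,j)" if "j < n" "j \<noteq> u" for j
      using S uv that by (simp add: T_def)
    have Ti: "T $$ (i,j) = of_bool (i = j)" if "i < k" "j < n" for i j
      using S uv that by (auto simp: T_def)
    define f where "f A j = (if A $$ (k,j) = 0 then 0 else Suc (degree (A $$ (k,j))))"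
      for A :: "complex poly mat" and j
    have "f T u < f S u"
    proof (cases "S $$ (k,u) mod S $$ (k,v) = 0")
      case False
      then have "degree (S $$ (k,u) mod S $$ (k,v)) < degree (S $$ (k,v))"
        using degree_mod_less[of "S $$ (k,v)" "S $$ (k,u)"] uv by auto
      then show ?thesis using uv Tku by (auto simp: f_def)
    qed (use uv Tku in \<open>auto simp: f_def\<close>)
    moreover from this have "f T j \<le> f S j" if "j < n" for j using Tk[OF that] by (cases "j = u") (auto simp: f_def)
    ultimately have "(\<Sum>j\<in>{k..<n}. f T j) < (\<Sum>j\<in>{k..<n}. f S j)"
      using uv by (intro sum_strict_mono_ex1) auto
    then obtain S' where S': "col_equiv n T S'" "\<forall>i<k. \<forall>j<n. S' $$ (i,j) = of_bool (i = j)"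
       "\<exists>l. \<forall>j. k \<le> j \<longrightarrow> j < n \<longrightarrow> j \<noteq> l \<longrightarrow> S' $$ (k,j) = 0"
      using less.hyps[of T] T Ti S(2) unfolding f_def by blast
    then show ?thesis using col_equiv_trans[OF S(1) eq S'(1)] by blast
  qed
qed

text \<open>Adding a multiple of column \<open>k\<close> to column \<open>q < k\<close> clears the
  entry in row \<open>k\<close>; the rows above do not change because column \<open>k\<close> is
  zero in them. \<open>q\<close> is the number of columns already treated.\<close>

lemma clear_row:
  fixes S :: "complex poly mat"
  assumes "S \<in> carrier_mat r n" and "k < r" "k < n"
    and "\<And>i j. i < k \<Longrightarrow> j < n \<Longrightarrow> S $$ (i,j) = of_bool (i = j)"
    and "\<And>j. k \<le> j \<Longrightarrow> j < n \<Longrightarrow> S $$ (k,j) = of_bool (k = j)"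
    and "q \<le> k"
  shows "\<exists>S'. col_equiv n S S' \<and> (\<forall>i<k. \<forall>j<n. S' $$ (i,j) = of_bool (i = j)) \<and>
     (\<forall>j<n. (k \<le> j \<or> j < q) \<longrightarrow> S' $$ (k,j) = of_bool (k = j))"
  using assms(6)
proof (induction q)
  case 0
  then show ?case using assms col_equiv_refl[OF assms(1)] by (intro exI[of _ S]) auto
next
  case (Suc q)
  then obtain S' where S': "col_equiv n S S'" "\<forall>i<k. \<forall>j<n. S' $$ (i,j) = of_bool (i = j)"
     "\<forall>j<n. (k \<le> j \<or> j < q) \<longrightarrow> S' $$ (k,j) = of_bool (k = j)" by auto
  have c: "S' \<in> carrier_mat r n" using col_equiv_carrier S'(1) assms(1) by blast
  define T where "T = addcol (- (S' $$ (k,q))) q k S'"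
  have "col_equiv n S' T" unfolding T_def by (rule col_equiv_addcol) (use c Suc.prems assms in auto)
  then have "col_equiv n S T" using col_equiv_trans[OF assms(1) S'(1)] by blast
  moreover have "\<forall>i<k. \<forall>j<n. T $$ (i,j) = of_bool (i = j)"
    using S' c Suc.prems assms by (auto simp: T_def)
  moreover have "\<forall>j<n. (k \<le> j \<or> j < Suc q) \<longrightarrow> T $$ (k,j) = of_bool (k = j)"
    using S' c Suc.prems assms by (auto simp: T_def less_Suc_eq)
  ultimately show ?case by blast
qed

text \<open>Inductive step: the pivot is constant, because at a root of it the row would be a combination
  of the preceding unit rows.\<close>
lemma primitive_rows_extend:
  fixes S :: "complex poly mat"
  assumes S: "S \<in> carrier_mat r n" and k: "k < r" and prim: "primitive_rows r n (\<lambda>i j. S $$ (i,j))"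
    and unit: "\<And>i j. i < k \<Longrightarrow> j < n \<Longrightarrow> S $$ (i,j) = of_bool (i = j)"
  shows "\<exists>S'. col_equiv n S S' \<and> (\<forall>i<Suc k. \<forall>j<n. S' $$ (i,j) = of_bool (i = j))"
proof -
  obtain A l where A: "col_equiv n S A" "\<forall>i<k. \<forall>j<n. A $$ (i,j) = of_bool (i = j)"
     "\<And>j. k \<le> j \<Longrightarrow> j < n \<Longrightarrow> j \<noteq> l \<Longrightarrow> A $$ (k,j) = 0"
    using row_reduction_step[OF S k] unit by blast
  have Ac: "A \<in> carrier_mat r n" using col_equiv_carrier A(1) S by blast
  have primA: "primitive_rows r n (\<lambda>i j. A $$ (i,j))" by (rule primitive_rows_col_equiv[OF S prim A(1)])
  \<comment> \<open>The reduction gives no range for \<open>l\<close>, so range and nonvanishing are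
    proved together: if either fails, row \<open>k\<close> is zero at \<open>z\<close> from column
    \<open>k\<close> on.\<close>
  have nz: "k \<le> l \<and> l < n \<and> poly (A $$ (k,l)) z \<noteq> 0" for z
  proof (rule ccontr)
    assume neg: "\<not> (k \<le> l \<and> l < n \<and> poly (A $$ (k,l)) z \<noteq> 0)"
    have zero: "poly (A $$ (k,j)) z = 0" if "k \<le> j" "j < n" for j
      using neg A(3)[OF that] that by (cases "j = l") auto
    \<comment> \<open>Subtracting from row \<open>k\<close> its own entries times the preceding unit
      rows clears the columns before \<open>k\<close>; this is the relation at \<open>z\<close> that
      primitivity forbids.\<close>
    define c where "c i = (if i < k then - poly (A $$ (k,i)) z else of_bool (i = k))" for i
    have "(\<Sum>i<r. c i * poly (A $$ (i,j)) z) = 0" if j: "j < n" for j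
    proof -
      have "(\<Sum>i<r. c i * poly (A $$ (i,j)) z) = (\<Sum>i<Suc k. c i * poly (A $$ (i,j)) z)"
        using k by (intro sum.mono_neutral_right) (auto simp: c_def)
      also have "\<dots> = (\<Sum>i<k. c i * poly (A $$ (i,j)) z) + poly (A $$ (k,j)) z" by (simp add: c_def)
      also have "(\<Sum>i<k. c i * poly (A $$ (i,j)) z) = (\<Sum>i<k. if i = j then - poly (A $$ (k,j)) z else 0)"
        using A(2) j by (intro sum.cong) (auto simp: c_def)
      also have "\<dots> + poly (A $$ (k,j)) z = 0" using zero[of j] j by (cases "j < k") auto
      finally show ?thesis .
    qed
    then have "c k = 0" using primA k unfolding primitive_rows_def by blast
    then show False by (simp add: c_def)
  qed
  then have l: "k \<le> l" "l < n" by blast+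
  have "constant (poly (A $$ (k,l)))"
    using fundamental_theorem_of_algebra nz by blast
  then have "degree (A $$ (k,l)) = 0" by (simp add: constant_degree)
  then obtain u where u: "A $$ (k,l) = [:u:]" using degree_eq_zeroE by metis
  have u0: "u \<noteq> 0" using nz[of 0] u by simp
  define B where "B = swapcols k l A"
  have Bc: "B \<in> carrier_mat r n" using Ac by (simp add: B_def mat_swapcols_def)
  have B: "col_equiv n S B"
    unfolding B_def using col_equiv_trans[OF S A(1) col_equiv_swapcols[OF Ac]] l by auto
  have B1: "\<forall>i<k. \<forall>j<n. B $$ (i,j) = of_bool (i = j)" "\<And>j. k \<le> j \<Longrightarrow> j < n \<Longrightarrow> B $$ (k,j) = of_bool (k = j) * [:u:]"
    using A Ac k l u by (auto simp: B_def)
  define C where "C = multcol k [:inverse u:] B"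
  have Cc: "C \<in> carrier_mat r n" using Bc by (simp add: C_def mat_multcol_def)
  have "col_equiv n B C" unfolding C_def
    by (rule col_equiv_multcol[OF Bc, where b = "[:u:]"]) (use l u0 in \<open>auto simp: one_pCons\<close>)
  then have C: "col_equiv n S C" using col_equiv_trans[OF S B] by blast
  have C1: "\<And>i j. i < k \<Longrightarrow> j < n \<Longrightarrow> C $$ (i,j) = of_bool (i = j)" "\<And>j. k \<le> j \<Longrightarrow> j < n \<Longrightarrow> C $$ (k,j) = of_bool (k = j)"
    using B1 Bc k l u0 by (auto simp: C_def one_pCons)
  obtain S' where S': "col_equiv n C S'" "\<forall>i<k. \<forall>j<n. S' $$ (i,j) = of_bool (i = j)"
     "\<forall>j<n. (k \<le> j \<or> j < k) \<longrightarrow> S' $$ (k,j) = of_bool (k = j)"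
    using clear_row[OF Cc k _ C1, of k] l by auto
  then show ?thesis using col_equiv_trans[OF S C S'(1)]
    by (intro exI[of _ S']) (auto simp: less_Suc_eq)
qed

text \<open>One unit row is created per step. Since \<open>R = (R * V) * W\<close>, the first
  \<open>r\<close> rows of the unimodular matrix \<open>W\<close> are those of \<open>R\<close>,
  which is the completion.\<close>

theorem primitive_rows_unimodular_completion:
  fixes R :: "complex poly mat"
  assumes R: "R \<in> carrier_mat r n" and prim: "primitive_rows r n (\<lambda>i j. R $$ (i,j))"
  obtains V W where "V \<in> carrier_mat n n" "W \<in> carrier_mat n n" "V * W = 1\<^sub>m n" "W * V = 1\<^sub>m n"
    "R * V = mat r n (\<lambda>(i,j). of_bool (i = j))"
proof -
  have "k \<le> r \<Longrightarrow> \<exists>S. col_equiv n R S \<and> (\<forall>i<k. \<forall>j<n. S $$ (i,j) = of_bool (i = j))" for k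
  proof (induction k)
    case 0
    then show ?case using col_equiv_refl[OF R] by auto
  next
    case (Suc k)
    then obtain S where S: "col_equiv n R S" "\<forall>i<k. \<forall>j<n. S $$ (i,j) = of_bool (i = j)" by auto
    have Sc: "S \<in> carrier_mat r n" using col_equiv_carrier S(1) R by blast
    obtain S' where "col_equiv n S S'" "\<forall>i<Suc k. \<forall>j<n. S' $$ (i,j) = of_bool (i = j)"
      using primitive_rows_extend[OF Sc _ primitive_rows_col_equiv[OF R prim S(1)], of k] S(2) Suc.prems by auto
    then show ?case using col_equiv_trans[OF R S(1)] by blast
  qed
  then obtain S where S: "col_equiv n R S" "\<forall>i<r. \<forall>j<n. S $$ (i,j) = of_bool (i = j)" by blast
  have "S \<in> carrier_mat r n" using col_equiv_carrier S(1) R by blast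
  then have "S = mat r n (\<lambda>(i,j). of_bool (i = j))" using S(2) by (intro eq_matI) auto
  then show thesis using S(1) that unfolding col_equiv_def by auto
qed

section \<open>Degree count for kernel vectors\<close>

text \<open>The coefficients are taken at the prescribed bounds \<open>dd\<close> and not at the
  actual degrees; independence then implies that every bound is attained
  (\<open>minimal_rows_row_degree\<close>).\<close>

definition leading_independent :: "nat \<Rightarrow> nat \<Rightarrow> (nat \<Rightarrow> nat) \<Rightarrow> (nat \<Rightarrow> nat \<Rightarrow> complex poly) \<Rightarrow> bool" where
  "leading_independent r n dd R \<longleftrightarrow>
     (\<forall>c. (\<forall>j<n. (\<Sum>i<r. c i * coeff (R i j) (dd i)) = 0) \<longrightarrow> (\<forall>i<r. c i = 0))"

text \<open>Forney's criterion for a minimal basis; \<open>minimal_basis_minimal_rows\<close> and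
  \<open>minimal_rows_minimal_basis_list\<close> are its two directions.\<close>

definition minimal_rows :: "nat \<Rightarrow> nat \<Rightarrow> (nat \<Rightarrow> nat) \<Rightarrow> (nat \<Rightarrow> nat \<Rightarrow> complex poly) \<Rightarrow> bool" where
  "minimal_rows r n dd R \<longleftrightarrow> (\<forall>i<r. \<forall>j<n. degree (R i j) \<le> dd i) \<and>
     primitive_rows r n R \<and> leading_independent r n dd R"

text \<open>The polynomial map cut down to finite-dimensional complex spaces, where dimensions can
  be counted.\<close>

definition surjective_upto :: "nat \<Rightarrow> nat \<Rightarrow> (nat \<Rightarrow> nat) \<Rightarrow> (nat \<Rightarrow> nat \<Rightarrow> complex poly) \<Rightarrow> nat \<Rightarrow> bool" where
  "surjective_upto r n dd R K \<longleftrightarrow> (\<forall>y. (\<forall>i<r. degree (y i) \<le> dd i + K) \<longrightarrow>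
     (\<exists>x. (\<forall>j<n. degree (x j) \<le> K) \<and> (\<forall>i<r. (\<Sum>j<n. R i j * x j) = y i)))"

lemma surjective_uptoD:
  assumes "surjective_upto r n dd R K" and "\<And>i. i < r \<Longrightarrow> degree (y i) \<le> dd i + K"
  shows "\<exists>x. (\<forall>j<n. degree (x j) \<le> K) \<and> (\<forall>i<r. (\<Sum>j<n. R i j * x j) = y i)"
  using assms unfolding surjective_upto_def by auto

lemma coeff_mult_at_bounds:
  fixes p q :: "'a::comm_semiring_0 poly"
  assumes "degree p \<le> a" and "degree q \<le> b"
  shows "coeff (p * q) (a + b) = coeff p a * coeff q b"
proof -
  have "coeff (p * q) (a + b) = (\<Sum>i\<le>a + b. coeff p i * coeff q (a + b - i))" by (rule coeff_mult)
  also have "\<dots> = (\<Sum>i\<in>{a}. coeff p i * coeff q (a + b - i))"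
  proof (rule sum.mono_neutral_right)
    show "\<forall>i\<in>{..a + b} - {a}. coeff p i * coeff q (a + b - i) = 0"
    proof
      fix i assume i: "i \<in> {..a + b} - {a}"
      show "coeff p i * coeff q (a + b - i) = 0"
      proof (cases "i < a")
        case True
        then have "degree q < a + b - i" using assms by linarith
        then show ?thesis by (simp add: coeff_eq_0)
      next
        case False
        then have "degree p < i" using assms i by auto
        then show ?thesis by (simp add: coeff_eq_0)
      qed
    qed
  qed auto
  finally show ?thesis by simp
qed

lemma degree_mult_le_bounds:
  fixes p q :: "'a::comm_semiring_0 poly"
  assumes "degree p \<le> a" and "degree q \<le> b"
  shows "degree (p * q) \<le> a + b"
  using degree_mult_le[of p q] assms by linarith

lemma primitive_rows_le:
  assumes "primitive_rows r n R"
  shows "r \<le> n"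
proof (rule ccontr)
  assume "\<not> r \<le> n"
  then obtain c where "\<exists>i\<in>{..<r}. c i \<noteq> 0" "\<forall>j\<in>{..<n}. (\<Sum>i<r. c i * poly (R i j) 0) = 0"
    using homogeneous_system_nontrivial[of "{..<n}" "{..<r}" "\<lambda>i j. poly (R i j) 0"] by auto
  then show False using assms unfolding primitive_rows_def by blast
qed

lemma primitive_rows_right_inverse:
  assumes "primitive_rows r n R"
  obtains X where "\<And>i i'. i < r \<Longrightarrow> i' < r \<Longrightarrow> (\<Sum>j<n. R i j * X j i') = of_bool (i = i')"
proof -
  define A where "A = mat r n (\<lambda>(i,j). R i j)"
  have A: "A \<in> carrier_mat r n" by (simp add: A_def)
  have "primitive_rows r n (\<lambda>i j. A $$ (i,j))" using assms by (simp add: primitive_rows_def A_def)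
  then obtain V W where V: "V \<in> carrier_mat n n" "A * V = mat r n (\<lambda>(i,j). of_bool (i = j))"
    using primitive_rows_unimodular_completion[OF A] by metis
  show thesis
  proof (rule that)
    fix i i' assume i: "i < r" "i' < r"
    then have i'n: "i' < n" using primitive_rows_le[OF assms] by simp
    have "(\<Sum>j<n. R i j * V $$ (j,i')) = (A * V) $$ (i,i')"
      unfolding index_mult_mat_sum[OF A V(1) i(1) i'n] using i by (simp add: A_def)
    then show "(\<Sum>j<n. R i j * V $$ (j,i')) = of_bool (i = i')" using V(2) i i'n by simp
  qed
qed

text \<open>Two right inverses combine. \<open>Y\<close>, for the coefficients at \<open>dd\<close>,
  removes the highest coefficients of the target one degree at a time; \<open>X\<close>, a
  polynomial one, solves for the remainder of bounded degree. The degrees of \<open>X\<close> are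
  not controlled, which is why \<open>K\<close> must be large.\<close>

lemma minimal_rows_surjective_upto:
  assumes "minimal_rows r n dd R"
  obtains K0 where "\<And>K. K \<ge> K0 \<Longrightarrow> surjective_upto r n dd R K"
proof -
  have deg: "\<And>i j. i < r \<Longrightarrow> j < n \<Longrightarrow> degree (R i j) \<le> dd i" and prim: "primitive_rows r n R"
    and lead: "leading_independent r n dd R"
    using assms by (auto simp: minimal_rows_def)
  obtain X where X: "\<And>i i'. i < r \<Longrightarrow> i' < r \<Longrightarrow> (\<Sum>j<n. R i j * X j i') = of_bool (i = i')"
    by (rule primitive_rows_right_inverse[OF prim]) blast
  have "\<exists>Y. \<forall>i\<in>{..<r}. \<forall>i'\<in>{..<r}. (\<Sum>j<n. coeff (R i j) (dd i) * Y j i') = of_bool (i = i')"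
  proof (rule independent_rows_right_inverse)
    fix c :: "nat \<Rightarrow> complex" and i
    assume "\<And>j. j \<in> {..<n} \<Longrightarrow> (\<Sum>i<r. c i * coeff (R i j) (dd i)) = 0" and "i \<in> {..<r}"
    then show "c i = 0" using lead unfolding leading_independent_def by (metis lessThan_iff)
  qed auto
  then obtain Y where Y: "\<And>i i'. i < r \<Longrightarrow> i' < r \<Longrightarrow> (\<Sum>j<n. coeff (R i j) (dd i) * Y j i') = of_bool (i = i')"
    by auto
  \<comment> \<open>A crude bound for the degree of \<open>X\<close> applied to a target whose
    \<open>i\<close>-th entry has degree at most \<open>dd i\<close>.\<close>
  define K0 where "K0 = (\<Sum>i<r. \<Sum>j<n. degree (X j i) + dd i)"
  have K0: "degree (X j i) + dd i \<le> K0" if "i < r" "j < n" for i j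
  proof -
    have "degree (X j i) + dd i \<le> (\<Sum>j<n. degree (X j i) + dd i)"
      using that by (intro member_le_sum) auto
    also have "\<dots> \<le> K0" unfolding K0_def using that by (intro member_le_sum[of i]) auto
    finally show ?thesis .
  qed
  \<comment> \<open>\<open>q\<close> is the number of degrees, counted from \<open>dd i\<close>
    upward, in which the target may still be nonzero; \<open>Suc K\<close> covers all admissible
    targets.\<close>
  have main: "\<exists>x. (\<forall>j<n. degree (x j) \<le> K) \<and> (\<forall>i<r. (\<Sum>j<n. R i j * x j) = y i)"
    if "K \<ge> K0" and "q \<le> Suc K" and "\<And>i k. i < r \<Longrightarrow> dd i + q \<le> k \<Longrightarrow> coeff (y i) k = 0" for K q y
    using that
  proof (induction q arbitrary: y)
    case 0
    have "degree (\<Sum>i<r. X j i * y i) \<le> K" if j: "j < n" for j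
    proof (rule degree_sum_le)
      fix i assume i: "i \<in> {..<r}"
      have "degree (y i) \<le> dd i" using 0 i by (intro degree_le) auto
      then show "degree (X j i * y i) \<le> K"
        using degree_mult_le[of "X j i" "y i"] K0[of i j] i j 0(1) by simp
    qed simp
    moreover have "(\<Sum>j<n. R i j * (\<Sum>i'<r. X j i' * y i')) = y i" if i: "i < r" for i
    proof -
      have "(\<Sum>j<n. R i j * (\<Sum>i'<r. X j i' * y i')) = (\<Sum>i'<r. (\<Sum>j<n. R i j * X j i') * y i')"
        unfolding sum_distrib_left sum_distrib_right by (subst sum.swap) (simp add: mult.assoc)
      also have "\<dots> = (\<Sum>i'<r. if i' = i then y i else 0)"
        using X i by (intro sum.cong) auto
      finally show ?thesis using i by simp
    qed
    ultimately show ?case by (intro exI[of _ "\<lambda>j. \<Sum>i<r. X j i * y i"]) auto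
  next
    case (Suc q)
    \<comment> \<open>One monomial vector of degree \<open>q\<close> corrects the coefficients at
      \<open>dd i + q\<close> in all rows at once.\<close>
    define x' where "x' j = monom (\<Sum>i<r. Y j i * coeff (y i) (dd i + q)) q" for j
    define y' where "y' i = y i - (\<Sum>j<n. R i j * x' j)" for i
    have dx': "degree (x' j) \<le> q" for j unfolding x'_def by (rule degree_monom_le)
    have "coeff (y' i) k = 0" if i: "i < r" and k: "dd i + q \<le> k" for i k
    proof (cases "k = dd i + q")
      case True
      have "coeff (\<Sum>j<n. R i j * x' j) k = (\<Sum>j<n. coeff (R i j) (dd i) * (\<Sum>i'<r. Y j i' * coeff (y i') (dd i' + q)))"
        unfolding True coeff_sum using deg[OF i] dx'
        by (intro sum.cong refl) (simp add: coeff_mult_at_bounds, simp add: x'_def)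
      also have "\<dots> = (\<Sum>i'<r. (\<Sum>j<n. coeff (R i j) (dd i) * Y j i') * coeff (y i') (dd i' + q))"
        unfolding sum_distrib_left sum_distrib_right by (subst sum.swap) (simp add: mult.assoc)
      also have "\<dots> = (\<Sum>i'<r. if i' = i then coeff (y i) k else 0)"
        using Y i True by (intro sum.cong) auto
      finally show ?thesis using i by (simp add: y'_def)
    next
      case False
      then have k': "dd i + q < k" using k by simp
      have "coeff (R i j * x' j) k = 0" if "j < n" for j
        using degree_mult_le_bounds[OF deg[OF i that] dx'[of j]] k' by (intro coeff_eq_0) simp
      then show ?thesis using Suc.prems(3)[of i k] i k' by (simp add: y'_def coeff_sum)
    qed
    then obtain x where x: "\<forall>j<n. degree (x j) \<le> K" "\<forall>i<r. (\<Sum>j<n. R i j * x j) = y' i"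
      using Suc.IH[of y'] Suc.prems by auto
    have "degree (x' j + x j) \<le> K" if "j < n" for j
      using dx'[of j] x(1) that Suc.prems by (intro degree_add_le) auto
    moreover have "(\<Sum>j<n. R i j * (x' j + x j)) = y i" if "i < r" for i
      using x(2) that by (simp add: distrib_left sum.distrib y'_def)
    ultimately show ?case by (intro exI[of _ "\<lambda>j. x' j + x j"]) auto
  qed
  show thesis
  proof (rule that)
    fix K assume K: "K0 \<le> K"
    show "surjective_upto r n dd R K" unfolding surjective_upto_def
    proof (intro allI impI main[OF K, of "Suc K"])
      fix y :: "nat \<Rightarrow> complex poly" and i k
      assume "\<forall>i<r. degree (y i) \<le> dd i + K" and "i < r" and "dd i + Suc K \<le> k"
      then have "degree (y i) < k" by fastforce
      then show "coeff (y i) k = 0" by (rule coeff_eq_0)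
    qed simp
  qed
qed

text \<open>Independence over the rational functions with denominators cleared, since the count
  below produces relations with polynomial coefficients.\<close>

definition poly_independent :: "nat \<Rightarrow> nat \<Rightarrow> (nat \<Rightarrow> nat \<Rightarrow> complex poly) \<Rightarrow> bool" where
  "poly_independent l n z \<longleftrightarrow> (\<forall>p. (\<forall>t<n. (\<Sum>j<l. p j * z j t) = 0) \<longrightarrow> (\<forall>j<l. p j = 0))"

text \<open>Dimension count in the complex space of vectors of degree at most \<open>K\<close>; an index \<open>j\<close> with
  \<open>e j > K\<close> contributes nothing because of truncated subtraction.\<close>
lemma kernel_degree_count:
  assumes surj: "surjective_upto r n dd R K"
    and ker: "\<And>j i. j < l \<Longrightarrow> i < r \<Longrightarrow> (\<Sum>t<n. R i t * z j t) = 0"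
    and deg: "\<And>j t. j < l \<Longrightarrow> t < n \<Longrightarrow> degree (z j t) \<le> e j"
    and ind: "poly_independent l n z"
  shows "(\<Sum>j<l. Suc K - e j) + (\<Sum>i<r. dd i + Suc K) \<le> n * Suc K"
proof (rule ccontr)
  assume neg: "\<not> ?thesis"
  define Q where "Q i k x \<longleftrightarrow> (\<forall>j<n. degree (x j) \<le> K) \<and>
     (\<forall>i'<r. (\<Sum>j<n. R i' j * x j) = (if i' = i then monom 1 k else 0))" for i k x
  define x where "x i k = (SOME x. Q i k x)" for i k
  have Qx: "Q i k (x i k)" if "i < r" "k < dd i + Suc K" for i k
  proof -
    have "degree (if i' = i then monom 1 k else 0 :: complex poly) \<le> dd i' + K" for i'
      using that degree_monom_le[of "1::complex" k] by auto
    then have "\<exists>x. Q i k x"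
      using surjective_uptoD[OF surj, of "\<lambda>i'. if i' = i then monom 1 k else 0"] unfolding Q_def by simp
    then show ?thesis unfolding x_def by (rule someI_ex)
  qed
  then have x: "\<And>i k j. i < r \<Longrightarrow> k < dd i + Suc K \<Longrightarrow> j < n \<Longrightarrow> degree (x i k j) \<le> K"
     "\<And>i k i'. i < r \<Longrightarrow> k < dd i + Suc K \<Longrightarrow> i' < r \<Longrightarrow>
        (\<Sum>j<n. R i' j * x i k j) = (if i' = i then monom 1 k else 0)"
    unfolding Q_def by simp_all
  \<comment> \<open>\<open>I1\<close> indexes the shifts of \<open>z j\<close> that keep degree at
    most \<open>K\<close>, \<open>I2\<close> the preimages \<open>x i k\<close> of single monomials.
    If the bound failed, these vectors would outnumber the dimension \<open>n * Suc K\<close> and be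
    dependent.\<close>
  define I1 where "I1 = (SIGMA j:{..<l}. {..<Suc K - e j})"
  define I2 where "I2 = (SIGMA i:{..<r}. {..<dd i + Suc K})"
  define w :: "nat \<times> nat + nat \<times> nat \<Rightarrow> nat \<Rightarrow> complex poly" where
    "w s t = (case s of Inl (j,k) \<Rightarrow> monom 1 k * z j t | Inr (i,k) \<Rightarrow> x i k t)" for s t
  have fin: "finite I1" "finite I2" by (auto simp: I1_def I2_def)
  have "card (I1 <+> I2) = (\<Sum>j<l. Suc K - e j) + (\<Sum>i<r. dd i + Suc K)"
    using fin by (simp add: card_Plus I1_def I2_def)
  moreover have "card ({..<n} \<times> {..K}) = n * Suc K" by (simp add: card_cartesian_product)
  ultimately obtain c where c: "\<exists>s\<in>I1 <+> I2. c s \<noteq> 0"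
     "\<And>t q. t < n \<Longrightarrow> q \<le> K \<Longrightarrow> (\<Sum>s\<in>I1 <+> I2. c s * coeff (w s t) q) = 0"
    using homogeneous_system_nontrivial[of "{..<n} \<times> {..K}" "I1 <+> I2" "\<lambda>s (t,q). coeff (w s t) q"] neg fin
    by auto
  have wdeg: "degree (w s t) \<le> K" if s: "s \<in> I1 <+> I2" and t: "t < n" for s t
  proof (cases s)
    case (Inl jk)
    then obtain j k where jk: "s = Inl (j,k)" "j < l" "k < Suc K - e j" using s by (auto simp: I1_def)
    have "degree (monom 1 k * z j t) \<le> k + e j"
      using degree_monom_le[of "1::complex" k] deg[OF jk(2) t] by (intro degree_mult_le_bounds)
    then show ?thesis using jk by (simp add: w_def)
  next
    case (Inr ik)
    then show ?thesis using s t x(1) by (auto simp: w_def I2_def)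
  qed
  have zero: "(\<Sum>s\<in>I1 <+> I2. smult (c s) (w s t)) = 0" if t: "t < n" for t
  proof (rule poly_eqI)
    fix q
    show "coeff (\<Sum>s\<in>I1 <+> I2. smult (c s) (w s t)) q = coeff 0 q"
    proof (cases "q \<le> K")
      case True
      then show ?thesis using c(2)[OF t True] by (simp add: coeff_sum)
    next
      case False
      have "coeff (w s t) q = 0" if "s \<in> I1 <+> I2" for s
        using wdeg[OF that t] False by (intro coeff_eq_0) simp
      then show ?thesis by (simp add: coeff_sum)
    qed
  qed
  define P where "P j = (\<Sum>k<Suc K - e j. monom (c (Inl (j,k))) k)" for j
  have split: "(\<Sum>s\<in>I1 <+> I2. smult (c s) (w s t))
      = (\<Sum>j<l. P j * z j t) + (\<Sum>i<r. \<Sum>k<dd i + Suc K. smult (c (Inr (i,k))) (x i k t))" for t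
  proof -
    have "(\<Sum>s\<in>I1 <+> I2. smult (c s) (w s t))
      = (\<Sum>(j,k)\<in>I1. smult (c (Inl (j,k))) (monom 1 k * z j t)) + (\<Sum>(i,k)\<in>I2. smult (c (Inr (i,k))) (x i k t))"
      using fin by (simp add: sum.Plus w_def case_prod_unfold)
    also have "(\<Sum>(j,k)\<in>I1. smult (c (Inl (j,k))) (monom 1 k * z j t)) = (\<Sum>j<l. P j * z j t)"
      unfolding I1_def P_def
      by (subst sum.Sigma[symmetric])
         (auto simp: sum_distrib_right smult_monom simp flip: mult_smult_left intro!: sum.cong)
    also have "(\<Sum>(i,k)\<in>I2. smult (c (Inr (i,k))) (x i k t)) = (\<Sum>i<r. \<Sum>k<dd i + Suc K. smult (c (Inr (i,k))) (x i k t))"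
      unfolding I2_def by (subst sum.Sigma[symmetric]) auto
    finally show ?thesis .
  qed
  \<comment> \<open>Applying row \<open>i\<close> of \<open>R\<close> kills the kernel vectors and
    turns the preimages into distinct monomials, so their coefficients can be read off.\<close>
  have cr: "c (Inr (i,k)) = 0" if i: "i < r" and k: "k < dd i + Suc K" for i k
  proof -
    have "0 = (\<Sum>t<n. R i t * (\<Sum>s\<in>I1 <+> I2. smult (c s) (w s t)))" using zero by simp
    also have "\<dots> = (\<Sum>t<n. R i t * (\<Sum>j<l. P j * z j t))
        + (\<Sum>t<n. R i t * (\<Sum>i'<r. \<Sum>k<dd i' + Suc K. smult (c (Inr (i',k))) (x i' k t)))"
      by (simp add: split distrib_left sum.distrib)
    also have "(\<Sum>t<n. R i t * (\<Sum>j<l. P j * z j t)) = (\<Sum>j<l. P j * (\<Sum>t<n. R i t * z j t))"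
      unfolding sum_distrib_left by (subst sum.swap) (simp add: ac_simps)
    also have "\<dots> = 0" using ker i by simp
    also have "(\<Sum>t<n. R i t * (\<Sum>i'<r. \<Sum>k<dd i' + Suc K. smult (c (Inr (i',k))) (x i' k t)))
        = (\<Sum>i'<r. \<Sum>t<n. \<Sum>k<dd i' + Suc K. smult (c (Inr (i',k))) (R i t * x i' k t))"
      unfolding sum_distrib_left mult_smult_right by (rule sum.swap)
    also have "\<dots> = (\<Sum>i'<r. \<Sum>k<dd i' + Suc K. smult (c (Inr (i',k))) (\<Sum>t<n. R i t * x i' k t))"
      by (rule sum.cong[OF refl], subst sum.swap) (simp add: smult_sum2)
    also have "\<dots> = (\<Sum>i'<r. if i' = i then (\<Sum>k<dd i + Suc K. monom (c (Inr (i,k))) k) else 0)"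
      using x(2) i by (intro sum.cong refl) (auto simp: smult_monom)
    also have "\<dots> = (\<Sum>k<dd i + Suc K. monom (c (Inr (i,k))) k)" using i by simp
    finally have "coeff (\<Sum>k<dd i + Suc K. monom (c (Inr (i,k))) k) k = 0" by simp
    then show ?thesis using k by (cases "k = dd i + K") (simp_all add: coeff_sum)
  qed
  \<comment> \<open>What remains is a polynomial relation among the \<open>z j\<close>, the scalars
    being collected in the \<open>P j\<close>.\<close>
  have "(\<Sum>j<l. P j * z j t) = 0" if t: "t < n" for t
    using zero[OF t] cr by (simp add: split)
  then have P0: "P j = 0" if "j < l" for j using ind that unfolding poly_independent_def by blast
  have cl: "c (Inl (j,k)) = 0" if j: "j < l" and k: "k < Suc K - e j" for j k
  proof -
    have "coeff (P j) k = 0" using P0[OF j] by simp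
    then show ?thesis using k by (simp add: P_def coeff_sum)
  qed
  show False using c(1) cr cl by (auto simp: I1_def I2_def)
qed

text \<open>For \<open>K\<close> beyond all \<open>e j\<close> the truncated subtraction is exact,
  and the multiples of \<open>Suc K\<close> cancel because \<open>n \<le> l + r\<close>. If the
  kernel vectors are \<open>minimal_rows\<close> as well, exchanging the roles gives the reverse
  inequality.\<close>

lemma kernel_degree_sum_ge:
  assumes R: "minimal_rows r n dd R" and l: "n \<le> l + r"
    and ker: "\<And>j i. j < l \<Longrightarrow> i < r \<Longrightarrow> (\<Sum>t<n. R i t * z j t) = 0"
    and deg: "\<And>j t. j < l \<Longrightarrow> t < n \<Longrightarrow> degree (z j t) \<le> e j"
    and ind: "poly_independent l n z"
  shows "(\<Sum>i<r. dd i) \<le> (\<Sum>j<l. e j)"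
proof -
  obtain K0 where K0: "\<And>K. K \<ge> K0 \<Longrightarrow> surjective_upto r n dd R K"
    using minimal_rows_surjective_upto[OF R] by blast
  define K where "K = K0 + (\<Sum>j<l. e j)"
  have eK: "e j \<le> Suc K" if "j < l" for j
    using member_le_sum[of j "{..<l}" e] that by (simp add: K_def)
  have "(\<Sum>j<l. Suc K - e j) + (\<Sum>i<r. dd i + Suc K) \<le> n * Suc K"
    by (rule kernel_degree_count[OF K0 ker deg ind]) (auto simp: K_def)
  moreover have "(\<Sum>j<l. Suc K - e j) + (\<Sum>j<l. e j) = (\<Sum>j<l. Suc K)"
    unfolding sum.distrib[symmetric] using eK by (intro sum.cong) auto
  moreover have "n * Suc K \<le> l * Suc K + r * Suc K"
    unfolding distrib_right[symmetric] using l by (rule mult_le_mono1)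
  moreover have "(\<Sum>i<r. dd i + Suc K) = (\<Sum>i<r. dd i) + r * Suc K"
    and "(\<Sum>j<l. Suc K) = l * Suc K"
    by (simp_all only: sum.distrib sum_constant card_lessThan of_nat_id)
  ultimately show ?thesis by linarith
qed

section \<open>Minimal bases and exchange\<close>

lemma lin_indep_list_iff:
  "lin_indep_list k vs \<longleftrightarrow>
     (\<forall>c. (\<forall>t<k. (\<Sum>i<length vs. c i * (vs ! i) $ t) = 0) \<longrightarrow> (\<forall>i<length vs. c i = 0))"
proof
  assume L: "lin_indep_list k vs"
  show "\<forall>c. (\<forall>t<k. (\<Sum>i<length vs. c i * (vs ! i) $ t) = 0) \<longrightarrow> (\<forall>i<length vs. c i = 0)"
  proof (intro allI impI)
    fix c i assume c: "\<forall>t<k. (\<Sum>i<length vs. c i * (vs ! i) $ t) = 0" and i: "i < length vs"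
    have "lincomb k (map c [0..<length vs]) vs = 0\<^sub>v k"
      using c by (intro eq_vecI) (auto simp: lincomb_def)
    then have "length (map c [0..<length vs]) = length vs \<and> lincomb k (map c [0..<length vs]) vs = 0\<^sub>v k"
      by simp
    then have "\<forall>x\<in>set (map c [0..<length vs]). x = 0" using L unfolding lin_indep_list_def by blast
    moreover have "c i \<in> set (map c [0..<length vs])" using i by simp
    ultimately show "c i = 0" by (rule bspec)
  qed
next
  assume R: "\<forall>c. (\<forall>t<k. (\<Sum>i<length vs. c i * (vs ! i) $ t) = 0) \<longrightarrow> (\<forall>i<length vs. c i = 0)"
  show "lin_indep_list k vs" unfolding lin_indep_list_def
  proof (intro allI impI)
    fix cs assume cs: "length cs = length vs \<and> lincomb k cs vs = 0\<^sub>v k"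
    have "(\<Sum>i<length vs. cs ! i * (vs ! i) $ t) = 0" if "t < k" for t
    proof -
      have "lincomb k cs vs $ t = 0" using cs that by simp
      then show ?thesis using that by (simp add: lincomb_def)
    qed
    then have "\<forall>i<length vs. cs ! i = 0" using R by blast
    then show "\<forall>c\<in>set cs. c = 0" using cs by (auto simp: in_set_conv_nth)
  qed
qed

lemma lin_indep_listD:
  assumes "lin_indep_list k vs" and "\<And>t. t < k \<Longrightarrow> (\<Sum>i<length vs. c i * (vs ! i) $ t) = 0" and "i < length vs"
  shows "c i = 0"
  using assms unfolding lin_indep_list_iff by blast

lemma span_list_iff:
  "v \<in> span_list k vs \<longleftrightarrow> v \<in> carrier_vec k \<and> (\<exists>c. \<forall>t<k. v $ t = (\<Sum>i<length vs. c i * (vs ! i) $ t))"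
proof
  assume "v \<in> span_list k vs"
  then show "v \<in> carrier_vec k \<and> (\<exists>c. \<forall>t<k. v $ t = (\<Sum>i<length vs. c i * (vs ! i) $ t))"
    unfolding span_list_def lincomb_def by auto
next
  assume "v \<in> carrier_vec k \<and> (\<exists>c. \<forall>t<k. v $ t = (\<Sum>i<length vs. c i * (vs ! i) $ t))"
  then obtain c where c: "v \<in> carrier_vec k" "\<forall>t<k. v $ t = (\<Sum>i<length vs. c i * (vs ! i) $ t)" by blast
  then have "v = lincomb k (map c [0..<length vs]) vs" by (intro eq_vecI) (auto simp: lincomb_def)
  then show "v \<in> span_list k vs" unfolding span_list_def by fastforce
qed

lemma exchange_sum:
  fixes vs :: "'a::field vec list"
  assumes "i0 < length vs" and u: "u $ t = (\<Sum>i<length vs. c i * (vs ! i) $ t)"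
  shows "(\<Sum>i<length vs. d i * (vs[i0 := u] ! i) $ t)
    = (\<Sum>i<length vs. (if i = i0 then d i0 * c i0 else d i + d i0 * c i) * (vs ! i) $ t)"
proof -
  have "(\<Sum>i<length vs. d i * (vs[i0 := u] ! i) $ t)
      = (\<Sum>i<length vs. (if i = i0 then 0 else d i * (vs ! i) $ t) + (if i = i0 then d i0 * u $ t else 0))"
    by (intro sum.cong) auto
  also have "\<dots> = (\<Sum>i<length vs. if i = i0 then 0 else d i * (vs ! i) $ t) + d i0 * u $ t"
    using assms(1) by (simp add: sum.distrib)
  also have "\<dots> = (\<Sum>i<length vs. (if i = i0 then 0 else d i * (vs ! i) $ t) + d i0 * (c i * (vs ! i) $ t))"
    by (simp add: u sum_distrib_left sum.distrib)
  also have "\<dots> = (\<Sum>i<length vs. (if i = i0 then d i0 * c i0 else d i + d i0 * c i) * (vs ! i) $ t)"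
    by (intro sum.cong) (auto simp: algebra_simps)
  finally show ?thesis .
qed

lemma exchange_basis:
  fixes vs :: "'a::field vec list"
  assumes i0: "i0 < length vs" and u: "\<And>t. t < k \<Longrightarrow> u $ t = (\<Sum>i<length vs. c i * (vs ! i) $ t)"
    and c: "c i0 \<noteq> 0" and ind: "lin_indep_list k vs"
  shows "lin_indep_list k (vs[i0 := u])" and "span_list k (vs[i0 := u]) = span_list k vs"
proof -
  note sums = exchange_sum[OF i0 u]
  show "lin_indep_list k (vs[i0 := u])" unfolding lin_indep_list_iff length_list_update
  proof (intro allI impI)
    fix d i assume d: "\<forall>t<k. (\<Sum>i<length vs. d i * (vs[i0 := u] ! i) $ t) = 0" and i: "i < length vs"
    define e where "e i = (if i = i0 then d i0 * c i0 else d i + d i0 * c i)" for i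
    have "\<forall>t<k. (\<Sum>i<length vs. e i * (vs ! i) $ t) = 0" using d sums unfolding e_def by simp
    then have e0: "e i = 0" if "i < length vs" for i using ind that unfolding lin_indep_list_iff by blast
    have "d i0 = 0" using e0[OF i0] c by (simp add: e_def)
    then show "d i = 0" using e0[OF i] by (cases "i = i0") (auto simp: e_def)
  qed
  show "span_list k (vs[i0 := u]) = span_list k vs"
  proof (intro equalityI subsetI)
    fix v assume "v \<in> span_list k (vs[i0 := u])"
    then obtain d where v: "v \<in> carrier_vec k" "\<forall>t<k. v $ t = (\<Sum>i<length vs. d i * (vs[i0 := u] ! i) $ t)"
      unfolding span_list_iff by auto
    then show "v \<in> span_list k vs" unfolding span_list_iff using sums
      by (intro conjI exI[of _ "\<lambda>i. if i = i0 then d i0 * c i0 else d i + d i0 * c i"]) auto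
  next
    fix v assume "v \<in> span_list k vs"
    then obtain e where v: "v \<in> carrier_vec k" "\<forall>t<k. v $ t = (\<Sum>i<length vs. e i * (vs ! i) $ t)"
      unfolding span_list_iff by auto
    \<comment> \<open>This inverts the change of coefficients described by
      \<open>exchange_sum\<close>.\<close>
    define d where "d i = (if i = i0 then e i0 / c i0 else e i - e i0 / c i0 * c i)" for i
    have "(if i = i0 then d i0 * c i0 else d i + d i0 * c i) = e i" for i using c by (auto simp: d_def)
    then have "(\<Sum>i<length vs. d i * (vs[i0 := u] ! i) $ t) = v $ t" if "t < k" for t
      using sums[OF that] v that by simp
    then show "v \<in> span_list k (vs[i0 := u])" unfolding span_list_iff length_list_update using v(1)
      by (intro conjI exI[of _ d]) auto
  qed
qed

lemma basis_length_le:
  fixes vs ws :: "'a::field vec list"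
  assumes ind: "lin_indep_list k vs" and sub: "\<And>i. i < length vs \<Longrightarrow> vs ! i \<in> span_list k ws"
  shows "length vs \<le> length ws"
proof (rule ccontr)
  assume neg: "\<not> ?thesis"
  have "\<forall>i. \<exists>c. i < length vs \<longrightarrow> (\<forall>t<k. vs ! i $ t = (\<Sum>j<length ws. c j * (ws ! j) $ t))"
    using sub unfolding span_list_iff by blast
  then obtain A where A: "\<And>i t. i < length vs \<Longrightarrow> t < k \<Longrightarrow> vs ! i $ t = (\<Sum>j<length ws. A i j * (ws ! j) $ t)"
    by metis
  obtain c where c: "\<exists>i\<in>{..<length vs}. c i \<noteq> 0" "\<forall>j\<in>{..<length ws}. (\<Sum>i<length vs. c i * A i j) = 0"
    using homogeneous_system_nontrivial[of "{..<length ws}" "{..<length vs}" A] neg by auto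
  have "(\<Sum>i<length vs. c i * (vs ! i) $ t) = 0" if t: "t < k" for t
  proof -
    have "(\<Sum>i<length vs. c i * (vs ! i) $ t) = (\<Sum>i<length vs. \<Sum>j<length ws. c i * A i j * (ws ! j) $ t)"
      using A t by (intro sum.cong) (auto simp: sum_distrib_left mult.assoc)
    also have "\<dots> = (\<Sum>j<length ws. (\<Sum>i<length vs. c i * A i j) * (ws ! j) $ t)"
      by (subst sum.swap) (simp add: sum_distrib_right)
    finally show ?thesis using c(2) by simp
  qed
  then show False using ind c(1) unfolding lin_indep_list_iff by blast
qed

lemma span_list_nth:
  fixes vs :: "'a::field vec list"
  assumes "i < length vs" and "vs ! i \<in> carrier_vec k"
  shows "vs ! i \<in> span_list k vs"
  unfolding span_list_iff
proof (intro conjI exI[of _ "\<lambda>j. of_bool (j = i)"] allI impI)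
  fix t assume "t < k"
  have "(\<Sum>j<length vs. of_bool (j = i) * (vs ! j) $ t) = (\<Sum>j<length vs. if j = i then (vs ! i) $ t else 0)"
    by (intro sum.cong) auto
  then show "vs ! i $ t = (\<Sum>j<length vs. of_bool (j = i) * (vs ! j) $ t)" using assms(1) by simp
qed (use assms in auto)

section \<open>Polynomial bases of subspaces over the rational functions\<close>

lemma fvec_carrier[simp]: "fvec v \<in> carrier_vec k \<longleftrightarrow> v \<in> carrier_vec k"
  by (simp add: fvec_def)

lemma nth_carrier_vec: "set bs \<subseteq> carrier_vec k \<Longrightarrow> i < length bs \<Longrightarrow> bs ! i \<in> carrier_vec k"
  using nth_mem by blast

lemma dim_nth_carrier_vec: "set bs \<subseteq> carrier_vec k \<Longrightarrow> i < length bs \<Longrightarrow> dim_vec (bs ! i) = k"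
  by (rule carrier_vecD[OF nth_carrier_vec])

lemma poly_basis_length_le:
  assumes "is_poly_basis k V bs" and "is_poly_basis k V bs'"
  shows "length bs \<le> length bs'"
proof -
  have V: "span_list k (map fvec bs') = V" "span_list k (map fvec bs) = V" and carr: "set bs \<subseteq> carrier_vec k"
    and ind: "lin_indep_list k (map fvec bs)"
    using assms unfolding is_poly_basis_def by blast+
  have "map fvec bs ! i \<in> span_list k (map fvec bs')" if "i < length (map fvec bs)" for i
    unfolding V(1) V(2)[symmetric] using that nth_carrier_vec[OF carr, of i] by (intro span_list_nth) auto
  then have "length (map fvec bs) \<le> length (map fvec bs')" by (rule basis_length_le[OF ind])
  then show ?thesis by simp
qed

lemma poly_basis_length_eq:
  "is_poly_basis k V bs \<Longrightarrow> is_poly_basis k V bs' \<Longrightarrow> length bs = length bs'"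
  using poly_basis_length_le by (metis le_antisym)

lemma lin_indep_fvec_poly_independent:
  assumes "lin_indep_list k (map fvec bs)" and "set bs \<subseteq> carrier_vec k"
  shows "poly_independent (length bs) k (\<lambda>j t. bs ! j $ t)"
  unfolding poly_independent_def
proof (intro allI impI)
  fix p :: "nat \<Rightarrow> complex poly" and j
  assume p: "\<forall>t<k. (\<Sum>j<length bs. p j * bs ! j $ t) = 0" and j: "j < length bs"
  have sum0: "(\<Sum>i<length (map fvec bs). to_fract (p i) * (map fvec bs ! i) $ t) = 0" if t: "t < k" for t
  proof -
    have "(\<Sum>i<length (map fvec bs). to_fract (p i) * (map fvec bs ! i) $ t)
        = (\<Sum>i<length bs. to_fract (p i * bs ! i $ t))"
      using t assms(2) nth_mem by (intro sum.cong) (force simp: fvec_def to_fract_mult)+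
    also have "\<dots> = to_fract (\<Sum>i<length bs. p i * bs ! i $ t)" by (simp only: to_fract_sum)
    also have "\<dots> = 0" using p t by simp
    finally show ?thesis .
  qed
  have "j < length (map fvec bs)" using j by simp
  with assms(1) sum0 have "to_fract (p j) = 0" by (rule lin_indep_listD)
  then show "p j = 0" by simp
qed

text \<open>Multiplying a rational relation by column \<open>i\<close> of \<open>X\<close> isolates
  the coefficient of vector \<open>i\<close>.\<close>

lemma right_inverse_lin_indep:
  assumes X: "\<And>i i'. i < length bs \<Longrightarrow> i' < length bs \<Longrightarrow> (\<Sum>t<k. bs ! i $ t * X t i') = of_bool (i = i')"
    and carr: "set bs \<subseteq> carrier_vec k"
  shows "lin_indep_list k (map fvec bs)"
  unfolding lin_indep_list_iff length_map
proof (intro allI impI)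
  fix c and i assume c: "\<forall>t<k. (\<Sum>i<length bs. c i * (map fvec bs ! i) $ t) = 0" and i: "i < length bs"
  have "0 = (\<Sum>t<k. (\<Sum>i'<length bs. c i' * (map fvec bs ! i') $ t) * to_fract (X t i))" using c by simp
  also have "\<dots> = (\<Sum>t<k. \<Sum>i'<length bs. c i' * to_fract (bs ! i' $ t * X t i))"
    using carr nth_mem unfolding sum_distrib_right
    by (intro sum.cong refl) (force simp: fvec_def to_fract_mult)
  also have "\<dots> = (\<Sum>i'<length bs. c i' * to_fract (\<Sum>t<k. bs ! i' $ t * X t i))"
    by (subst sum.swap) (simp add: to_fract_sum sum_distrib_left)
  also have "\<dots> = (\<Sum>i'<length bs. if i' = i then c i else 0)"
    using X i by (intro sum.cong) auto
  also have "\<dots> = c i" using i by simp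
  finally show "c i = 0" by simp
qed

text \<open>A natural-number degree, so that sums can be minimized and subtracted. It is 0 on the
  zero vector, where \<open>vdeg\<close> is minus infinity; on members of a basis the two
  agree.\<close>

definition ndeg :: "complex poly vec \<Rightarrow> nat" where
  "ndeg v = Max (insert 0 ((\<lambda>i. degree (v $ i)) ` {..<dim_vec v}))"

lemma degree_le_ndeg: "i < dim_vec v \<Longrightarrow> degree (v $ i) \<le> ndeg v"
  unfolding ndeg_def by (rule Max_ge) auto

lemma ndeg_le: "(\<And>i. i < dim_vec v \<Longrightarrow> degree (v $ i) \<le> e) \<Longrightarrow> ndeg v \<le> e"
  unfolding ndeg_def by (subst Max_le_iff) auto

lemma vdeg_le_iff: "vdeg v \<le> ereal (real e) \<longleftrightarrow> (\<forall>i<dim_vec v. degree (v $ i) \<le> e)"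
proof -
  have "vdeg v \<le> ereal (real e) \<longleftrightarrow> (\<forall>i<dim_vec v. v $ i \<noteq> 0 \<longrightarrow> degree (v $ i) \<le> e)"
    unfolding vdeg_def SUP_le_iff by auto
  also have "\<dots> \<longleftrightarrow> (\<forall>i<dim_vec v. degree (v $ i) \<le> e)" by (metis degree_0 zero_le)
  finally show ?thesis .
qed

lemma vdeg_eq_iff:
  "vdeg v = ereal (real e) \<longleftrightarrow> (\<forall>i<dim_vec v. degree (v $ i) \<le> e) \<and> (\<exists>i<dim_vec v. coeff (v $ i) e \<noteq> 0)"
proof
  assume eq: "vdeg v = ereal (real e)"
  then have le: "\<forall>i<dim_vec v. degree (v $ i) \<le> e" using vdeg_le_iff[of v e] by simp
  have "\<exists>i<dim_vec v. coeff (v $ i) e \<noteq> 0"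
  proof (rule ccontr)
    assume neg: "\<not> ?thesis"
    have "vdeg v \<le> ereal (real e - 1)" unfolding vdeg_def
    proof (rule SUP_least)
      fix i assume i: "i \<in> {i. i < dim_vec v \<and> v $ i \<noteq> 0}"
      then have "degree (v $ i) \<noteq> e" using neg leading_coeff_0_iff by blast
      then have "degree (v $ i) < e" using le i by (simp add: order_less_le)
      then show "ereal (real (degree (v $ i))) \<le> ereal (real e - 1)" by simp
    qed
    then show False using eq by simp
  qed
  then show "(\<forall>i<dim_vec v. degree (v $ i) \<le> e) \<and> (\<exists>i<dim_vec v. coeff (v $ i) e \<noteq> 0)" using le by blast
next
  assume A: "(\<forall>i<dim_vec v. degree (v $ i) \<le> e) \<and> (\<exists>i<dim_vec v. coeff (v $ i) e \<noteq> 0)"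
  then obtain i where i: "i < dim_vec v" "coeff (v $ i) e \<noteq> 0" by blast
  have "degree (v $ i) = e" using A i le_degree by (metis le_antisym)
  moreover have "v $ i \<noteq> 0" using i by auto
  ultimately have "ereal (real e) \<le> vdeg v"
    unfolding vdeg_def using i by (intro SUP_upper2[of i]) auto
  then show "vdeg v = ereal (real e)" using A vdeg_le_iff[of v e] by (simp add: antisym)
qed

lemma vdeg_eq_ndeg:
  assumes "i < dim_vec v" and "v $ i \<noteq> 0"
  shows "vdeg v = ereal (real (ndeg v))"
proof -
  let ?S = "insert 0 ((\<lambda>i. degree (v $ i)) ` {..<dim_vec v})"
  have "ndeg v \<in> ?S" unfolding ndeg_def by (rule Max_in) auto
  then have "\<exists>i<dim_vec v. coeff (v $ i) (ndeg v) \<noteq> 0"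
  proof
    assume n0: "ndeg v = 0"
    then have "degree (v $ i) = 0" using degree_le_ndeg[OF assms(1)] by simp
    then show ?thesis using assms n0 leading_coeff_0_iff by metis
  next
    assume "ndeg v \<in> (\<lambda>i. degree (v $ i)) ` {..<dim_vec v}"
    then obtain j where j: "j < dim_vec v" "ndeg v = degree (v $ j)" by auto
    show ?thesis
    proof (cases "v $ j = 0")
      case True
      then have "ndeg v = 0" using j by simp
      then have "degree (v $ i) = 0" using degree_le_ndeg[OF assms(1)] by simp
      then show ?thesis using assms \<open>ndeg v = 0\<close> leading_coeff_0_iff by metis
    qed (use j in auto)
  qed
  then show ?thesis unfolding vdeg_eq_iff using degree_le_ndeg by blast
qed

lemma vdeg_eq_imp_ndeg: "vdeg v = ereal (real e) \<Longrightarrow> ndeg v = e"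
proof -
  assume e: "vdeg v = ereal (real e)"
  then obtain i where "i < dim_vec v" "coeff (v $ i) e \<noteq> 0" unfolding vdeg_eq_iff by blast
  then have "i < dim_vec v" "v $ i \<noteq> 0" by auto
  then show ?thesis using vdeg_eq_ndeg e by simp
qed

lemma poly_independentD:
  assumes "poly_independent l n z" and "\<And>t. t < n \<Longrightarrow> (\<Sum>j<l. p j * z j t) = 0" and "j < l"
  shows "p j = 0"
  using assms unfolding poly_independent_def by blast

lemma poly_basis_vdeg:
  assumes "is_poly_basis k V bs" and i: "i < length bs"
  shows "vdeg (bs ! i) = ereal (real (ndeg (bs ! i)))"
proof -
  have c: "bs ! i \<in> carrier_vec k" and ind: "poly_independent (length bs) k (\<lambda>j t. bs ! j $ t)"
    using assms lin_indep_fvec_poly_independent unfolding is_poly_basis_def by auto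
  have "\<exists>t<k. bs ! i $ t \<noteq> 0"
  proof (rule ccontr)
    assume "\<not> ?thesis"
    then have zero: "(\<Sum>j<length bs. of_bool (j = i) * bs ! j $ t) = 0" if "t < k" for t
      using that by (intro sum.neutral) auto
    have "of_bool (i = i) = (0 :: complex poly)"
      by (rule poly_independentD[OF ind _ i, of "\<lambda>j. of_bool (j = i)"]) (rule zero)
    then show False by simp
  qed
  then obtain t where "t < k" "bs ! i $ t \<noteq> 0" by blast
  then show ?thesis using carrier_vecD[OF c] by (intro vdeg_eq_ndeg[of t]) auto
qed

lemma poly_basis_vdeg_sum:
  assumes "is_poly_basis k V bs"
  shows "sum_list (map vdeg bs) = ereal (real (\<Sum>i<length bs. ndeg (bs ! i)))"
proof -
  have "sum_list (map vdeg bs) = (\<Sum>i<length bs. vdeg (bs ! i))"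
    by (simp add: sum_list_sum_nth atLeast0LessThan)
  also have "\<dots> = (\<Sum>i<length bs. ereal (real (ndeg (bs ! i))))"
    using poly_basis_vdeg[OF assms] by (intro sum.cong) auto
  finally show ?thesis by simp
qed

text \<open>Degree sums of polynomial bases are natural numbers, so a least one exists.\<close>

lemma minimal_basis_exists:
  assumes "is_poly_basis k V bs"
  obtains bs' where "is_minimal_basis k V bs'"
proof -
  obtain bs' where "is_poly_basis k V bs'"
    "\<And>bs''. is_poly_basis k V bs'' \<Longrightarrow> (\<Sum>i<length bs'. ndeg (bs' ! i)) \<le> (\<Sum>i<length bs''. ndeg (bs'' ! i))"
    using ex_has_least_nat[of "is_poly_basis k V" bs "\<lambda>bs. \<Sum>i<length bs. ndeg (bs ! i)"] assms by blast
  then have "is_minimal_basis k V bs'"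
    unfolding is_minimal_basis_def using poly_basis_vdeg_sum by (simp del: of_nat_sum)
  then show thesis by (rule that)
qed

text \<open>If \<open>w\<close> had smaller degree than basis vector \<open>i0\<close>, it could
  replace that vector, its coordinate there being nonzero, and lower the degree sum. The factor
  \<open>q\<close> admits quotients as \<open>w\<close>. The conclusion names a nonzero coefficient
  because a degree bound would say nothing when the basis vector has degree 0.\<close>

lemma minimal_basis_exchange:
  assumes min: "is_minimal_basis k V bs" and i0: "i0 < length bs" and p: "p i0 \<noteq> 0" and q: "q \<noteq> 0"
    and eq: "\<And>t. t < k \<Longrightarrow> q * w t = (\<Sum>i<length bs. p i * bs ! i $ t)"
  shows "\<exists>t<k. \<exists>s\<ge>ndeg (bs ! i0). coeff (w t) s \<noteq> 0"
proof (rule ccontr)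
  assume neg: "\<not> ?thesis"
  have basis: "is_poly_basis k V bs" using min unfolding is_minimal_basis_def by blast
  then have carr: "set bs \<subseteq> carrier_vec k" and ind: "lin_indep_list k (map fvec bs)"
      and span: "span_list k (map fvec bs) = V"
    unfolding is_poly_basis_def by auto
  define D where "D = ndeg (bs ! i0)"
  define u where "u = vec k w"
  have ut: "fvec u $ t = (\<Sum>i<length (map fvec bs). (to_fract (p i) / to_fract q) * (map fvec bs ! i) $ t)"
    if t: "t < k" for t
  proof -
    have "(\<Sum>i<length (map fvec bs). (to_fract (p i) / to_fract q) * (map fvec bs ! i) $ t)
        = (\<Sum>i<length bs. to_fract (p i * bs ! i $ t)) / to_fract q"
      using carr nth_mem t unfolding sum_divide_distrib
      by (intro sum.cong) (force simp: fvec_def to_fract_mult)+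
    also have "\<dots> = to_fract (q * w t) / to_fract q" using eq[OF t] by (simp add: to_fract_sum)
    also have "\<dots> = fvec u $ t" using q t by (simp add: to_fract_mult u_def fvec_def)
    finally show ?thesis by simp
  qed
  have c0: "to_fract (p i0) / to_fract q \<noteq> 0" using p q by simp
  have i0': "i0 < length (map fvec bs)" using i0 by simp
  have upd: "map fvec (bs[i0 := u]) = (map fvec bs)[i0 := fvec u]" by (simp add: map_update)
  note ex = exchange_basis[OF i0' ut c0 ind]
  have "set (bs[i0 := u]) \<subseteq> carrier_vec k" using carr set_update_subset_insert[of bs i0 u] by (auto simp: u_def)
  then have basis': "is_poly_basis k V (bs[i0 := u])"
    unfolding is_poly_basis_def upd using ex span by blast
  have zero: "coeff (w t) s = 0" if "t < k" "D \<le> s" for t s using neg that unfolding D_def by blast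
  \<comment> \<open>For degree 0 all coefficients of \<open>w\<close> would vanish, against
    independence; only for \<open>D \<noteq> 0\<close> is the bound \<open>D - 1\<close> a strict
    decrease.\<close>
  have D0: "D \<noteq> 0"
  proof
    assume "D = 0"
    then have "w t = 0" if "t < k" for t using zero[OF that] by (intro poly_eqI) simp
    then have zero: "(\<Sum>i<length bs. p i * bs ! i $ t) = 0" if "t < k" for t
      using eq[OF that] that by simp
    have "p i0 = 0"
      by (rule poly_independentD[OF lin_indep_fvec_poly_independent[OF ind carr] _ i0, of p]) (rule zero)
    then show False using p by simp
  qed
  have "ndeg u \<le> D - 1"
  proof (rule ndeg_le)
    fix t assume "t < dim_vec u"
    then show "degree (u $ t) \<le> D - 1" using zero[of t] by (intro degree_le) (auto simp: u_def)
  qed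
  then have "ndeg u < ndeg (bs ! i0)" using D0 unfolding D_def by linarith
  then have "(\<Sum>i<length bs. ndeg (bs[i0 := u] ! i)) < (\<Sum>i<length bs. ndeg (bs ! i))"
    using i0 by (intro sum_strict_mono_ex1) (auto simp: nth_list_update)
  then have "sum_list (map vdeg (bs[i0 := u])) < sum_list (map vdeg bs)"
    unfolding poly_basis_vdeg_sum[OF basis] poly_basis_vdeg_sum[OF basis'] by (simp del: of_nat_sum)
  moreover have "sum_list (map vdeg bs) \<le> sum_list (map vdeg (bs[i0 := u]))"
    using min basis' unfolding is_minimal_basis_def by blast
  ultimately show False by simp
qed

text \<open>Necessity in Forney's criterion. A relation at a point \<open>z\<close> makes a
  combination divisible by the linear factor of \<open>z\<close>; a relation between leading
  coefficients makes a suitably shifted combination drop in degree. Either way an exchange would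
  shorten the basis.\<close>

lemma minimal_basis_minimal_rows:
  assumes min: "is_minimal_basis k V bs"
  shows "minimal_rows (length bs) k (\<lambda>i. ndeg (bs ! i)) (\<lambda>i t. bs ! i $ t)"
proof -
  let ?l = "length bs"
  have carr: "set bs \<subseteq> carrier_vec k"
    using min unfolding is_minimal_basis_def is_poly_basis_def by blast
  have deg: "degree (bs ! i $ t) \<le> ndeg (bs ! i)" if "i < ?l" "t < k" for i t
    using that dim_nth_carrier_vec[OF carr] by (intro degree_le_ndeg) auto
  \<comment> \<open>The vector to be replaced must have the largest degree among those that occur,
    otherwise the combination need not be shorter than it.\<close>
  have pick: "\<exists>i0<?l. c i0 \<noteq> 0 \<and> (\<forall>i<?l. c i \<noteq> 0 \<longrightarrow> ndeg (bs ! i) \<le> ndeg (bs ! i0))"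
    if "i1 < ?l" "c i1 \<noteq> 0" for c :: "nat \<Rightarrow> complex" and i1
  proof -
    define S where "S = {i. i < ?l \<and> c i \<noteq> 0}"
    have S: "finite S" "S \<noteq> {}" using that by (auto simp: S_def)
    have "Max ((\<lambda>i. ndeg (bs ! i)) ` S) \<in> (\<lambda>i. ndeg (bs ! i)) ` S" using S by (intro Max_in) auto
    then obtain i0 where i0: "i0 \<in> S" "Max ((\<lambda>i. ndeg (bs ! i)) ` S) = ndeg (bs ! i0)" by blast
    have "ndeg (bs ! i) \<le> ndeg (bs ! i0)" if "i \<in> S" for i
      unfolding i0(2)[symmetric] using that S(1) by (intro Max_ge) auto
    then show ?thesis using i0(1) unfolding S_def by blast
  qed
  have "primitive_rows ?l k (\<lambda>i t. bs ! i $ t)" unfolding primitive_rows_def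
  proof (intro allI impI, rule ccontr)
    fix z and c :: "nat \<Rightarrow> complex" and i1
    assume c: "\<forall>t<k. (\<Sum>i<?l. c i * poly (bs ! i $ t) z) = 0" and i1: "i1 < ?l" "c i1 \<noteq> 0"
    obtain i0 where i0: "i0 < ?l" "c i0 \<noteq> 0" "\<And>i. i < ?l \<Longrightarrow> c i \<noteq> 0 \<Longrightarrow> ndeg (bs ! i) \<le> ndeg (bs ! i0)"
      using pick[of i1 c, OF i1] by blast
    define g where "g t = (\<Sum>i<?l. smult (c i) (bs ! i $ t))" for t
    define w where "w t = g t div [:-z, 1:]" for t
    have gw: "[:-z, 1:] * w t = g t" if "t < k" for t
    proof -
      have "poly (g t) z = 0" using c that by (simp add: g_def poly_sum)
      then have "[:-z, 1:] dvd g t" by (simp add: poly_eq_0_iff_dvd)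
      then show ?thesis unfolding w_def by (rule dvd_mult_div_cancel)
    qed
    have dg: "degree (g t) \<le> ndeg (bs ! i0)" if "t < k" for t
      unfolding g_def
    proof (rule degree_sum_le)
      fix i assume "i \<in> {..<?l}"
      then show "degree (smult (c i) (bs ! i $ t)) \<le> ndeg (bs ! i0)"
        using deg[of i t] i0(3)[of i] that by (cases "c i = 0") auto
    qed simp
    obtain t s where ts: "t < k" "ndeg (bs ! i0) \<le> s" "coeff (w t) s \<noteq> 0"
      using minimal_basis_exchange[OF min i0(1), of "\<lambda>i. [:c i:]" "[:-z, 1:]" w] i0(2) gw
      by (auto simp: g_def)
    then have w0: "w t \<noteq> 0" by auto
    have "degree (g t) = Suc (degree (w t))"
      unfolding gw[OF ts(1), symmetric] using w0 by (subst degree_mult_eq) auto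
    then show False using dg[OF ts(1)] le_degree[OF ts(3)] ts(2) by linarith
  qed
  moreover have "leading_independent ?l k (\<lambda>i. ndeg (bs ! i)) (\<lambda>i t. bs ! i $ t)"
    unfolding leading_independent_def
  proof (intro allI impI, rule ccontr)
    fix c :: "nat \<Rightarrow> complex" and i1
    assume c: "\<forall>t<k. (\<Sum>i<?l. c i * coeff (bs ! i $ t) (ndeg (bs ! i))) = 0" and i1: "i1 < ?l" "c i1 \<noteq> 0"
    obtain i0 where i0: "i0 < ?l" "c i0 \<noteq> 0" "\<And>i. i < ?l \<Longrightarrow> c i \<noteq> 0 \<Longrightarrow> ndeg (bs ! i) \<le> ndeg (bs ! i0)"
      using pick[of i1 c, OF i1] by blast
    define D where "D = ndeg (bs ! i0)"
    \<comment> \<open>The shifts bring all terms to the common degree \<open>D\<close>, where the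
      relation \<open>c\<close> cancels them.\<close>
    define p where "p i = monom (c i) (D - ndeg (bs ! i))" for i
    define w where "w t = (\<Sum>i<?l. p i * bs ! i $ t)" for t
    obtain t s where ts: "t < k" "D \<le> s" "coeff (w t) s \<noteq> 0"
      using minimal_basis_exchange[OF min i0(1), of p 1 w] i0(2) by (auto simp: w_def p_def D_def)
    have pd: "degree (p i) \<le> D - ndeg (bs ! i)" for i unfolding p_def by (rule degree_monom_le)
    have "coeff (p i * bs ! i $ t) s = (if s = D then c i * coeff (bs ! i $ t) (ndeg (bs ! i)) else 0)"
      if i: "i < ?l" for i
    proof (cases "c i = 0")
      case False
      then have D: "D - ndeg (bs ! i) + ndeg (bs ! i) = D" using i0(3)[OF i] by (simp add: D_def)
      show ?thesis
      proof (cases "s = D")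
        case True
        have "coeff (p i * bs ! i $ t) D = coeff (p i) (D - ndeg (bs ! i)) * coeff (bs ! i $ t) (ndeg (bs ! i))"
          using coeff_mult_at_bounds[OF pd deg[OF i ts(1)]] D by metis
        then show ?thesis using True by (simp add: p_def)
      next
        case False
        have "degree (p i * bs ! i $ t) \<le> D"
          using degree_mult_le_bounds[OF pd deg[OF i ts(1)]] D by metis
        then show ?thesis using False ts(2) by (simp add: coeff_eq_0)
      qed
    qed (simp add: p_def)
    then have "coeff (w t) s = (if s = D then (\<Sum>i<?l. c i * coeff (bs ! i $ t) (ndeg (bs ! i))) else 0)"
      by (simp add: w_def coeff_sum)
    then show False using ts c by (simp split: if_splits)
  qed
  ultimately show ?thesis unfolding minimal_rows_def using deg by blast
qed

section \<open>Minimal indices of null spaces\<close>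

lemma right_nullspace_iff:
  assumes "R \<in> carrier_mat r n"
  shows "x \<in> right_nullspace R \<longleftrightarrow> x \<in> carrier_vec n \<and> (\<forall>i<r. (\<Sum>j<n. to_fract (R $$ (i,j)) * x $ j) = 0)"
proof (cases "x \<in> carrier_vec n")
  case True
  have "fmat R *\<^sub>v x = 0\<^sub>v r \<longleftrightarrow> (\<forall>i<r. (fmat R *\<^sub>v x) $ i = 0)"
  proof
    assume "\<forall>i<r. (fmat R *\<^sub>v x) $ i = 0"
    then show "fmat R *\<^sub>v x = 0\<^sub>v r" using assms by (intro eq_vecI) (auto simp: fmat_def)
  qed simp
  moreover have "(fmat R *\<^sub>v x) $ i = (\<Sum>j<n. to_fract (R $$ (i,j)) * x $ j)" if "i < r" for i
    using that True assms by (simp add: fmat_def scalar_prod_def atLeast0LessThan)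
  ultimately show ?thesis using True assms unfolding right_nullspace_def by auto
qed (use assms in \<open>auto simp: right_nullspace_def\<close>)

lemma right_nullspace_fvec:
  assumes R: "R \<in> carrier_mat r n" and v: "v \<in> carrier_vec n" and k: "fvec v \<in> right_nullspace R" and i: "i < r"
  shows "(\<Sum>t<n. R $$ (i,t) * v $ t) = 0"
proof -
  have "to_fract (\<Sum>t<n. R $$ (i,t) * v $ t) = (\<Sum>t<n. to_fract (R $$ (i,t)) * fvec v $ t)"
    unfolding to_fract_sum using v by (intro sum.cong) (auto simp: fvec_def to_fract_mult)
  also have "\<dots> = 0" using k i unfolding right_nullspace_iff[OF R] by blast
  finally show ?thesis by (simp only: to_fract_eq_0_iff)
qed

lemma poly_basis_nth_in:
  assumes "is_poly_basis k V bs" and "i < length bs"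
  shows "fvec (bs ! i) \<in> V" and "bs ! i \<in> carrier_vec k"
proof -
  have carr: "set bs \<subseteq> carrier_vec k" and V: "span_list k (map fvec bs) = V"
    using assms(1) unfolding is_poly_basis_def by blast+
  show c: "bs ! i \<in> carrier_vec k" by (rule nth_carrier_vec[OF carr assms(2)])
  have "map fvec bs ! i \<in> span_list k (map fvec bs)" using c assms(2) by (intro span_list_nth) auto
  then show "fvec (bs ! i) \<in> V" using assms(2) V by simp
qed

lemma span_fvec_coordinates:
  assumes carr: "set bs \<subseteq> carrier_vec k" and v: "v \<in> span_list k (map fvec bs)"
  obtains c where "\<And>t. t < k \<Longrightarrow> v $ t = (\<Sum>i<length bs. c i * to_fract (bs ! i $ t))"
proof -
  obtain c where c: "\<forall>t<k. v $ t = (\<Sum>i<length (map fvec bs). c i * (map fvec bs ! i) $ t)"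
    using v unfolding span_list_iff by blast
  have "(\<Sum>i<length (map fvec bs). c i * (map fvec bs ! i) $ t) = (\<Sum>i<length bs. c i * to_fract (bs ! i $ t))"
    if "t < k" for t
    using that dim_nth_carrier_vec[OF carr] by (intro sum.cong) (simp_all add: fvec_def)
  then show thesis using that[of c] c by simp
qed

lemma primitive_rows_poly_basis:
  assumes R: "R \<in> carrier_mat r n" and prim: "primitive_rows r n (\<lambda>i j. R $$ (i,j))"
  shows "is_poly_basis n (span_list n (map fvec (rows R))) (rows R)"
proof -
  have carr: "set (rows R) \<subseteq> carrier_vec n" using R by (auto simp: rows_def)
  obtain X where X: "\<And>i i'. i < r \<Longrightarrow> i' < r \<Longrightarrow> (\<Sum>j<n. R $$ (i,j) * X j i') = of_bool (i = i')"
    by (rule primitive_rows_right_inverse[OF prim]) blast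
  have "lin_indep_list n (map fvec (rows R))"
    by (rule right_inverse_lin_indep[OF _ carr, of X]) (use X R in simp)
  then show ?thesis using carr unfolding is_poly_basis_def by blast
qed

text \<open>When \<open>R * V\<close> is an identity block followed by zeros, the columns of
  \<open>V\<close> from \<open>r\<close> on lie in the null space. They span it because
  \<open>W\<close> gives coordinates with respect to the columns of \<open>V\<close>.\<close>

lemma right_nullspace_basis:
  assumes R: "R \<in> carrier_mat r n" and prim: "primitive_rows r n (\<lambda>i j. R $$ (i,j))"
  obtains bs where "is_poly_basis n (right_nullspace R) bs" and "length bs = n - r"
proof -
  obtain V W where V: "V \<in> carrier_mat n n" "W \<in> carrier_mat n n" "V * W = 1\<^sub>m n" "W * V = 1\<^sub>m n"
    "R * V = mat r n (\<lambda>(i,j). of_bool (i = j))"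
    by (rule primitive_rows_unimodular_completion[OF R prim])
  have rn: "r \<le> n" by (rule primitive_rows_le[OF prim])
  define bs where "bs = map (\<lambda>j. col V (r + j)) [0..<n - r]"
  have len: "length bs = n - r" by (simp add: bs_def)
  have bsi: "bs ! j $ t = V $$ (t, r + j)" if "j < n - r" "t < n" for j t
    using that V(1) by (simp add: bs_def)
  have carr: "set bs \<subseteq> carrier_vec n" using V(1) by (auto simp: bs_def)
  have ind: "lin_indep_list n (map fvec bs)"
  proof (rule right_inverse_lin_indep[OF _ carr])
    fix i i' assume i: "i < length bs" "i' < length bs"
    have "(\<Sum>t<n. bs ! i $ t * W $$ (r + i', t)) = (\<Sum>t<n. W $$ (r + i', t) * V $$ (t, r + i))"
      using i len by (intro sum.cong) (auto simp: bsi)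
    also have "\<dots> = (W * V) $$ (r + i', r + i)" using i len by (subst index_mult_mat_sum[OF V(2) V(1)]) auto
    also have "\<dots> = of_bool (i = i')" using i len V(4) by auto
    finally show "(\<Sum>t<n. bs ! i $ t * W $$ (r + i', t)) = of_bool (i = i')" .
  qed
  \<comment> \<open>The rows of \<open>R\<close> are the first rows of \<open>W\<close>, so the
    coordinates of a null vector begin with \<open>r\<close> zeros.\<close>
  have WR: "W $$ (q,t) = R $$ (q,t)" if "q < r" "t < n" for q t
  proof -
    have "R * V * W = R * (V * W)" by (rule assoc_mult_mat[OF R V(1,2)])
    then have "R = R * V * W" using V(3) R by simp
    then have "R $$ (q,t) = (\<Sum>p<n. (R * V) $$ (q,p) * W $$ (p,t))"
      using index_mult_mat_sum[of "R * V" r n W n q t] R V that by (metis mult_carrier_mat)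
    also have "\<dots> = (\<Sum>p<n. if p = q then W $$ (q,t) else 0)"
      using that by (intro sum.cong) (auto simp: V(5))
    finally show ?thesis using that rn by simp
  qed
  have "span_list n (map fvec bs) = right_nullspace R"
  proof (intro equalityI subsetI)
    fix x assume "x \<in> span_list n (map fvec bs)"
    then have x: "x \<in> carrier_vec n" unfolding span_list_iff by blast
    obtain c where c: "\<And>t. t < n \<Longrightarrow> x $ t = (\<Sum>i<length bs. c i * to_fract (bs ! i $ t))"
      by (rule span_fvec_coordinates[OF carr \<open>x \<in> span_list n (map fvec bs)\<close>]) blast
    have xt: "x $ t = (\<Sum>j<n - r. c j * to_fract (V $$ (t, r + j)))" if "t < n" for t
      using c[OF that] that len by (simp add: bsi)
    have "(\<Sum>t<n. to_fract (R $$ (i,t)) * x $ t) = 0" if i: "i < r" for i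
    proof -
      have "(\<Sum>t<n. to_fract (R $$ (i,t)) * x $ t) = (\<Sum>t<n. \<Sum>j<n - r. c j * to_fract (R $$ (i,t) * V $$ (t, r + j)))"
        using xt by (intro sum.cong) (auto simp: sum_distrib_left to_fract_mult ac_simps)
      also have "\<dots> = (\<Sum>j<n - r. c j * to_fract (\<Sum>t<n. R $$ (i,t) * V $$ (t, r + j)))"
        by (subst sum.swap) (simp add: to_fract_sum sum_distrib_left)
      also have "\<dots> = 0"
      proof (rule sum.neutral, rule ballI)
        fix j assume "j \<in> {..<n - r}"
        then have j: "r + j < n" by auto
        have "(\<Sum>t<n. R $$ (i,t) * V $$ (t, r + j)) = (R * V) $$ (i, r + j)"
          by (rule index_mult_mat_sum[OF R V(1) i j, symmetric])
        also have "\<dots> = 0" using i j V(5) by simp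
        finally show "c j * to_fract (\<Sum>t<n. R $$ (i,t) * V $$ (t, r + j)) = 0" by simp
      qed
      finally show ?thesis .
    qed
    then show "x \<in> right_nullspace R" using x right_nullspace_iff[OF R] by blast
  next
    fix x assume "x \<in> right_nullspace R"
    then have x: "x \<in> carrier_vec n" "\<And>i. i < r \<Longrightarrow> (\<Sum>j<n. to_fract (R $$ (i,j)) * x $ j) = 0"
      unfolding right_nullspace_iff[OF R] by blast+
    define c where "c q = (\<Sum>t<n. to_fract (W $$ (q,t)) * x $ t)" for q
    have c0: "c q = 0" if "q < r" for q
      using x(2)[OF that] WR[OF that] by (simp add: c_def)
    have xs: "x $ s = (\<Sum>i<length (map fvec bs). c (r + i) * (map fvec bs ! i) $ s)" if s: "s < n" for s
    proof -
      have "x $ s = (\<Sum>t<n. if t = s then x $ t else 0)" using s by simp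
      also have "\<dots> = (\<Sum>t<n. to_fract ((V * W) $$ (s,t)) * x $ t)"
        using V(3) s by (intro sum.cong) auto
      also have "\<dots> = (\<Sum>t<n. \<Sum>q<n. to_fract (V $$ (s,q)) * (to_fract (W $$ (q,t)) * x $ t))"
        using index_mult_mat_sum[OF V(1,2) s]
        by (intro sum.cong) (auto simp: to_fract_sum to_fract_mult sum_distrib_left sum_distrib_right mult.assoc)
      also have "\<dots> = (\<Sum>q<n. to_fract (V $$ (s,q)) * c q)"
        by (subst sum.swap) (simp add: c_def sum_distrib_left)
      also have "\<dots> = (\<Sum>q\<in>{r..<n}. to_fract (V $$ (s,q)) * c q)"
        using c0 by (intro sum.mono_neutral_right) auto
      also have "\<dots> = (\<Sum>i<n - r. to_fract (V $$ (s,r + i)) * c (r + i))"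
        using sum.shift_bounds_nat_ivl[of "\<lambda>q. to_fract (V $$ (s,q)) * c q" 0 r "n - r"] rn
        by (simp add: add.commute atLeast0LessThan)
      also have "\<dots> = (\<Sum>i<length (map fvec bs). c (r + i) * (map fvec bs ! i) $ s)"
        using s dim_nth_carrier_vec[OF carr] len by (intro sum.cong) (simp_all add: fvec_def bsi mult.commute)
      finally show ?thesis .
    qed
    show "x \<in> span_list n (map fvec bs)" unfolding span_list_iff
      by (intro conjI x(1) exI[of _ "\<lambda>i. c (r + i)"] allI impI xs)
  qed
  then show thesis using that[of bs] carr ind len unfolding is_poly_basis_def by blast
qed

lemma minimal_rows_poly_independent:
  assumes "minimal_rows r n dd R"
  shows "poly_independent r n R"
proof -
  have "primitive_rows r n R" using assms unfolding minimal_rows_def by blast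
  then obtain X where X: "\<And>i i'. i < r \<Longrightarrow> i' < r \<Longrightarrow> (\<Sum>j<n. R i j * X j i') = of_bool (i = i')"
    by (rule primitive_rows_right_inverse) blast
  show ?thesis unfolding poly_independent_def
  proof (intro allI impI)
    fix p i assume p: "\<forall>t<n. (\<Sum>j<r. p j * R j t) = 0" and i: "i < r"
    have "0 = (\<Sum>t<n. (\<Sum>j<r. p j * R j t) * X t i)" using p by simp
    also have "\<dots> = (\<Sum>j<r. p j * (\<Sum>t<n. R j t * X t i))"
      unfolding sum_distrib_right sum_distrib_left by (subst sum.swap) (simp add: mult.assoc)
    also have "\<dots> = (\<Sum>j<r. if j = i then p i else 0)" using X i by (intro sum.cong) auto
    also have "\<dots> = p i" using i by simp
    finally show "p i = 0" by simp
  qed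
qed

lemma right_nullspace_minimal_basis:
  assumes R: "R \<in> carrier_mat r n" and prim: "primitive_rows r n (\<lambda>i j. R $$ (i,j))"
  obtains bs where "is_minimal_basis n (right_nullspace R) bs" and "length bs = n - r"
    and "\<And>i j. i < r \<Longrightarrow> j < n - r \<Longrightarrow> (\<Sum>t<n. R $$ (i,t) * bs ! j $ t) = 0"
proof -
  obtain bs where bs: "is_poly_basis n (right_nullspace R) bs" "length bs = n - r"
    by (rule right_nullspace_basis[OF R prim])
  obtain bs' where bs': "is_minimal_basis n (right_nullspace R) bs'"
    by (rule minimal_basis_exists[OF bs(1)])
  then have b: "is_poly_basis n (right_nullspace R) bs'" unfolding is_minimal_basis_def by blast
  have len: "length bs' = n - r" using poly_basis_length_eq[OF b bs(1)] bs(2) by simp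
  show thesis
  proof (rule that[OF bs' len])
    fix i j assume "i < r" "j < n - r"
    then show "(\<Sum>t<n. R $$ (i,t) * bs' ! j $ t) = 0"
      using poly_basis_nth_in[OF b, of j] len by (intro right_nullspace_fvec[OF R]) auto
  qed
qed

text \<open>Independence rules out a row whose coefficients at \<open>dd i\<close> all vanish, so
  the degree bound is attained.\<close>

lemma minimal_rows_row_degree:
  assumes R: "R \<in> carrier_mat r n" and min: "minimal_rows r n dd (\<lambda>i j. R $$ (i,j))" and i: "i < r"
  shows "vdeg (row R i) = ereal (real (dd i))"
proof -
  have "\<exists>j<n. coeff (R $$ (i,j)) (dd i) \<noteq> 0"
  proof (rule ccontr)
    assume neg: "\<not> ?thesis"
    have "(\<Sum>i'<r. of_bool (i' = i) * coeff (R $$ (i',j)) (dd i')) = 0" if "j < n" for j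
      using neg that by (intro sum.neutral) auto
    then have "(of_bool (i = i) :: complex) = 0"
      using min[unfolded minimal_rows_def leading_independent_def, THEN conjunct2, THEN conjunct2,
        THEN spec, of "\<lambda>i'. of_bool (i' = i)"] i by blast
    then show False by simp
  qed
  then show ?thesis unfolding vdeg_eq_iff using R min i by (auto simp: minimal_rows_def)
qed

text \<open>Sufficiency in Forney's criterion. With \<open>N\<close> a minimal basis of the null
  space, the degree sum of \<open>R\<close> is at most that of \<open>N\<close>; as \<open>N\<close>
  is \<open>minimal_rows\<close> too, its sum is at most that of any basis of the row space of
  \<open>R\<close>, because \<open>N\<close> annihilates such a basis.\<close>

lemma minimal_rows_minimal_basis_list:
  assumes R: "R \<in> carrier_mat r n" and min: "minimal_rows r n dd (\<lambda>i j. R $$ (i,j))"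
  shows "is_minimal_basis_list n (rows R)"
proof -
  have prim: "primitive_rows r n (\<lambda>i j. R $$ (i,j))" using min unfolding minimal_rows_def by blast
  obtain N where N: "is_minimal_basis n (right_nullspace R) N" "length N = n - r"
     "\<And>i j. i < r \<Longrightarrow> j < n - r \<Longrightarrow> (\<Sum>t<n. R $$ (i,t) * N ! j $ t) = 0"
    by (rule right_nullspace_minimal_basis[OF R prim]) blast
  have minN: "minimal_rows (n - r) n (\<lambda>j. ndeg (N ! j)) (\<lambda>j t. N ! j $ t)"
    using minimal_basis_minimal_rows[OF N(1)] N(2) by simp
  have rn: "r \<le> n" by (rule primitive_rows_le[OF prim])
  have indN: "poly_independent (n - r) n (\<lambda>j t. N ! j $ t)" by (rule minimal_rows_poly_independent[OF minN])
  have degN: "degree (N ! j $ t) \<le> ndeg (N ! j)" if "j < n - r" "t < n" for j t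
    using minN that unfolding minimal_rows_def by blast
  have le1: "(\<Sum>i<r. dd i) \<le> (\<Sum>j<n - r. ndeg (N ! j))"
    using rn N(3) by (intro kernel_degree_sum_ge[OF min _ _ degN indN]) auto
  let ?bs = "rows R"
  have len: "length ?bs = r" using R by simp
  have carr: "set ?bs \<subseteq> carrier_vec n" using R by (auto simp: rows_def)
  note basis = primitive_rows_poly_basis[OF R prim]
  show ?thesis unfolding is_minimal_basis_list_def is_minimal_basis_def
  proof (intro conjI allI impI basis)
    fix bs' assume b': "is_poly_basis n (span_list n (map fvec ?bs)) bs'"
    have len': "length bs' = r" using poly_basis_length_eq[OF basis b'] len by simp
    have c': "set bs' \<subseteq> carrier_vec n" and ind': "lin_indep_list n (map fvec bs')"
      using b' unfolding is_poly_basis_def by blast+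
    have ker: "(\<Sum>t<n. N ! i $ t * bs' ! j $ t) = 0" if j: "j < r" and i: "i < n - r" for j i
    proof -
      have "fvec (bs' ! j) \<in> span_list n (map fvec ?bs)" using poly_basis_nth_in[OF b'] j len' by simp
      then obtain c where c: "\<And>t. t < n \<Longrightarrow> fvec (bs' ! j) $ t = (\<Sum>i<length ?bs. c i * to_fract (?bs ! i $ t))"
        by (rule span_fvec_coordinates[OF carr]) blast
      have ct: "to_fract (bs' ! j $ t) = (\<Sum>i<r. c i * to_fract (R $$ (i,t)))" if "t < n" for t
        using c[OF that] that dim_nth_carrier_vec[OF c'] j len' R by (simp add: fvec_def)
      have "to_fract (\<Sum>t<n. N ! i $ t * bs' ! j $ t) = (\<Sum>t<n. \<Sum>i'<r. c i' * to_fract (R $$ (i',t) * N ! i $ t))"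
        using ct unfolding to_fract_sum
        by (intro sum.cong) (auto simp: to_fract_mult sum_distrib_left ac_simps)
      also have "\<dots> = (\<Sum>i'<r. c i' * to_fract (\<Sum>t<n. R $$ (i',t) * N ! i $ t))"
        by (subst sum.swap) (simp add: to_fract_sum sum_distrib_left)
      also have "\<dots> = 0" using N(3) i by (intro sum.neutral) auto
      finally show ?thesis by (simp only: to_fract_eq_0_iff)
    qed
    have "(\<Sum>j<n - r. ndeg (N ! j)) \<le> (\<Sum>i<r. ndeg (bs' ! i))"
    proof (rule kernel_degree_sum_ge[OF minN _ ker, where e = "\<lambda>i. ndeg (bs' ! i)"])
      show "poly_independent r n (\<lambda>j t. bs' ! j $ t)"
        using lin_indep_fvec_poly_independent[OF ind' c'] len' by simp
    next
      fix j t assume "j < r" "t < n"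
      then show "degree (bs' ! j $ t) \<le> ndeg (bs' ! j)"
        using dim_nth_carrier_vec[OF c'] len' by (intro degree_le_ndeg) auto
    qed (use rn in auto)
    moreover have "(\<Sum>i<r. ndeg (?bs ! i)) = (\<Sum>i<r. dd i)"
      using vdeg_eq_imp_ndeg[OF minimal_rows_row_degree[OF R min]] R by (intro sum.cong) auto
    ultimately have "(\<Sum>i<length ?bs. ndeg (?bs ! i)) \<le> (\<Sum>i<length bs'. ndeg (bs' ! i))"
      unfolding len len' using le1 by linarith
    then show "sum_list (map vdeg ?bs) \<le> sum_list (map vdeg bs')"
      unfolding poly_basis_vdeg_sum[OF basis] poly_basis_vdeg_sum[OF b'] by (simp del: of_nat_sum)
  qed
qed

text \<open>The injectivity part is phrased with coefficients so that for \<alpha> = 0 it concerns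
  the zero vector only; a bound on the degree could not express this.\<close>

definition generic_rows :: "nat \<Rightarrow> nat \<Rightarrow> (nat \<Rightarrow> nat) \<Rightarrow> nat \<Rightarrow> (nat \<Rightarrow> nat \<Rightarrow> complex poly) \<Rightarrow> bool" where
  "generic_rows r n dd \<alpha> R \<longleftrightarrow> (\<forall>i<r. \<forall>j<n. degree (R i j) \<le> dd i) \<and> surjective_upto r n dd R \<alpha> \<and>
     (\<forall>x. (\<forall>j<n. \<forall>k\<ge>\<alpha>. coeff (x j) k = 0) \<longrightarrow> (\<forall>i<r. (\<Sum>j<n. R i j * x j) = 0) \<longrightarrow> (\<forall>j<n. x j = 0))"

text \<open>A relation \<open>c\<close> is paired with a preimage: that of the constant unit vector
  \<open>i\<close> for values at a point, that of \<open>monom 1 (dd i + \<alpha>)\<close> in row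
  \<open>i\<close> for the coefficients at \<open>dd\<close>. Both pairings leave
  \<open>c i = 0\<close>.\<close>

lemma generic_rows_minimal_rows:
  assumes "generic_rows r n dd \<alpha> R"
  shows "minimal_rows r n dd R"
proof -
  have deg: "\<And>i j. i < r \<Longrightarrow> j < n \<Longrightarrow> degree (R i j) \<le> dd i" and surj: "surjective_upto r n dd R \<alpha>"
    using assms by (auto simp: generic_rows_def)
  have "primitive_rows r n R" unfolding primitive_rows_def
  proof (intro allI impI)
    fix z and c :: "nat \<Rightarrow> complex" and i
    assume c: "\<forall>j<n. (\<Sum>i<r. c i * poly (R i j) z) = 0" and i: "i < r"
    have "\<exists>x. (\<forall>j<n. degree (x j) \<le> \<alpha>) \<and> (\<forall>i'<r. (\<Sum>j<n. R i' j * x j) = (if i' = i then 1 else 0))"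
      by (rule surjective_uptoD[OF surj]) auto
    then obtain x where x: "\<forall>i'<r. (\<Sum>j<n. R i' j * x j) = (if i' = i then 1 else 0)" by blast
    have "0 = (\<Sum>j<n. (\<Sum>i'<r. c i' * poly (R i' j) z) * poly (x j) z)" using c by simp
    also have "\<dots> = (\<Sum>i'<r. c i' * poly (\<Sum>j<n. R i' j * x j) z)"
      unfolding sum_distrib_right poly_sum sum_distrib_left by (subst sum.swap) (simp add: mult.assoc)
    also have "\<dots> = (\<Sum>i'<r. if i' = i then c i else 0)" using x by (intro sum.cong) auto
    also have "\<dots> = c i" using i by simp
    finally show "c i = 0" by simp
  qed
  moreover have "leading_independent r n dd R" unfolding leading_independent_def
  proof (intro allI impI)
    fix c :: "nat \<Rightarrow> complex" and i
    assume c: "\<forall>j<n. (\<Sum>i<r. c i * coeff (R i j) (dd i)) = 0" and i: "i < r"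
    have "\<exists>x. (\<forall>j<n. degree (x j) \<le> \<alpha>) \<and>
        (\<forall>i'<r. (\<Sum>j<n. R i' j * x j) = (if i' = i then monom 1 (dd i + \<alpha>) else 0))"
      by (rule surjective_uptoD[OF surj]) (auto simp: degree_monom_le)
    then obtain x where x: "\<forall>j<n. degree (x j) \<le> \<alpha>"
       "\<forall>i'<r. (\<Sum>j<n. R i' j * x j) = (if i' = i then monom 1 (dd i + \<alpha>) else 0)"
      by blast
    have top: "(\<Sum>j<n. coeff (R i' j) (dd i') * coeff (x j) \<alpha>) = of_bool (i' = i)" if i': "i' < r" for i'
    proof -
      have "(\<Sum>j<n. coeff (R i' j) (dd i') * coeff (x j) \<alpha>) = coeff (\<Sum>j<n. R i' j * x j) (dd i' + \<alpha>)"
        unfolding coeff_sum using deg[OF i'] x(1) by (intro sum.cong) (auto simp: coeff_mult_at_bounds)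
      then show ?thesis using x(2) i' by auto
    qed
    have "0 = (\<Sum>j<n. (\<Sum>i'<r. c i' * coeff (R i' j) (dd i')) * coeff (x j) \<alpha>)" using c by simp
    also have "\<dots> = (\<Sum>i'<r. c i' * (\<Sum>j<n. coeff (R i' j) (dd i') * coeff (x j) \<alpha>))"
      unfolding sum_distrib_right sum_distrib_left by (subst sum.swap) (simp add: mult.assoc)
    also have "\<dots> = (\<Sum>i'<r. if i' = i then c i else 0)" using top by (intro sum.cong) auto
    also have "\<dots> = c i" using i by simp
    finally show "c i = 0" by simp
  qed
  ultimately show ?thesis unfolding minimal_rows_def using deg by blast
qed

lemma mset_map_two_values:
  assumes "\<And>j. j < l \<Longrightarrow> f j = (0::nat) \<or> f j = 1"
  shows "mset (map (\<lambda>j. if f j = 1 then x else y) [0..<l]) = replicate_mset (\<Sum>j<l. f j) x + replicate_mset (l - (\<Sum>j<l. f j)) y"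
  using assms
proof (induction l)
  case (Suc l)
  have "f j \<le> 1" if "j \<in> {..<l}" for j using Suc.prems[of j] that by auto
  then have "(\<Sum>j<l. f j) \<le> (\<Sum>j<l. 1)" by (rule sum_mono)
  then have le: "(\<Sum>j<l. f j) \<le> l" by simp
  then have "Suc l - (\<Sum>j<l. f j) = Suc (l - (\<Sum>j<l. f j))" by (rule Suc_diff_le)
  moreover have "mset (map (\<lambda>j. if f j = 1 then x else y) [0..<l])
      = replicate_mset (\<Sum>j<l. f j) x + replicate_mset (l - (\<Sum>j<l. f j)) y"
    by (rule Suc.IH, rule Suc.prems) simp
  moreover have "f l = 0 \<or> f l = 1" using Suc.prems by simp
  ultimately show ?case by (elim disjE) simp_all
qed simp

text \<open>With \<open>l = n - r\<close> and indices \<open>e j\<close>: injectivity gives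
  \<open>e j \<ge> \<alpha>\<close>, the count at \<open>K = \<alpha>\<close> leaves room for at
  most \<open>l - s\<close> indices equal to \<alpha>, and the sum is at most
  \<open>a = l * \<alpha> + s\<close>. Only one distribution satisfies all three.\<close>

theorem generic_rows_nullspace_indices:
  assumes R: "R \<in> carrier_mat r n" and rn: "r < n" and a: "a = (\<Sum>i<r. dd i)"
    and gen: "generic_rows r n dd (a div (n - r)) (\<lambda>i j. R $$ (i,j))"
  shows "has_minimal_indices n (right_nullspace R) (mi_spec (n - r) (a div (n - r)) (a mod (n - r)))"
proof -
  define l where "l = n - r"
  define \<alpha> where "\<alpha> = a div l"
  define s where "s = a mod l"
  have l: "l > 0" "n = l + r" using rn by (auto simp: l_def)
  have as: "a = l * \<alpha> + s" "s < l" using l by (auto simp: \<alpha>_def s_def)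
  have gen': "generic_rows r n dd \<alpha> (\<lambda>i j. R $$ (i,j))" using gen by (simp add: \<alpha>_def l_def)
  note min = generic_rows_minimal_rows[OF gen']
  have surj: "surjective_upto r n dd (\<lambda>i j. R $$ (i,j)) \<alpha>"
    and degR: "\<And>i j. i < r \<Longrightarrow> j < n \<Longrightarrow> degree (R $$ (i,j)) \<le> dd i"
    and inj: "\<And>x j. (\<forall>j<n. \<forall>k\<ge>\<alpha>. coeff (x j) k = 0) \<Longrightarrow> (\<forall>i<r. (\<Sum>j<n. R $$ (i,j) * x j) = 0) \<Longrightarrow> j < n \<Longrightarrow> x j = 0"
    using gen' unfolding generic_rows_def by blast+
  have prim: "primitive_rows r n (\<lambda>i j. R $$ (i,j))" using min unfolding minimal_rows_def by blast
  obtain N where N: "is_minimal_basis n (right_nullspace R) N" "length N = l"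
     "\<And>i j. i < r \<Longrightarrow> j < l \<Longrightarrow> (\<Sum>t<n. R $$ (i,t) * N ! j $ t) = 0"
    unfolding l_def by (rule right_nullspace_minimal_basis[OF R prim]) blast
  define e where "e j = ndeg (N ! j)" for j
  have minN: "minimal_rows l n e (\<lambda>j t. N ! j $ t)"
    using minimal_basis_minimal_rows[OF N(1)] N(2) by (simp add: e_def[abs_def])
  have indN: "poly_independent l n (\<lambda>j t. N ! j $ t)" by (rule minimal_rows_poly_independent[OF minN])
  have degN: "degree (N ! j $ t) \<le> e j" if "j < l" "t < n" for j t
    using minN that unfolding minimal_rows_def by blast
  \<comment> \<open>The roles are exchanged: the rows of \<open>R\<close> serve as kernel vectors of
    the minimal basis \<open>N\<close>.\<close>
  have le_a: "(\<Sum>j<l. e j) \<le> a" unfolding a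
  proof (rule kernel_degree_sum_ge[OF minN _ _ degR])
    fix j i assume "j < r" "i < l"
    then show "(\<Sum>t<n. N ! i $ t * R $$ (j,t)) = 0" using N(3)[of j i] by (simp add: mult.commute)
  qed (use l minimal_rows_poly_independent[OF min] in auto)
  have ge: "\<alpha> \<le> e j" if j: "j < l" for j
  proof (rule ccontr)
    assume neg: "\<not> \<alpha> \<le> e j"
    have small: "\<forall>t<n. \<forall>k\<ge>\<alpha>. coeff (N ! j $ t) k = 0"
    proof (intro allI impI)
      fix t k assume "t < n" "\<alpha> \<le> k"
      then have "degree (N ! j $ t) < k" using degN[OF j, of t] neg by linarith
      then show "coeff (N ! j $ t) k = 0" by (rule coeff_eq_0)
    qed
    have zero: "N ! j $ t = 0" if "t < n" for t
      using inj[of "\<lambda>t. N ! j $ t" t] small N(3) j that by blast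
    have sum0: "(\<Sum>i<l. of_bool (i = j) * N ! i $ t) = 0" if "t < n" for t
      using zero[OF that] by (intro sum.neutral) auto
    have "of_bool (j = j) = (0 :: complex poly)"
      by (rule poly_independentD[OF indN _ j, of "\<lambda>i. of_bool (i = j)"]) (rule sum0)
    then show False by simp
  qed
  \<comment> \<open>Given \<open>ge\<close>, this is 1 for an index equal to \<alpha> and, by
    truncation, 0 for a larger one.\<close>
  define f where "f j = Suc \<alpha> - e j" for j
  have "(\<Sum>j<l. f j) + (\<Sum>i<r. dd i + Suc \<alpha>) \<le> n * Suc \<alpha>"
    unfolding f_def using N(3) by (intro kernel_degree_count[OF surj _ degN indN]) auto
  moreover have "(\<Sum>i<r. dd i + Suc \<alpha>) = a + r * Suc \<alpha>"
    unfolding a by (simp only: sum.distrib sum_constant card_lessThan of_nat_id)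
  moreover have "n * Suc \<alpha> = l * \<alpha> + l + r * Suc \<alpha>" by (simp add: l(2) algebra_simps)
  ultimately have f_le: "(\<Sum>j<l. f j) + s \<le> l" using as by linarith
  have f01: "f j = 0 \<or> f j = 1" if "j < l" for j using ge[OF that] by (auto simp: f_def)
  \<comment> \<open>Each \<open>e j + f j\<close> is at least \<open>Suc \<alpha>\<close>, so this
    bound on the sum forces equality in every term.\<close>
  have "(\<Sum>j<l. e j + f j) \<le> (\<Sum>j<l. Suc \<alpha>)"
    using le_a f_le as by (simp add: sum.distrib)
  then have "e j + f j = Suc \<alpha>" if "j < l" for j
  proof -
    have g: "\<And>j. j \<in> {..<l} \<Longrightarrow> Suc \<alpha> \<le> e j + f j" by (auto simp: f_def)
    then have "(\<Sum>j<l. Suc \<alpha>) \<le> (\<Sum>j<l. e j + f j)" by (rule sum_mono)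
    with \<open>(\<Sum>j<l. e j + f j) \<le> (\<Sum>j<l. Suc \<alpha>)\<close> have "(\<Sum>j<l. Suc \<alpha>) = (\<Sum>j<l. e j + f j)" by simp
    then show ?thesis using sum_mono_inv[of "\<lambda>_. Suc \<alpha>" "{..<l}" "\<lambda>j. e j + f j" j] g that by auto
  qed
  note ef = this
  have "(\<Sum>j<l. e j + f j) = (\<Sum>j<l. Suc \<alpha>)" using ef by (intro sum.cong) auto
  then have "(\<Sum>j<l. e j) + (\<Sum>j<l. f j) = l * Suc \<alpha>" by (simp add: sum.distrib)
  then have sf: "(\<Sum>j<l. f j) = l - s" using le_a f_le as by simp
  have basis: "is_poly_basis n (right_nullspace R) N" using N(1) unfolding is_minimal_basis_def by blast
  have "map vdeg N = map (\<lambda>j. if f j = 1 then ereal (real \<alpha>) else ereal (real (\<alpha> + 1))) [0..<l]"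
  proof (rule nth_equalityI)
    fix j assume "j < length (map vdeg N)"
    then have j: "j < l" using N(2) by simp
    have "vdeg (N ! j) = ereal (real (e j))" unfolding e_def using poly_basis_vdeg[OF basis] j N(2) by simp
    moreover have "e j = (if f j = 1 then \<alpha> else \<alpha> + 1)" using ef[OF j] f01[OF j] by auto
    ultimately show "map vdeg N ! j = map (\<lambda>j. if f j = 1 then ereal (real \<alpha>) else ereal (real (\<alpha> + 1))) [0..<l] ! j"
      using j N(2) by simp
  qed (simp add: N(2))
  then have "mset (map vdeg N) = replicate_mset (l - s) (ereal (real \<alpha>)) + replicate_mset s (ereal (real (\<alpha> + 1)))"
    using mset_map_two_values[of l f "ereal (real \<alpha>)" "ereal (real (\<alpha> + 1))"] f01 sf as by simp
  also have "\<dots> = mi_spec l \<alpha> s" unfolding mi_spec_def by (rule add.commute)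
  finally show ?thesis
    unfolding has_minimal_indices_def using N(1) by (auto simp: l_def \<alpha>_def s_def)
qed

section \<open>Generic rows: existence and density\<close>

lemma sum_lessThan_add:
  fixes f :: "nat \<Rightarrow> 'a::comm_monoid_add"
  shows "(\<Sum>j<m + k. f j) = (\<Sum>j<m. f j) + (\<Sum>q<k. f (m + q))"
  by (induction k) (simp_all add: add.assoc)

lemma poly_eq_sum_monom:
  assumes "\<And>k. m \<le> k \<Longrightarrow> coeff p k = 0"
  shows "p = (\<Sum>k<m. monom (coeff p k) k)"
  using assms by (intro poly_eqI) (auto simp: coeff_sum not_less)

text \<open>The witness glues the row intervals \<open>[D i, D (i + 1)]\<close> of \<open>[0, a]\<close> end to end by the first
  \<open>r - 1\<close> columns; the remaining columns are monomials placed at breakpoints with gaps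
  \<open>\<alpha>\<close> or \<open>\<alpha> + 1\<close>.\<close>
locale zigzag =
  fixes r l :: nat and dd :: "nat \<Rightarrow> nat" and D \<beta> \<iota> :: "nat \<Rightarrow> nat" and \<alpha> :: nat
  assumes r: "0 < r"
    and D0: "D 0 = 0" and DS: "\<And>i. D (Suc i) = D i + dd i"
    and \<beta>0: "\<beta> 0 = 0" and \<beta>l: "\<beta> l = D r"
    and \<beta>_ge: "\<And>q. \<beta> q + \<alpha> \<le> \<beta> (Suc q)" and \<beta>_le: "\<And>q. \<beta> (Suc q) \<le> \<beta> q + Suc \<alpha>"
    and \<iota>: "\<And>q. q \<le> l \<Longrightarrow> \<iota> q < r \<and> D (\<iota> q) \<le> \<beta> q \<and> \<beta> q \<le> D (Suc (\<iota> q))"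
begin

text \<open>Column \<open>j < r - 1\<close> holds the end of interval \<open>j\<close> in row
  \<open>j\<close> and the start of interval \<open>j + 1\<close> in the next row, which are the
  same point \<open>D (Suc j)\<close>. Column \<open>r - 1 + q\<close> marks breakpoint
  \<open>\<beta> q\<close> in a row whose interval contains it. The \<open>l + 1\<close> breakpoints
  and \<open>r - 1\<close> glue columns make \<open>n\<close> columns.\<close>

definition Z :: "nat \<Rightarrow> nat \<Rightarrow> complex poly" where
  "Z i j = (if j < r - 1 then (if i = j then monom 1 (dd j) else if i = Suc j then 1 else 0)
            else if i = \<iota> (j - (r - 1)) then monom 1 (\<beta> (j - (r - 1)) - D i) else 0)"

abbreviation "n \<equiv> r + l"

lemma n_eq: "n = (r - 1) + Suc l" using r by simp

lemma D_mono: "i \<le> i' \<Longrightarrow> D i \<le> D i'"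
  by (induction rule: dec_induct) (auto simp: DS)

lemma Z_degree:
  assumes "j < n"
  shows "degree (Z i j) \<le> dd i"
proof (cases "j < r - 1")
  case True
  then show ?thesis using degree_monom_le[of "1::complex" "dd j"] by (auto simp: Z_def)
next
  case False
  define q where "q = j - (r - 1)"
  have "q \<le> l" using assms by (simp add: q_def)
  then have "\<beta> q - D (\<iota> q) \<le> dd (\<iota> q)" using \<iota>[of q] DS[of "\<iota> q"] by linarith
  then show ?thesis using False order.trans[OF degree_monom_le, of "\<beta> q - D i" "dd i"]
    by (auto simp: Z_def q_def)
qed

definition reach :: "(nat \<Rightarrow> complex poly) \<Rightarrow> bool" where
  "reach y \<longleftrightarrow> (\<exists>x. (\<forall>j<n. degree (x j) \<le> \<alpha>) \<and> (\<forall>i<r. (\<Sum>j<n. Z i j * x j) = y i))"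

lemma reach_cong: "reach y \<Longrightarrow> (\<And>i. i < r \<Longrightarrow> y i = y' i) \<Longrightarrow> reach y'"
  unfolding reach_def by auto

lemma reach_zero: "reach (\<lambda>_. 0)"
  unfolding reach_def by (intro exI[of _ "\<lambda>_. 0"]) auto

lemma reach_add_smult: "reach y \<Longrightarrow> reach y' \<Longrightarrow> reach (\<lambda>i. y i + smult c (y' i))"
proof -
  assume "reach y" "reach y'"
  then obtain x x' where x: "\<forall>j<n. degree (x j) \<le> \<alpha>" "\<forall>i<r. (\<Sum>j<n. Z i j * x j) = y i"
    and x': "\<forall>j<n. degree (x' j) \<le> \<alpha>" "\<forall>i<r. (\<Sum>j<n. Z i j * x' j) = y' i"
    unfolding reach_def by blast
  have "degree (x j + smult c (x' j)) \<le> \<alpha>" if "j < n" for j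
    using x(1) x'(1) that order.trans[OF degree_smult_le[of c "x' j"]] by (intro degree_add_le) auto
  moreover have "(\<Sum>j<n. Z i j * (x j + smult c (x' j))) = y i + smult c (y' i)" if "i < r" for i
    using x(2) x'(2) that by (simp add: distrib_left sum.distrib flip: smult_sum2)
  ultimately show ?thesis unfolding reach_def
    by (intro exI[of _ "\<lambda>j. x j + smult c (x' j)"]) simp
qed

lemma reach_sum:
  assumes "finite I" and "\<And>s. s \<in> I \<Longrightarrow> reach (f s)"
  shows "reach (\<lambda>i. \<Sum>s\<in>I. smult (c s) (f s i))"
  using assms
proof (induction I rule: finite_induct)
  case (insert s I)
  then have "reach (\<lambda>i. (\<Sum>s\<in>I. smult (c s) (f s i)) + smult (c s) (f s i))"
    by (intro reach_add_smult) auto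
  then show ?case using insert.hyps by (simp add: add.commute)
qed (simp add: reach_zero)

lemma reach_column:
  assumes "j < n" and "k \<le> \<alpha>"
  shows "reach (\<lambda>i. Z i j * monom 1 k)"
proof -
  have "(\<Sum>j'<n. Z i j' * (if j' = j then monom 1 k else 0)) = Z i j * monom 1 k" for i
  proof -
    have "(\<Sum>j'<n. Z i j' * (if j' = j then monom 1 k else 0)) = (\<Sum>j'<n. if j' = j then Z i j * monom 1 k else 0)"
      by (intro sum.cong) auto
    then show ?thesis using assms(1) by simp
  qed
  moreover have "degree (if j' = j then monom 1 k else 0 :: complex poly) \<le> \<alpha>" for j'
    using assms(2) degree_monom_le[of "1::complex" k] by auto
  ultimately show ?thesis unfolding reach_def by (intro exI[of _ "\<lambda>j'. if j' = j then monom 1 k else 0"]) auto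
qed

text \<open>The point \<open>p\<close> of the glued line as seen from row \<open>i\<close>, where
  exponent \<open>k\<close> has position \<open>D i + k\<close>.\<close>

definition unit_at :: "nat \<Rightarrow> nat \<Rightarrow> nat \<Rightarrow> complex poly" where
  "unit_at i p i' = (if i' = i then monom 1 (p - D i) else 0)"

text \<open>A shift of glue column \<open>i\<close> is the sum of the two representatives of
  \<open>p\<close>, so each is reachable from the other. The shift may have degree at most \<alpha>,
  whence the range of \<open>p\<close>.\<close>

lemma glue:
  assumes "Suc i < r" and "D (Suc i) \<le> p" and "p \<le> D (Suc i) + \<alpha>"
  shows "reach (unit_at i p) \<longleftrightarrow> reach (unit_at (Suc i) p)"
proof -
  have col: "reach (\<lambda>i'. Z i' i * monom 1 (p - D (Suc i)))" using assms by (intro reach_column) auto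
  have "Z i' i * monom 1 (p - D (Suc i)) = unit_at i p i' + unit_at (Suc i) p i'" for i'
    using assms by (auto simp: Z_def unit_at_def mult_monom DS)
  then have col': "reach (\<lambda>i'. unit_at i p i' + unit_at (Suc i) p i')" using col by simp
  show ?thesis
  proof
    assume "reach (unit_at i p)"
    from reach_add_smult[OF col' this, of "- 1"] show "reach (unit_at (Suc i) p)" by simp
  next
    assume "reach (unit_at (Suc i) p)"
    from reach_add_smult[OF col' this, of "- 1"] show "reach (unit_at i p)" by simp
  qed
qed

lemma glue_range:
  assumes "i \<le> i'" and "i' < r" and "D i' \<le> p" and "p \<le> D (Suc i) + \<alpha>"
  shows "reach (unit_at i p) \<longleftrightarrow> reach (unit_at i' p)"
  using assms
proof (induction i' rule: dec_induct)
  case (step i')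
  have "D i' \<le> p" using step.prems DS[of i'] by simp
  then have "reach (unit_at i p) \<longleftrightarrow> reach (unit_at i' p)" using step by simp
  moreover have "D (Suc i) \<le> D (Suc i')" using step.hyps by (intro D_mono) auto
  then have "reach (unit_at i' p) \<longleftrightarrow> reach (unit_at (Suc i') p)"
    using step.prems by (intro glue) auto
  ultimately show ?case by simp
qed simp

text \<open>As gaps are at most \<open>Suc \<alpha>\<close>, the windows of length \<alpha> starting
  at the breakpoints leave no integer point uncovered.\<close>

lemma breakpoint: "p \<le> \<beta> q + \<alpha> \<Longrightarrow> \<exists>q'\<le>q. \<beta> q' \<le> p \<and> p \<le> \<beta> q' + \<alpha>"
proof (induction q)
  case 0
  then show ?case using \<beta>0 by auto
next
  case (Suc q)
  show ?case
  proof (cases "\<beta> (Suc q) \<le> p")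
    case False
    then have "p \<le> \<beta> q + \<alpha>" using \<beta>_le[of q] by simp
    then show ?thesis using Suc.IH le_SucI by blast
  qed (use Suc.prems in auto)
qed

text \<open>A breakpoint column shifted by at most \<alpha> hits \<open>p\<close> in the row of that
  breakpoint; gluing carries it from there to row \<open>i\<close>, upward or downward.\<close>

lemma reach_unit:
  assumes i: "i < r" and p: "D i \<le> p" "p \<le> D (Suc i) + \<alpha>"
  shows "reach (unit_at i p)"
proof -
  have "D (Suc i) \<le> D r" using i by (intro D_mono) auto
  then obtain q where q: "q \<le> l" "\<beta> q \<le> p" "p \<le> \<beta> q + \<alpha>" using breakpoint[of p l] p \<beta>l by auto
  note i' = \<iota>[OF q(1)]
  have "reach (\<lambda>i. Z i (r - 1 + q) * monom 1 (p - \<beta> q))"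
    using q r by (intro reach_column) auto
  moreover have "Z i (r - 1 + q) * monom 1 (p - \<beta> q) = unit_at (\<iota> q) p i" for i
    using q i' by (auto simp: Z_def unit_at_def mult_monom)
  ultimately have base: "reach (unit_at (\<iota> q) p)" by simp
  show ?thesis
  proof (cases "i \<le> \<iota> q")
    case True
    then show ?thesis using glue_range[of i "\<iota> q" p] base i' q p by auto
  next
    case False
    then show ?thesis using glue_range[of "\<iota> q" i p] base i' q p i by auto
  qed
qed

lemma Z_surjective: "surjective_upto r n dd Z \<alpha>"
  unfolding surjective_upto_def
proof (intro allI impI)
  fix y :: "nat \<Rightarrow> complex poly"
  assume y: "\<forall>i<r. degree (y i) \<le> dd i + \<alpha>"
  define I where "I = (SIGMA i:{..<r}. {..<Suc (dd i + \<alpha>)})"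
  have "reach (\<lambda>i'. \<Sum>s\<in>I. smult (case s of (i,k) \<Rightarrow> coeff (y i) k) ((case s of (i,k) \<Rightarrow> unit_at i (D i + k)) i'))"
    by (rule reach_sum) (auto simp: I_def DS intro!: reach_unit)
  moreover have "(\<Sum>s\<in>I. smult (case s of (i,k) \<Rightarrow> coeff (y i) k) ((case s of (i,k) \<Rightarrow> unit_at i (D i + k)) i')) = y i'"
    if i': "i' < r" for i'
  proof -
    have "(\<Sum>s\<in>I. smult (case s of (i,k) \<Rightarrow> coeff (y i) k) ((case s of (i,k) \<Rightarrow> unit_at i (D i + k)) i'))
        = (\<Sum>i<r. \<Sum>k<Suc (dd i + \<alpha>). smult (coeff (y i) k) (unit_at i (D i + k) i'))"
      unfolding I_def by (subst sum.Sigma) (auto intro!: sum.cong)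
    also have "\<dots> = (\<Sum>i<r. if i = i' then (\<Sum>k<Suc (dd i' + \<alpha>). monom (coeff (y i') k) k) else 0)"
      by (intro sum.cong refl) (auto simp: unit_at_def smult_monom)
    also have "\<dots> = (\<Sum>k<Suc (dd i' + \<alpha>). monom (coeff (y i') k) k)" using i' by simp
    also have "\<dots> = y i'"
      using y i' by (intro poly_eq_sum_monom[symmetric]) (auto intro!: coeff_eq_0 simp: less_Suc_eq_le Suc_le_eq le_less_trans)
    finally show ?thesis .
  qed
  ultimately have "reach y" by (rule reach_cong)
  then show "\<exists>x. (\<forall>j<n. degree (x j) \<le> \<alpha>) \<and> (\<forall>i<r. (\<Sum>j<n. Z i j * x j) = y i)"
    unfolding reach_def .
qed

lemma \<beta>_gap: "q < q' \<Longrightarrow> \<beta> q + \<alpha> \<le> \<beta> q'"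
proof (induction q')
  case (Suc q')
  then show ?case using \<beta>_ge[of q'] by (cases "q = q'") auto
qed simp

text \<open>The weights place both entries of a glue column at the same exponent with opposite
  signs, so only breakpoint columns survive.\<close>

lemma weighted_column:
  assumes "j < n"
  shows "(\<Sum>i<r. monom ((-1) ^ i) (D i) * Z i j)
    = (if j < r - 1 then 0 else monom ((-1) ^ \<iota> (j - (r - 1))) (\<beta> (j - (r - 1))))"
proof (cases "j < r - 1")
  case True
  then have jr: "j < r" "Suc j < r" by auto
  have "(\<Sum>i<r. monom ((-1) ^ i) (D i) * Z i j)
      = (\<Sum>i<r. (if i = j then monom ((-1) ^ j) (D j + dd j) else 0)
          + (if i = Suc j then monom ((-1) ^ Suc j) (D (Suc j)) else 0))"
    using True by (intro sum.cong) (auto simp: Z_def mult_monom)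
  also have "\<dots> = monom ((-1) ^ j) (D j + dd j) + monom ((-1) ^ Suc j) (D (Suc j))"
    using jr by (simp add: sum.distrib)
  also have "\<dots> = 0" by (simp add: DS minus_monom[symmetric])
  finally show ?thesis using True by simp
next
  case False
  define q where "q = j - (r - 1)"
  have q: "q \<le> l" using assms by (simp add: q_def)
  have "(\<Sum>i<r. monom ((-1) ^ i) (D i) * Z i j) = (\<Sum>i<r. if i = \<iota> q then monom ((-1) ^ \<iota> q) (\<beta> q) else 0)"
    using False \<iota>[OF q] by (intro sum.cong) (auto simp: Z_def mult_monom q_def)
  also have "\<dots> = monom ((-1) ^ \<iota> q) (\<beta> q)" using \<iota>[OF q] by simp
  finally show ?thesis using False by (simp add: q_def)
qed

text \<open>The weighted sum of the rows sees only the breakpoint columns. Their gaps are at least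
  \<alpha>, so multiples of degree below \<alpha> do not overlap and each must vanish. The glue
  columns follow from the first row down.\<close>

lemma Z_injective:
  assumes x: "\<forall>j<n. \<forall>k\<ge>\<alpha>. coeff (x j) k = 0" and ker: "\<forall>i<r. (\<Sum>j<n. Z i j * x j) = 0"
  shows "\<forall>j<n. x j = 0"
proof -
  have "0 = (\<Sum>i<r. monom ((-1) ^ i) (D i) * (\<Sum>j<n. Z i j * x j))" using ker by simp
  also have "\<dots> = (\<Sum>j<n. (\<Sum>i<r. monom ((-1) ^ i) (D i) * Z i j) * x j)"
    unfolding sum_distrib_left sum_distrib_right by (subst sum.swap) (simp add: mult.assoc)
  also have "\<dots> = (\<Sum>j<n. (if j < r - 1 then 0 else monom ((-1) ^ \<iota> (j - (r - 1))) (\<beta> (j - (r - 1)))) * x j)"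
    using weighted_column by (intro sum.cong) auto
  also have "\<dots> = (\<Sum>q<Suc l. monom ((-1) ^ \<iota> q) (\<beta> q) * x (r - 1 + q))"
    unfolding n_eq sum_lessThan_add by simp
  finally have zero: "(\<Sum>q<Suc l. monom ((-1) ^ \<iota> q) (\<beta> q) * x (r - 1 + q)) = 0" by simp
  have tail: "x (r - 1 + q) = 0" if q: "q \<le> l" for q
  proof (rule poly_eqI)
    fix k
    have inn: "r - 1 + q' < n" if "q' \<le> l" for q' using that r by simp
    show "coeff (x (r - 1 + q)) k = coeff 0 k"
    proof (cases "k < \<alpha>")
      case True
      have summand: "coeff (monom ((-1) ^ \<iota> q') (\<beta> q') * x (r - 1 + q')) (\<beta> q + k)
          = (if q' = q then (-1) ^ \<iota> q * coeff (x (r - 1 + q)) k else 0)" if q': "q' \<in> {..<Suc l}" for q'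
      proof -
        consider "q' = q" | "q < q'" | "q' < q" by linarith
        then show ?thesis
        proof cases
          case 2
          then show ?thesis using \<beta>_gap[of q q'] True by (simp add: coeff_monom_mult)
        next
          case 3
          then have "\<alpha> \<le> \<beta> q + k - \<beta> q'" using \<beta>_gap[of q' q] by simp
          moreover have "r - 1 + q' < n" using q' by (intro inn) auto
          ultimately have "coeff (x (r - 1 + q')) (\<beta> q + k - \<beta> q') = 0" using x by blast
          then show ?thesis using 3 by (simp add: coeff_monom_mult)
        qed (simp add: coeff_monom_mult)
      qed
      have "0 = coeff (\<Sum>q<Suc l. monom ((-1) ^ \<iota> q) (\<beta> q) * x (r - 1 + q)) (\<beta> q + k)" by (simp only: zero coeff_0)
      also have "\<dots> = (\<Sum>q'<Suc l. if q' = q then (-1) ^ \<iota> q * coeff (x (r - 1 + q)) k else 0)"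
        unfolding coeff_sum using summand by (rule sum.cong[OF refl])
      also have "\<dots> = (-1) ^ \<iota> q * coeff (x (r - 1 + q)) k"
        by (subst sum.delta) (use q in auto)
      finally have "(-1) ^ \<iota> q * coeff (x (r - 1 + q)) k = 0" by simp
      then show ?thesis by simp
    qed (use x inn[OF q] in auto)
  qed
  \<comment> \<open>With the tail gone, row \<open>j\<close> involves only columns \<open>j\<close>
    and \<open>j - 1\<close>, and the latter entry is already zero.\<close>
  have front: "x j = 0" if j: "j < r - 1" for j
    using j
  proof (induction j rule: less_induct)
    case (less j)
    have "0 = (\<Sum>j'<n. Z j j' * x j')" using ker less.prems by simp
    also have "\<dots> = (\<Sum>j'<r - 1. Z j j' * x j')" unfolding n_eq sum_lessThan_add using tail by simp
    also have "\<dots> = (\<Sum>j'<r - 1. if j' = j then monom 1 (dd j) * x j else 0)"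
      using less by (intro sum.cong) (auto simp: Z_def)
    also have "\<dots> = monom 1 (dd j) * x j" using less.prems by simp
    finally have "monom 1 (dd j) * x j = 0" by simp
    then show "x j = 0" by (simp add: monom_eq_0_iff)
  qed
  show ?thesis
  proof (intro allI impI)
    fix j assume j: "j < n"
    show "x j = 0"
    proof (cases "j < r - 1")
      case False
      then have "r - 1 + (j - (r - 1)) = j" "j - (r - 1) \<le> l" using j by auto
      then show ?thesis using tail[of "j - (r - 1)"] by simp
    qed (rule front)
  qed
qed

lemma Z_generic: "generic_rows r n dd \<alpha> Z"
  unfolding generic_rows_def using Z_degree Z_surjective Z_injective by blast

end

lemma interval_index:
  fixes D :: "nat \<Rightarrow> nat"
  assumes "D 0 = 0" and "0 < r" and "b \<le> D r"
  shows "\<exists>i<r. D i \<le> b \<and> b \<le> D (Suc i)"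
  using assms(2,3)
proof (induction r)
  case (Suc r)
  show ?case
  proof (cases "D r \<le> b")
    case False
    then have "r \<noteq> 0" using assms(1) by (cases r) auto
    then obtain i where "i < r" "D i \<le> b \<and> b \<le> D (Suc i)" using Suc.IH False by auto
    then show ?thesis by (intro exI[of _ i]) simp
  qed (use Suc.prems in auto)
qed simp

theorem generic_rows_exist:
  assumes "0 < r" and "r < n" and "a = (\<Sum>i<r. dd i)"
  obtains Z where "generic_rows r n dd (a div (n - r)) Z"
proof -
  define l where "l = n - r"
  have l: "0 < l" "n = r + l" using assms by (auto simp: l_def)
  define \<alpha> where "\<alpha> = a div l"
  define s where "s = a mod l"
  define D where "D i = (\<Sum>i'<i. dd i')" for i
  \<comment> \<open>The first \<open>s\<close> gaps are \<alpha> + 1 and the others \<alpha>, which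
    makes \<open>\<beta> l = a\<close>.\<close>
  define \<beta> where "\<beta> q = q * \<alpha> + min q s" for q
  have "s < l" using l by (simp add: s_def)
  then have "\<beta> l = l * (a div l) + a mod l" by (simp add: \<beta>_def \<alpha>_def s_def)
  then have bl: "\<beta> l = a" by simp
  have mono: "mono \<beta>" by (rule monoI) (auto simp: \<beta>_def intro!: add_mono mult_le_mono1)
  have "\<exists>i<r. D i \<le> \<beta> q \<and> \<beta> q \<le> D (Suc i)" if "q \<le> l" for q
    using monoD[OF mono that] bl assms by (intro interval_index) (auto simp: D_def)
  then have ex: "\<And>q. q \<le> l \<Longrightarrow> \<exists>i. i < r \<and> D i \<le> \<beta> q \<and> \<beta> q \<le> D (Suc i)" by blast
  define \<iota> where "\<iota> q = (SOME i. i < r \<and> D i \<le> \<beta> q \<and> \<beta> q \<le> D (Suc i))" for q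
  have \<iota>: "\<iota> q < r \<and> D (\<iota> q) \<le> \<beta> q \<and> \<beta> q \<le> D (Suc (\<iota> q))" if "q \<le> l" for q
    unfolding \<iota>_def by (rule someI_ex[OF ex[OF that]])
  interpret zigzag r l dd D \<beta> \<iota> \<alpha>
  proof
    show "0 < r" "D 0 = 0" "\<And>i. D (Suc i) = D i + dd i" "\<beta> 0 = 0" using assms by (auto simp: D_def \<beta>_def)
    show "\<beta> l = D r" using bl assms by (simp add: D_def)
    show "\<beta> q + \<alpha> \<le> \<beta> (Suc q)" "\<beta> (Suc q) \<le> \<beta> q + Suc \<alpha>" for q by (auto simp: \<beta>_def)
  qed (rule \<iota>)
  show thesis using that Z_generic by (simp add: l \<alpha>_def)
qed

text \<open>Composing with a one-sided inverse of the map of \<open>Z\<close> turns each requirement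
  on the perturbed rows into invertibility of a square matrix plus \<epsilon>: a right inverse
  \<open>X\<close> serves surjectivity, a left inverse \<open>Y\<close> injectivity. Each fails for
  finitely many \<epsilon> only.\<close>

lemma generic_rows_perturb:
  assumes R: "\<And>i j. i < r \<Longrightarrow> j < n \<Longrightarrow> degree (R i j) \<le> dd i" and gen: "generic_rows r n dd \<alpha> Z"
  shows "finite {\<epsilon>. \<not> generic_rows r n dd \<alpha> (\<lambda>i j. R i j + smult \<epsilon> (Z i j))}"
proof -
  have Z: "\<And>i j. i < r \<Longrightarrow> j < n \<Longrightarrow> degree (Z i j) \<le> dd i" and surj: "surjective_upto r n dd Z \<alpha>"
    and inj: "\<And>x j. (\<forall>j<n. \<forall>k\<ge>\<alpha>. coeff (x j) k = 0) \<Longrightarrow> (\<forall>i<r. (\<Sum>j<n. Z i j * x j) = 0) \<Longrightarrow> j < n \<Longrightarrow> x j = 0"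
    using gen unfolding generic_rows_def by blast+
  define P where "P \<epsilon> i j = R i j + smult \<epsilon> (Z i j)" for \<epsilon> i j
  have Pdeg: "degree (P \<epsilon> i j) \<le> dd i" if "i < r" "j < n" for \<epsilon> i j
    unfolding P_def using R[OF that] Z[OF that]
    by (intro degree_add_le) (auto intro: order.trans[OF degree_smult_le])
  define B where "B = (SIGMA i:{..<r}. {..<Suc (dd i + \<alpha>)})"
  define Q where "Q b x \<longleftrightarrow> (\<forall>j<n. degree (x j) \<le> \<alpha>) \<and>
     (\<forall>i'<r. (\<Sum>j<n. Z i' j * x j) = (if i' = fst b then monom 1 (snd b) else 0))" for b x
  define X where "X b = (SOME x. Q b x)" for b
  have QX: "Q b (X b)" if "b \<in> B" for b
  proof -
    have "\<exists>x. Q b x" unfolding Q_def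
    proof (rule surjective_uptoD[OF surj])
      fix i assume "i < r"
      then show "degree (if i = fst b then monom 1 (snd b) else 0 :: complex poly) \<le> dd i + \<alpha>"
        using that degree_monom_le[of "1::complex" "snd b"] by (auto simp: B_def)
    qed
    then show ?thesis unfolding X_def by (rule someI_ex)
  qed
  have X: "\<And>b j. b \<in> B \<Longrightarrow> j < n \<Longrightarrow> degree (X b j) \<le> \<alpha>"
     "\<And>b i'. b \<in> B \<Longrightarrow> i' < r \<Longrightarrow> (\<Sum>j<n. Z i' j * X b j) = (if i' = fst b then monom 1 (snd b) else 0)"
    using QX unfolding Q_def by blast+
  \<comment> \<open>The map of \<open>R\<close> after \<open>X\<close>, on the coefficients of the
    target indexed by \<open>B\<close>; the map of \<open>Z\<close> after \<open>X\<close> is the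
    identity.\<close>
  define M where "M b b' = coeff (\<Sum>j<n. R (fst b) j * X b' j) (snd b)" for b b'
  have finB: "finite B" by (simp add: B_def)
  let ?S1 = "{\<epsilon>. \<exists>c. (\<exists>b\<in>B. c b \<noteq> 0) \<and> (\<forall>b\<in>B. (\<Sum>b'\<in>B. M b b' * c b') + \<epsilon> * c b = 0)}"
  have S1: "surjective_upto r n dd (P \<epsilon>) \<alpha>" if \<epsilon>: "\<epsilon> \<notin> ?S1" for \<epsilon>
    unfolding surjective_upto_def
  proof (intro allI impI)
    fix y :: "nat \<Rightarrow> complex poly"
    assume y: "\<forall>i<r. degree (y i) \<le> dd i + \<alpha>"
    have shift: "(\<Sum>b'\<in>B. (M b b' + (if b' = b then \<epsilon> else 0)) * c b') = (\<Sum>b'\<in>B. M b b' * c b') + \<epsilon> * c b"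
      if "b \<in> B" for b and c :: "nat \<times> nat \<Rightarrow> complex"
    proof -
      have "(\<Sum>b'\<in>B. (M b b' + (if b' = b then \<epsilon> else 0)) * c b')
          = (\<Sum>b'\<in>B. M b b' * c b') + (\<Sum>b'\<in>B. if b' = b then \<epsilon> * c b else 0)"
        unfolding sum.distrib[symmetric] by (intro sum.cong) (auto simp: distrib_right)
      then show ?thesis using that finB by simp
    qed
    have "\<exists>c. \<forall>b\<in>B. (\<Sum>b'\<in>B. (M b b' + (if b' = b then \<epsilon> else 0)) * c b') = coeff (y (fst b)) (snd b)"
    proof (rule injective_square_surjective[OF finB])
      fix c b assume "\<And>b. b \<in> B \<Longrightarrow> (\<Sum>b'\<in>B. (M b b' + (if b' = b then \<epsilon> else 0)) * c b') = 0" and "b \<in> B"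
      then have "(\<Sum>b'\<in>B. M b b' * c b') + \<epsilon> * c b = 0" if "b \<in> B" for b
        unfolding shift[OF that, symmetric] using that by blast
      then show "c b = 0" using \<epsilon> \<open>b \<in> B\<close> by blast
    qed
    then obtain c where "\<forall>b\<in>B. (\<Sum>b'\<in>B. (M b b' + (if b' = b then \<epsilon> else 0)) * c b') = coeff (y (fst b)) (snd b)"
      by blast
    then have c: "(\<Sum>b'\<in>B. M b b' * c b') + \<epsilon> * c b = coeff (y (fst b)) (snd b)" if "b \<in> B" for b
      unfolding shift[OF that, symmetric] using that by blast
    define x where "x j = (\<Sum>b\<in>B. smult (c b) (X b j))" for j
    have xd: "degree (x j) \<le> \<alpha>" if "j < n" for j
      unfolding x_def using X that finB by (intro degree_sum_le) (auto intro: order.trans[OF degree_smult_le])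
    have "(\<Sum>j<n. P \<epsilon> i j * x j) = y i" if i: "i < r" for i
    proof (rule poly_eqI)
      fix k
      show "coeff (\<Sum>j<n. P \<epsilon> i j * x j) k = coeff (y i) k"
      proof (cases "k \<le> dd i + \<alpha>")
        case True
        then have b: "(i,k) \<in> B" using i by (simp add: B_def)
        have "(\<Sum>j<n. P \<epsilon> i j * x j) = (\<Sum>b\<in>B. smult (c b) ((\<Sum>j<n. R i j * X b j) + smult \<epsilon> (\<Sum>j<n. Z i j * X b j)))"
          unfolding x_def P_def sum_distrib_left
          by (subst sum.swap) (simp add: distrib_right sum.distrib smult_add_right flip: smult_sum2)
        also have "coeff \<dots> k = (\<Sum>b'\<in>B. c b' * (M (i,k) b' + \<epsilon> * coeff (\<Sum>j<n. Z i j * X b' j) k))"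
          by (simp add: coeff_sum M_def)
        also have "\<dots> = (\<Sum>b'\<in>B. M (i,k) b' * c b' + (if b' = (i,k) then \<epsilon> * c (i,k) else 0))"
          using X i by (intro sum.cong) (auto simp: algebra_simps prod_eq_iff)
        also have "\<dots> = (\<Sum>b'\<in>B. M (i,k) b' * c b') + \<epsilon> * c (i,k)"
          using b finB by (simp add: sum.distrib)
        also have "\<dots> = coeff (y i) k" using c[OF b] by simp
        finally show ?thesis .
      next
        case False
        have "degree (\<Sum>j<n. P \<epsilon> i j * x j) \<le> dd i + \<alpha>"
          using Pdeg[OF i] xd by (intro degree_sum_le degree_mult_le_bounds) auto
        moreover have "degree (y i) < k" using False y[rule_format, OF i] by linarith
        ultimately show ?thesis using False by (simp add: coeff_eq_0)
      qed
    qed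
    then show "\<exists>x. (\<forall>j<n. degree (x j) \<le> \<alpha>) \<and> (\<forall>i<r. (\<Sum>j<n. P \<epsilon> i j * x j) = y i)"
      using xd by blast
  qed
  define A where "A = {..<n} \<times> {..<\<alpha>}"
  have finA: "finite A" by (simp add: A_def)
  \<comment> \<open>The matrix of \<open>Q\<close> on coefficients, \<open>a\<close> indexing the
    argument and \<open>b\<close> the value. Injectivity below degree \<alpha> becomes independence
    of its rows.\<close>
  define T where "T Q a b = coeff (Q (fst b) (fst a) * monom 1 (snd a)) (snd b)"
    for Q :: "nat \<Rightarrow> nat \<Rightarrow> complex poly" and a b :: "nat \<times> nat"
  have T_coeff: "coeff (\<Sum>j<n. Q i j * x j) k = (\<Sum>a\<in>A. coeff (x (fst a)) (snd a) * T Q a (i,k))"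
    if "\<forall>j<n. \<forall>k\<ge>\<alpha>. coeff (x j) k = 0" for Q x i k
  proof -
    have "x j = (\<Sum>k<\<alpha>. monom (coeff (x j) k) k)" if "j < n" for j
      by (rule poly_eq_sum_monom) (use \<open>\<forall>j<n. \<forall>k\<ge>\<alpha>. coeff (x j) k = 0\<close> that in blast)
    then have "coeff (\<Sum>j<n. Q i j * x j) k = (\<Sum>j<n. coeff (Q i j * (\<Sum>k<\<alpha>. monom (coeff (x j) k) k)) k)"
      unfolding coeff_sum by (intro sum.cong refl) (metis lessThan_iff)
    also have "\<dots> = (\<Sum>j<n. \<Sum>k'<\<alpha>. coeff (x j) k' * T Q (j,k') (i,k))"
      by (intro sum.cong refl) (simp add: sum_distrib_left coeff_sum T_def coeff_monom_mult mult.commute[of "Q _ _"] if_distrib cong: if_cong)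
    also have "\<dots> = (\<Sum>a\<in>A. coeff (x (fst a)) (snd a) * T Q a (i,k))"
      unfolding A_def by (simp add: sum.cartesian_product case_prod_unfold)
    finally show ?thesis .
  qed
  have "\<exists>Y. \<forall>a\<in>A. \<forall>a'\<in>A. (\<Sum>b\<in>B. T Z a b * Y b a') = of_bool (a = a')"
  proof (rule independent_rows_right_inverse[OF finA finB])
    fix c a assume c: "\<And>b. b \<in> B \<Longrightarrow> (\<Sum>a\<in>A. c a * T Z a b) = 0" and a: "a \<in> A"
    define x where "x j = (\<Sum>k<\<alpha>. monom (c (j,k)) k)" for j
    have xc: "coeff (x j) k = (if k < \<alpha> then c (j,k) else 0)" for j k by (simp add: x_def coeff_sum)
    have small: "\<forall>j<n. \<forall>k\<ge>\<alpha>. coeff (x j) k = 0" by (simp add: xc)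
    have "(\<Sum>j<n. Z i j * x j) = 0" if i: "i < r" for i
    proof (rule poly_eqI)
      fix k
      show "coeff (\<Sum>j<n. Z i j * x j) k = coeff 0 k"
      proof (cases "k \<le> dd i + \<alpha>")
        case True
        have "(\<Sum>a\<in>A. coeff (x (fst a)) (snd a) * T Z a (i,k)) = (\<Sum>a\<in>A. c a * T Z a (i,k))"
          by (intro sum.cong) (auto simp: A_def xc)
        also have "\<dots> = 0" using c i True by (simp add: B_def)
        finally show ?thesis using T_coeff[OF small] by simp
      next
        case False
        have "degree (x j) \<le> \<alpha>" for j by (rule degree_le) (simp add: xc)
        then have "degree (\<Sum>j<n. Z i j * x j) \<le> dd i + \<alpha>"
          using Z[OF i] by (intro degree_sum_le degree_mult_le_bounds) auto
        then show ?thesis using False by (simp add: coeff_eq_0)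
      qed
    qed
    then have "x (fst a) = 0" using inj[OF small] a by (auto simp: A_def)
    then have "coeff (x (fst a)) (snd a) = 0" by simp
    then show "c a = 0" using a by (auto simp: xc A_def split: if_splits)
  qed
  then obtain Y where Y: "\<And>a a'. a \<in> A \<Longrightarrow> a' \<in> A \<Longrightarrow> (\<Sum>b\<in>B. T Z a b * Y b a') = of_bool (a = a')"
    by blast
  \<comment> \<open>The map of \<open>R\<close> followed by \<open>Y\<close>. As \<open>Y\<close>
    undoes the map of \<open>Z\<close>, the same composition for \<open>P \<epsilon>\<close> is
    \<open>M'\<close> plus \<epsilon>.\<close>
  define M' where "M' a' a = (\<Sum>b\<in>B. T R a b * Y b a')" for a' a
  let ?S2 = "{\<epsilon>. \<exists>c. (\<exists>a\<in>A. c a \<noteq> 0) \<and> (\<forall>a\<in>A. (\<Sum>a'\<in>A. M' a a' * c a') + \<epsilon> * c a = 0)}"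
  have S2: "\<forall>j<n. x j = 0"
    if \<epsilon>: "\<epsilon> \<notin> ?S2" and small: "\<forall>j<n. \<forall>k\<ge>\<alpha>. coeff (x j) k = 0" and ker: "\<forall>i<r. (\<Sum>j<n. P \<epsilon> i j * x j) = 0"
    for \<epsilon> x
  proof -
    define c where "c a = coeff (x (fst a)) (snd a)" for a
    have TP: "T (P \<epsilon>) a b = T R a b + \<epsilon> * T Z a b" for a b
      by (simp add: T_def P_def distrib_right)
    have "(\<Sum>a\<in>A. M' a' a * c a) + \<epsilon> * c a' = 0" if a': "a' \<in> A" for a'
    proof -
      have "0 = (\<Sum>b\<in>B. (\<Sum>a\<in>A. c a * T (P \<epsilon>) a b) * Y b a')"
      proof (rule sum.neutral[symmetric], rule ballI)
        fix b assume "b \<in> B"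
        then have "fst b < r" by (auto simp: B_def)
        then have "(\<Sum>a\<in>A. c a * T (P \<epsilon>) a b) = 0"
          using T_coeff[OF small, of "P \<epsilon>" "fst b" "snd b"] ker unfolding c_def by simp
        then show "(\<Sum>a\<in>A. c a * T (P \<epsilon>) a b) * Y b a' = 0" by simp
      qed
      also have "\<dots> = (\<Sum>a\<in>A. c a * (\<Sum>b\<in>B. T (P \<epsilon>) a b * Y b a'))"
        unfolding sum_distrib_right sum_distrib_left by (subst sum.swap) (simp add: mult.assoc)
      also have "\<dots> = (\<Sum>a\<in>A. c a * (M' a' a + \<epsilon> * (\<Sum>b\<in>B. T Z a b * Y b a')))"
        unfolding TP M'_def by (simp add: distrib_right sum.distrib sum_distrib_left mult.assoc)
      also have "\<dots> = (\<Sum>a\<in>A. M' a' a * c a + (if a = a' then \<epsilon> * c a' else 0))"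
        using Y a' by (intro sum.cong) (auto simp: algebra_simps)
      also have "\<dots> = (\<Sum>a\<in>A. M' a' a * c a) + \<epsilon> * c a'" using a' finA by (simp add: sum.distrib)
      finally show ?thesis by simp
    qed
    then have c0: "c a = 0" if "a \<in> A" for a using \<epsilon> that by blast
    show ?thesis
    proof (intro allI impI poly_eqI)
      fix j k assume "j < n"
      then show "coeff (x j) k = coeff 0 k"
        using c0[of "(j,k)"] small by (cases "k < \<alpha>") (auto simp: c_def A_def)
    qed
  qed
  have "{\<epsilon>. \<not> generic_rows r n dd \<alpha> (\<lambda>i j. R i j + smult \<epsilon> (Z i j))} \<subseteq> ?S1 \<union> ?S2"
  proof (rule subsetI, rule ccontr)
    fix \<epsilon> assume "\<epsilon> \<in> {\<epsilon>. \<not> generic_rows r n dd \<alpha> (\<lambda>i j. R i j + smult \<epsilon> (Z i j))}"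
    then have not: "\<not> generic_rows r n dd \<alpha> (P \<epsilon>)" by (simp add: P_def[abs_def])
    assume "\<epsilon> \<notin> ?S1 \<union> ?S2"
    then have e: "\<epsilon> \<notin> ?S1" "\<epsilon> \<notin> ?S2" by simp_all
    have "generic_rows r n dd \<alpha> (P \<epsilon>)" unfolding generic_rows_def
      by (intro conjI allI impI Pdeg S1[OF e(1)]) (use S2[OF e(2)] in simp_all)
    then show False using not by simp
  qed
  then show ?thesis
    using finite_singular_shifts[OF finB, of M] finite_singular_shifts[OF finA, of M']
    by (meson finite_UnI finite_subset)
qed

section \<open>Closures of sets of factored matrices\<close>

text \<open>Closeness of each single coefficient, equivalent to closeness in \<open>pm_dist\<close>
  up to a factor depending on the size.\<close>

definition coeff_near :: "nat \<Rightarrow> nat \<Rightarrow> nat \<Rightarrow> real \<Rightarrow> complex poly mat \<Rightarrow> complex poly mat \<Rightarrow> bool" where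
  "coeff_near m n d e P Q \<longleftrightarrow>
     (\<forall>i<m. \<forall>j<n. \<forall>k\<le>d. cmod (coeff (P $$ (i,j)) k - coeff (Q $$ (i,j)) k) < e)"

lemma pm_dist_imp_coeff_near:
  assumes P: "P \<in> carrier_mat m n" and "pm_dist d P Q < e"
  shows "coeff_near m n d e P Q"
  unfolding coeff_near_def
proof (intro allI impI)
  fix i j k assume ijk: "i < m" "j < n" "k \<le> d"
  define f where "f k i j = (cmod (coeff (P $$ (i,j)) k - coeff (Q $$ (i,j)) k))\<^sup>2" for k i j
  have "f k i j \<le> (\<Sum>j<n. f k i j)" using ijk by (intro member_le_sum) (auto simp: f_def)
  also have "\<dots> \<le> (\<Sum>i<m. \<Sum>j<n. f k i j)"
    using ijk by (intro member_le_sum[of i]) (auto simp: f_def intro!: sum_nonneg)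
  also have "\<dots> \<le> (\<Sum>k\<le>d. \<Sum>i<m. \<Sum>j<n. f k i j)"
    using ijk by (intro member_le_sum[of k]) (auto simp: f_def intro!: sum_nonneg)
  finally have "cmod (coeff (P $$ (i,j)) k - coeff (Q $$ (i,j)) k) \<le> pm_dist d P Q"
    unfolding pm_dist_def f_def carrier_matD[OF P] by (rule real_le_rsqrt)
  then show "cmod (coeff (P $$ (i,j)) k - coeff (Q $$ (i,j)) k) < e" using assms(2) by simp
qed

lemma coeff_near_imp_pm_dist:
  assumes P: "P \<in> carrier_mat m n" and near: "coeff_near m n d (e / (1 + sqrt (Suc d * m * n))) P Q" and e: "e > 0"
  shows "pm_dist d P Q < e"
proof -
  define N where "N = real (Suc d * m * n)"
  \<comment> \<open>The added 1 keeps the divisor positive even for empty matrices and makes the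
    final inequality strict.\<close>
  define t where "t = e / (1 + sqrt N)"
  have N: "N \<ge> 0" by (simp add: N_def)
  have pos: "0 < 1 + sqrt N" using N by (simp add: add_pos_nonneg)
  have "(\<Sum>k\<le>d. \<Sum>i<m. \<Sum>j<n. (cmod (coeff (P $$ (i,j)) k - coeff (Q $$ (i,j)) k))\<^sup>2)
      \<le> (\<Sum>k\<le>d. \<Sum>i<m. \<Sum>j<n. t\<^sup>2)"
    using near unfolding coeff_near_def t_def N_def
    by (intro sum_mono power_mono) (auto intro: less_imp_le)
  also have "\<dots> = N * t\<^sup>2" by (simp add: N_def algebra_simps)
  finally have "pm_dist d P Q \<le> sqrt (N * t\<^sup>2)" using P by (simp add: pm_dist_def)
  also have "\<dots> = sqrt N * t" using pos e by (simp add: real_sqrt_mult t_def)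
  also have "\<dots> < e" using pos e N by (simp add: t_def field_simps)
  finally show ?thesis .
qed

lemma pm_closure_iff:
  "P \<in> pm_closure m n d S \<longleftrightarrow> P \<in> pmats m n d \<and> (\<forall>e>0. \<exists>Q\<in>S. coeff_near m n d e P Q)"
proof (cases "P \<in> pmats m n d")
  case True
  then have P: "P \<in> carrier_mat m n" by (simp add: pmats_def)
  show ?thesis
  proof
    assume "P \<in> pm_closure m n d S"
    then show "P \<in> pmats m n d \<and> (\<forall>e>0. \<exists>Q\<in>S. coeff_near m n d e P Q)"
      unfolding pm_closure_def using pm_dist_imp_coeff_near[OF P] by blast
  next
    assume *: "P \<in> pmats m n d \<and> (\<forall>e>0. \<exists>Q\<in>S. coeff_near m n d e P Q)"
    have "\<exists>Q\<in>S. pm_dist d P Q < e" if e: "e > 0" for e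
    proof -
      have "e / (1 + sqrt (Suc d * m * n)) > 0" using e by (intro divide_pos_pos add_pos_nonneg) auto
      then obtain Q where Q: "Q \<in> S" "coeff_near m n d (e / (1 + sqrt (Suc d * m * n))) P Q" using * by blast
      then show ?thesis using coeff_near_imp_pm_dist[OF P _ e] by blast
    qed
    then show "P \<in> pm_closure m n d S" using True unfolding pm_closure_def by blast
  qed
qed (simp add: pm_closure_def)

lemma pm_closure_mono: "S \<subseteq> T \<Longrightarrow> pm_closure m n d S \<subseteq> pm_closure m n d T"
  unfolding pm_closure_def by blast

lemma pm_closure_trans:
  assumes "S \<subseteq> pm_closure m n d T"
  shows "pm_closure m n d S \<subseteq> pm_closure m n d T"
proof
  fix P assume P: "P \<in> pm_closure m n d S"
  show "P \<in> pm_closure m n d T" unfolding pm_closure_iff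
  proof (intro conjI allI impI)
    show "P \<in> pmats m n d" using P unfolding pm_closure_iff by blast
  next
    fix e :: real assume e: "e > 0"
    then obtain Q where Q: "Q \<in> S" "coeff_near m n d (e / 2) P Q"
      using P unfolding pm_closure_iff by (meson half_gt_zero)
    then obtain Q' where Q': "Q' \<in> T" "coeff_near m n d (e / 2) Q Q'"
      using assms e unfolding pm_closure_iff by (meson half_gt_zero pm_closure_iff subsetD)
    have "coeff_near m n d e P Q'" unfolding coeff_near_def
    proof (intro allI impI)
      fix i j k assume "i < m" "j < n" "k \<le> d"
      then have "cmod (coeff (P $$ (i,j)) k - coeff (Q $$ (i,j)) k) < e / 2"
        and "cmod (coeff (Q $$ (i,j)) k - coeff (Q' $$ (i,j)) k) < e / 2"
        using Q(2) Q'(2) unfolding coeff_near_def by blast+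
      then show "cmod (coeff (P $$ (i,j)) k - coeff (Q' $$ (i,j)) k) < e"
        by (rule norm_diff_triangle_less[THEN less_le_trans]) simp
    qed
    then show "\<exists>Q\<in>T. coeff_near m n d e P Q" using Q'(1) by blast
  qed
qed

text \<open>Both perturbations below have this form: \<open>B\<close> is zero when a degree is moved
  between rows, and comes from the product of the two changes when both factors are made
  generic.\<close>

lemma perturbation_near:
  fixes A B :: "nat \<Rightarrow> nat \<Rightarrow> complex poly"
  assumes "e > 0"
  obtains \<delta> :: real where "\<delta> > 0"
    and "\<And>\<epsilon> P Q. 0 < cmod \<epsilon> \<Longrightarrow> cmod \<epsilon> < \<delta> \<Longrightarrow>
      (\<And>i j. i < m \<Longrightarrow> j < n \<Longrightarrow> Q $$ (i,j) = P $$ (i,j) + smult \<epsilon> (A i j) + smult (\<epsilon>\<^sup>2) (B i j)) \<Longrightarrow>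
      coeff_near m n d e P Q"
proof -
  define f where "f i j k = cmod (coeff (A i j) k) + cmod (coeff (B i j) k)" for i j k
  define C where "C = 1 + (\<Sum>i<m. \<Sum>j<n. \<Sum>k\<le>d. f i j k)"
  have f0: "0 \<le> f i j k" for i j k by (simp add: f_def)
  have C0: "0 < C" unfolding C_def by (intro add_pos_nonneg sum_nonneg f0) auto
  have fC: "f i j k \<le> C" if "i < m" "j < n" "k \<le> d" for i j k
  proof -
    have "f i j k \<le> (\<Sum>k\<le>d. f i j k)" using that f0 by (intro member_le_sum) auto
    also have "\<dots> \<le> (\<Sum>j<n. \<Sum>k\<le>d. f i j k)" using that f0 by (intro member_le_sum[of j]) (auto intro!: sum_nonneg)
    also have "\<dots> \<le> (\<Sum>i<m. \<Sum>j<n. \<Sum>k\<le>d. f i j k)" using that f0 by (intro member_le_sum[of i]) (auto intro!: sum_nonneg)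
    finally show ?thesis by (simp add: C_def)
  qed
  \<comment> \<open>The cap 1 allows the square of \<epsilon> to be estimated by \<epsilon>.\<close>
  define \<delta> where "\<delta> = min 1 (e / C)"
  show thesis
  proof (rule that)
    show "\<delta> > 0" using C0 assms by (simp add: \<delta>_def)
  next
    fix \<epsilon> :: complex and P Q :: "complex poly mat"
    assume \<epsilon>: "0 < cmod \<epsilon>" "cmod \<epsilon> < \<delta>"
      and Q: "\<And>i j. i < m \<Longrightarrow> j < n \<Longrightarrow> Q $$ (i,j) = P $$ (i,j) + smult \<epsilon> (A i j) + smult (\<epsilon>\<^sup>2) (B i j)"
    show "coeff_near m n d e P Q" unfolding coeff_near_def
    proof (intro allI impI)
      fix i j k assume ijk: "i < m" "j < n" "k \<le> d"
      have "coeff (P $$ (i,j)) k - coeff (Q $$ (i,j)) k = - (\<epsilon> * coeff (A i j) k + \<epsilon>\<^sup>2 * coeff (B i j) k)"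
        using Q ijk by simp
      then have "cmod (coeff (P $$ (i,j)) k - coeff (Q $$ (i,j)) k) = cmod (\<epsilon> * coeff (A i j) k + \<epsilon>\<^sup>2 * coeff (B i j) k)"
        by (simp only: norm_minus_cancel)
      also have "\<dots> \<le> cmod \<epsilon> * cmod (coeff (A i j) k) + (cmod \<epsilon>)\<^sup>2 * cmod (coeff (B i j) k)"
        by (rule norm_triangle_le) (simp add: norm_mult norm_power)
      also have "\<dots> \<le> cmod \<epsilon> * cmod (coeff (A i j) k) + cmod \<epsilon> * cmod (coeff (B i j) k)"
        using \<epsilon> by (intro add_left_mono mult_right_mono) (auto simp: \<delta>_def power2_eq_square mult_left_le)
      also have "\<dots> = cmod \<epsilon> * f i j k" by (simp add: f_def distrib_left)
      also have "\<dots> \<le> cmod \<epsilon> * C" using fC[OF ijk] by (intro mult_left_mono) auto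
      also have "\<dots> < e" using \<epsilon> C0 by (simp add: \<delta>_def pos_less_divide_eq)
      finally show "cmod (coeff (P $$ (i,j)) k - coeff (Q $$ (i,j)) k) < e" .
    qed
  qed
qed

text \<open>Upper bounds instead of exact degrees, because bounds survive perturbation of the
  factors. Products from \<open>setA\<close> lie in such a set for some \<open>dd\<close>, those
  from \<open>setC\<close> for the balanced one.\<close>

definition factored :: "nat \<Rightarrow> nat \<Rightarrow> nat \<Rightarrow> nat \<Rightarrow> (nat \<Rightarrow> nat) \<Rightarrow> complex poly mat set" where
  "factored m n r d dd = {L * R | L R. L \<in> carrier_mat m r \<and> R \<in> carrier_mat r n \<and>
     (\<forall>i<r. (\<forall>j<n. degree (R $$ (i,j)) \<le> dd i) \<and> (\<forall>j<m. degree (L $$ (j,i)) \<le> d - dd i))}"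

lemma product_in_pmats:
  assumes L: "L \<in> carrier_mat m r" and R: "R \<in> carrier_mat r n" and dd: "\<And>i. i < r \<Longrightarrow> dd i \<le> d"
    and deg: "\<And>i j. i < r \<Longrightarrow> j < n \<Longrightarrow> degree (R $$ (i,j)) \<le> dd i"
      "\<And>i j. i < r \<Longrightarrow> j < m \<Longrightarrow> degree (L $$ (j,i)) \<le> d - dd i"
  shows "L * R \<in> pmats m n d"
  unfolding pmats_def
proof (safe intro!: mult_carrier_mat[OF L R])
  fix i j assume ij: "i < m" "j < n"
  have "degree (L $$ (i,k) * R $$ (k,j)) \<le> d" if "k < r" for k
    using degree_mult_le_bounds[OF deg(2)[OF that ij(1)] deg(1)[OF that ij(2)]] dd[OF that] by simp
  then show "degree ((L * R) $$ (i,j)) \<le> d"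
    unfolding index_mult_mat_sum[OF L R ij] by (intro degree_sum_le) auto
qed

lemma degree_le_SucD: "degree p \<le> Suc a \<Longrightarrow> coeff p (Suc a) = 0 \<Longrightarrow> degree p \<le> a"
  by (metis degree_0 eq_zero_or_degree_less le_Suc_eq zero_le leading_coeff_0_iff)

lemma sum_remove2:
  fixes f :: "nat \<Rightarrow> 'a::comm_monoid_add"
  assumes "u < r" "v < r" "u \<noteq> v"
  shows "(\<Sum>i<r. f i) = f u + f v + (\<Sum>i\<in>{..<r} - {u,v}. f i)"
proof -
  have "(\<Sum>i<r. f i) = f u + (\<Sum>i\<in>{..<r} - {u}. f i)" using assms by (intro sum.remove) auto
  also have "(\<Sum>i\<in>{..<r} - {u}. f i) = f v + (\<Sum>i\<in>{..<r} - {u} - {v}. f i)" using assms by (intro sum.remove) auto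
  also have "{..<r} - {u} - {v} = {..<r} - {u,v}" by auto
  finally show ?thesis by (simp add: add.assoc)
qed

text \<open>One degree is moved from row \<open>u\<close> of \<open>R\<close> to row \<open>v\<close>: a perturbation of size \<open>\<epsilon>\<close> raises the
  degree of row \<open>v\<close> so that a multiple of it cancels the leading term of row \<open>u\<close>. The inverse column
  operation on a similarly perturbed \<open>L\<close> keeps the product close to \<open>L * R\<close>.\<close>
lemma factored_transfer:
  assumes uv: "u < r" "v < r" and lt: "dd v < dd u" and dd: "\<And>i. i < r \<Longrightarrow> dd i \<le> d"
  shows "factored m n r d dd \<subseteq> pm_closure m n d (factored m n r d (dd(u := dd u - 1, v := dd v + 1)))"
proof
  fix P assume "P \<in> factored m n r d dd"
  then obtain L R where L: "L \<in> carrier_mat m r" and R: "R \<in> carrier_mat r n" and P: "P = L * R"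
    and dR: "\<And>i j. i < r \<Longrightarrow> j < n \<Longrightarrow> degree (R $$ (i,j)) \<le> dd i"
    and dL: "\<And>i j. i < r \<Longrightarrow> j < m \<Longrightarrow> degree (L $$ (j,i)) \<le> d - dd i"
    unfolding factored_def by blast
  define p q where "p = dd u" and "q = dd v"
  \<comment> \<open>After row \<open>v\<close> has gained a degree, a shift by \<open>k\<close>
    brings it to degree \<open>p\<close>.\<close>
  define k where "k = p - Suc q"
  have pqk: "p = k + Suc q" "p \<le> d" and neq: "u \<noteq> v" using lt dd[OF uv(1)] by (auto simp: p_def q_def k_def)
  have dpq: "d - q = k + Suc (d - p)" using pqk by simp
  define h where "h j = coeff (R $$ (u,j)) p" for j
  define g where "g t = coeff (L $$ (t,v)) (d - q)" for t
  define A where "A t j = monom (h j) (Suc q) * L $$ (t,v) - monom (g t) (Suc (d - p)) * R $$ (u,j)" for t j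
  show "P \<in> pm_closure m n d (factored m n r d (dd(u := dd u - 1, v := dd v + 1)))"
    unfolding pm_closure_iff
  proof (intro conjI allI impI)
    show "P \<in> pmats m n d" unfolding P by (rule product_in_pmats[OF L R dd dR dL])
  next
    fix e :: real assume "e > 0"
    then obtain \<delta> where \<delta>: "\<delta> > 0" and near: "\<And>\<epsilon> P Q. 0 < cmod \<epsilon> \<Longrightarrow> cmod \<epsilon> < \<delta> \<Longrightarrow>
      (\<And>i j. i < m \<Longrightarrow> j < n \<Longrightarrow> Q $$ (i,j) = P $$ (i,j) + smult \<epsilon> (A i j) + smult (\<epsilon>\<^sup>2) 0) \<Longrightarrow>
      coeff_near m n d e P Q"
      using perturbation_near[of e m n A "\<lambda>_ _. 0" d] by auto
    define \<epsilon> where "\<epsilon> = complex_of_real (\<delta> / 2)"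
    have \<epsilon>: "0 < cmod \<epsilon>" "cmod \<epsilon> < \<delta>" using \<delta> by (simp_all add: \<epsilon>_def norm_divide)
    then have \<epsilon>0: "\<epsilon> \<noteq> 0" by auto
    define rv where "rv j = R $$ (v,j) + monom (\<epsilon> * h j) (Suc q)" for j
    \<comment> \<open>Column \<open>u\<close> of \<open>L\<close> gains the degree that row
      \<open>u\<close> of \<open>R\<close> loses; the sign makes \<open>s * lu\<close> cancel the
      top coefficient \<open>g\<close> of column \<open>v\<close>.\<close>
    define lu where "lu t = L $$ (t,u) - monom (\<epsilon> * g t) (Suc (d - p))" for t
    \<comment> \<open>The multiplier is of size \<open>1 / \<epsilon>\<close> and so are the changes
      of the factors, but it enters \<open>R'\<close> and \<open>L'\<close> with opposite signs and
      drops out of the product.\<close>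
    define s where "s = monom (1 / \<epsilon>) k"
    define R' where "R' = mat r n (\<lambda>(i,j). if i = u then R $$ (u,j) - s * rv j else if i = v then rv j else R $$ (i,j))"
    define L' where "L' = mat m r (\<lambda>(t,i). if i = u then lu t else if i = v then L $$ (t,v) + s * lu t else L $$ (t,i))"
    have L': "L' \<in> carrier_mat m r" and R': "R' \<in> carrier_mat r n" by (simp_all add: L'_def R'_def)
    have drv: "degree (rv j) \<le> Suc q" if "j < n" for j
      unfolding rv_def using dR[OF uv(2) that] degree_monom_le[of "\<epsilon> * h j" "Suc q"]
      by (intro degree_add_le) (auto simp: q_def)
    have crv: "coeff (rv j) (Suc q) = \<epsilon> * h j" if "j < n" for j
    proof -
      have "degree (R $$ (v,j)) < Suc q" using dR[OF uv(2) that] by (simp add: q_def)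
      then show ?thesis by (simp add: rv_def coeff_eq_0)
    qed
    have dlu: "degree (lu t) \<le> Suc (d - p)" if "t < m" for t
      unfolding lu_def using dL[OF uv(1) that] degree_monom_le[of "\<epsilon> * g t" "Suc (d - p)"]
      by (intro degree_diff_le) (auto simp: p_def)
    have clu: "coeff (lu t) (Suc (d - p)) = - \<epsilon> * g t" if "t < m" for t
    proof -
      have "degree (L $$ (t,u)) < Suc (d - p)" using dL[OF uv(1) that] by (simp add: p_def)
      then show ?thesis by (simp add: lu_def coeff_eq_0)
    qed
    have ds: "degree s \<le> k" unfolding s_def by (rule degree_monom_le)
    have cs: "coeff s k = 1 / \<epsilon>" by (simp add: s_def)
    have dru: "degree (R $$ (u,j) - s * rv j) \<le> p - 1" if j: "j < n" for j
    proof (rule degree_le_SucD)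
      have "degree (s * rv j) \<le> p" unfolding pqk(1) by (rule degree_mult_le_bounds[OF ds drv[OF j]])
      then show "degree (R $$ (u,j) - s * rv j) \<le> Suc (p - 1)"
        using dR[OF uv(1) j] pqk by (intro degree_diff_le) (auto simp: p_def)
      have "coeff (s * rv j) p = h j"
        unfolding pqk(1) coeff_mult_at_bounds[OF ds drv[OF j]] using \<epsilon>0 by (simp add: cs crv[OF j])
      then show "coeff (R $$ (u,j) - s * rv j) (Suc (p - 1)) = 0" using pqk by (simp add: h_def)
    qed
    have dlv: "degree (L $$ (t,v) + s * lu t) \<le> d - Suc q" if t: "t < m" for t
    proof (rule degree_le_SucD)
      have dq: "Suc (d - Suc q) = d - q" using pqk by simp
      have "degree (s * lu t) \<le> d - q" unfolding dpq by (rule degree_mult_le_bounds[OF ds dlu[OF t]])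
      then show "degree (L $$ (t,v) + s * lu t) \<le> Suc (d - Suc q)"
        unfolding dq using dL[OF uv(2) t] by (intro degree_add_le) (auto simp: q_def)
      have "coeff (s * lu t) (d - q) = - g t"
        unfolding dpq coeff_mult_at_bounds[OF ds dlu[OF t]] using \<epsilon>0 by (simp add: cs clu[OF t])
      then show "coeff (L $$ (t,v) + s * lu t) (Suc (d - Suc q)) = 0" unfolding dq by (simp add: g_def)
    qed
    have "\<forall>i<r. (\<forall>j<n. degree (R' $$ (i,j)) \<le> (dd(u := dd u - 1, v := dd v + 1)) i)
        \<and> (\<forall>j<m. degree (L' $$ (j,i)) \<le> d - (dd(u := dd u - 1, v := dd v + 1)) i)"
    proof (intro allI impI conjI)
      fix i j assume "i < r" "j < n"
      then show "degree (R' $$ (i,j)) \<le> (dd(u := dd u - 1, v := dd v + 1)) i"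
        using dru drv dR neq by (auto simp: R'_def p_def q_def)
    next
      fix i j assume "i < r" "j < m"
      moreover have "Suc (d - p) = d - (p - 1)" using pqk by simp
      ultimately show "degree (L' $$ (j,i)) \<le> d - (dd(u := dd u - 1, v := dd v + 1)) i"
        using dlu dlv dL neq by (auto simp: L'_def p_def q_def)
    qed
    then have "L' * R' \<in> factored m n r d (dd(u := dd u - 1, v := dd v + 1))"
      unfolding factored_def using L' R' by blast
    moreover have "coeff_near m n d e P (L' * R')"
    proof (rule near[OF \<epsilon>])
      fix t j assume tj: "t < m" "j < n"
      have "(L' * R') $$ (t,j) = lu t * (R $$ (u,j) - s * rv j) + (L $$ (t,v) + s * lu t) * rv j
          + (\<Sum>i\<in>{..<r} - {u,v}. L $$ (t,i) * R $$ (i,j))"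
        unfolding index_mult_mat_sum[OF L' R' tj] sum_remove2[OF uv neq] using uv neq tj
        by (intro arg_cong2[where f = "(+)"] sum.cong) (auto simp: L'_def R'_def)
      also have "lu t * (R $$ (u,j) - s * rv j) + (L $$ (t,v) + s * lu t) * rv j
          = L $$ (t,u) * R $$ (u,j) + L $$ (t,v) * R $$ (v,j)
            + (monom (\<epsilon> * h j) (Suc q) * L $$ (t,v) - monom (\<epsilon> * g t) (Suc (d - p)) * R $$ (u,j))"
        by (simp add: lu_def rv_def algebra_simps)
      also have "monom (\<epsilon> * h j) (Suc q) * L $$ (t,v) - monom (\<epsilon> * g t) (Suc (d - p)) * R $$ (u,j) = smult \<epsilon> (A t j)"
        by (simp add: A_def smult_diff_right smult_monom[symmetric])
      finally show "(L' * R') $$ (t,j) = P $$ (t,j) + smult \<epsilon> (A t j) + smult (\<epsilon>\<^sup>2) 0"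
        unfolding P index_mult_mat_sum[OF L R tj] sum_remove2[OF uv neq] by (simp add: algebra_simps)
    qed
    ultimately show "\<exists>Q\<in>factored m n r d (dd(u := dd u - 1, v := dd v + 1)). coeff_near m n d e P Q" by blast
  qed
qed

lemma factored_in_pmats: "(\<And>i. i < r \<Longrightarrow> dd i \<le> d) \<Longrightarrow> factored m n r d dd \<subseteq> pmats m n d"
proof
  fix P assume dd: "\<And>i. i < r \<Longrightarrow> dd i \<le> d" and "P \<in> factored m n r d dd"
  then obtain L R where "L \<in> carrier_mat m r" "R \<in> carrier_mat r n" "P = L * R"
    and "\<And>i j. i < r \<Longrightarrow> j < n \<Longrightarrow> degree (R $$ (i,j)) \<le> dd i"
    and "\<And>i j. i < r \<Longrightarrow> j < m \<Longrightarrow> degree (L $$ (j,i)) \<le> d - dd i"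
    unfolding factored_def by blast
  then show "P \<in> pmats m n d" using product_in_pmats[of L m r R n dd d] dd by blast
qed

lemma subset_pm_closure: "S \<subseteq> pmats m n d \<Longrightarrow> S \<subseteq> pm_closure m n d S"
proof
  fix P assume "S \<subseteq> pmats m n d" "P \<in> S"
  then show "P \<in> pm_closure m n d S"
    unfolding pm_closure_iff by (intro conjI allI impI bexI[of _ P]) (auto simp: coeff_near_def)
qed

lemma factored_cong: "(\<And>i. i < r \<Longrightarrow> dd i = dd' i) \<Longrightarrow> factored m n r d dd = factored m n r d dd'"
  unfolding factored_def by (simp cong: conj_cong)

text \<open>While some \<open>dd u\<close> exceeds \<open>\<tau> u\<close>, equal sums provide a
  \<open>v\<close> with \<open>dd v < \<tau> v\<close>, and moving a degree from \<open>u\<close> to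
  \<open>v\<close> lowers the total excess. Finitely many approximations compose by
  \<open>pm_closure_trans\<close>.\<close>

lemma factored_balance:
  assumes "\<And>i. i < r \<Longrightarrow> dd i \<le> d" and "(\<Sum>i<r. dd i) = (\<Sum>i<r. \<tau> i)"
    and bal: "\<And>i j. i < r \<Longrightarrow> j < r \<Longrightarrow> \<tau> i \<le> Suc (\<tau> j)"
  shows "factored m n r d dd \<subseteq> pm_closure m n d (factored m n r d \<tau>)"
  using assms(1,2)
proof (induction "\<Sum>i<r. dd i - \<tau> i" arbitrary: dd rule: less_induct)
  case less
  show ?case
  proof (cases "\<exists>u<r. \<tau> u < dd u")
    case False
    then have le: "dd i \<le> \<tau> i" if "i \<in> {..<r}" for i using that not_less by auto
    have "dd i = \<tau> i" if "i < r" for i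
      using sum_mono_inv[of dd "{..<r}" \<tau> i] less.prems(2) le that by auto
    then have "factored m n r d \<tau> = factored m n r d dd" by (intro factored_cong) auto
    then show ?thesis using subset_pm_closure factored_in_pmats[of r dd d m n] less.prems(1) by simp
  next
    case True
    then obtain u where u: "u < r" "\<tau> u < dd u" by blast
    have "\<exists>v<r. dd v < \<tau> v"
    proof (rule ccontr)
      assume "\<not> ?thesis"
      then have "\<And>i. i \<in> {..<r} \<Longrightarrow> \<tau> i \<le> dd i" using not_less by auto
      then have "(\<Sum>i<r. \<tau> i) < (\<Sum>i<r. dd i)" using u by (intro sum_strict_mono_ex1) auto
      then show False using less.prems(2) by simp
    qed
    then obtain v where v: "v < r" "dd v < \<tau> v" by blast
    \<comment> \<open>Balance gives \<open>dd v < \<tau> v \<le> \<tau> u + 1 \<le> dd u\<close>, as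
      the transfer requires.\<close>
    have lt: "dd v < dd u" using u v bal[OF v(1) u(1)] by linarith
    then have neq: "u \<noteq> v" by auto
    define dd' where "dd' = dd(u := dd u - 1, v := dd v + 1)"
    have "(\<Sum>i<r. dd' i) = (\<Sum>i<r. dd i)"
      unfolding sum_remove2[OF u(1) v(1) neq] using neq lt by (auto simp: dd'_def intro!: sum.cong)
    moreover have "(\<Sum>i<r. dd' i - \<tau> i) < (\<Sum>i<r. dd i - \<tau> i)"
      using u v neq by (intro sum_strict_mono_ex1) (auto simp: dd'_def)
    moreover have "dd' i \<le> d" if "i < r" for i
      using less.prems(1)[OF that] less.prems(1)[OF u(1)] lt by (auto simp: dd'_def)
    ultimately have "factored m n r d dd' \<subseteq> pm_closure m n d (factored m n r d \<tau>)"
      using less.hyps[of dd'] less.prems(2) by simp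
    then have "pm_closure m n d (factored m n r d dd') \<subseteq> pm_closure m n d (factored m n r d \<tau>)"
      by (rule pm_closure_trans)
    moreover have "factored m n r d dd \<subseteq> pm_closure m n d (factored m n r d dd')"
      unfolding dd'_def by (rule factored_transfer[OF u(1) v(1) lt less.prems(1)])
    ultimately show ?thesis by blast
  qed
qed

definition balanced :: "nat \<Rightarrow> nat \<Rightarrow> nat \<Rightarrow> nat" where
  "balanced r a i = (if i < a mod r then a div r + 1 else a div r)"

lemma balanced_sum: "0 < r \<Longrightarrow> (\<Sum>i<r. balanced r a i) = a"
proof -
  assume r: "0 < r"
  have "(\<Sum>i<r. balanced r a i) = (\<Sum>i<r. a div r + (if i < a mod r then 1 else 0))"
    by (intro sum.cong) (auto simp: balanced_def)
  also have "\<dots> = r * (a div r) + card ({..<r} \<inter> {i. i < a mod r})"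
    by (simp add: sum.distrib sum.If_cases)
  also have "{..<r} \<inter> {i. i < a mod r} = {..<a mod r}" using mod_less_divisor[OF r, of a] by auto
  finally show ?thesis by simp
qed

lemma balanced_le: "0 < r \<Longrightarrow> a \<le> r * d \<Longrightarrow> balanced r a i \<le> d"
proof -
  assume r: "0 < r" and a: "a \<le> r * d"
  have "r * (a div r) + a mod r \<le> r * d" using a by simp
  then show ?thesis
  proof (cases "i < a mod r")
    case True
    then have "r * (a div r) < r * d" using \<open>r * (a div r) + a mod r \<le> r * d\<close> by linarith
    then show ?thesis using True by (simp add: balanced_def)
  next
    case False
    have "r * (a div r) \<le> r * d" using \<open>r * (a div r) + a mod r \<le> r * d\<close> by linarith
    then show ?thesis using False r by (simp add: balanced_def)
  qed
qed

lemma fmat_transpose: "fmat (transpose_mat X) = transpose_mat (fmat X)"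
  by (rule eq_matI) (auto simp: fmat_def)

lemma left_nullspace_transpose: "left_nullspace X = right_nullspace (transpose_mat X)"
  unfolding left_nullspace_def right_nullspace_def fmat_transpose by simp

lemma exists_small_avoiding:
  assumes "finite F" and "\<delta> > 0"
  obtains \<epsilon> :: complex where "\<epsilon> \<notin> F" "0 < cmod \<epsilon>" "cmod \<epsilon> < \<delta>"
proof -
  have "infinite (complex_of_real ` {0<..<\<delta>})"
    using assms(2) infinite_Ioo[of 0 \<delta>] by (simp add: finite_image_iff inj_on_def)
  then obtain \<epsilon> where "\<epsilon> \<in> complex_of_real ` {0<..<\<delta>}" "\<epsilon> \<notin> F"
    using assms(1) by (meson finite_subset subsetI)
  then show thesis using that[of \<epsilon>] by auto
qed

lemma generic_rows_cong:
  assumes "\<And>i j. i < r \<Longrightarrow> j < n \<Longrightarrow> R i j = R' i j"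
  shows "generic_rows r n dd \<alpha> R \<longleftrightarrow> generic_rows r n dd \<alpha> R'"
  unfolding generic_rows_def surjective_upto_def using assms by (simp cong: conj_cong)

section \<open>Density of products of generic factors\<close>

lemma generic_conds_MH:
  assumes rm: "r < m" and rn: "r < n" and r: "0 < r" and a: "a \<le> r * d"
    and L: "L \<in> carrier_mat m r" and R: "R \<in> carrier_mat r n"
    and gR: "generic_rows r n (balanced r a) (a div (n - r)) (\<lambda>i j. R $$ (i,j))"
    and gL: "generic_rows r m (\<lambda>i. d - balanced r a i) ((r * d - a) div (m - r)) (\<lambda>i j. L $$ (j,i))"
  shows "conds_MH m n r d a L R"
proof -
  have Lt: "transpose_mat L \<in> carrier_mat r m" using L by simp
  have sumL: "r * d - a = (\<Sum>i<r. d - balanced r a i)"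
    using balanced_le[OF r a] balanced_sum[OF r, of a] by (subst sum_subtractf_nat) auto
  have idx: "generic_rows r m dd k (\<lambda>i j. L $$ (j,i)) \<longleftrightarrow> generic_rows r m dd k (\<lambda>i j. transpose_mat L $$ (i,j))" for dd k
    using L by (intro generic_rows_cong) simp
  note gLt = gL[unfolded idx]
  note mR = generic_rows_minimal_rows[OF gR] and mL = generic_rows_minimal_rows[OF gLt]
  have colL: "vdeg (col L i) = ereal (real (d - balanced r a i))" if "i < r" for i
    using minimal_rows_row_degree[OF Lt mL that] that L by simp
  have "conds_B m n r d a L R" unfolding conds_B_def
    using L R minimal_rows_row_degree[OF R mR] colL balanced_le[OF r a]
    by (auto simp: balanced_def of_nat_diff)
  moreover have "is_minimal_basis_list m (cols L)"
    using minimal_rows_minimal_basis_list[OF Lt mL] by simp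
  moreover have "is_minimal_basis_list n (rows R)" by (rule minimal_rows_minimal_basis_list[OF R mR])
  moreover have "has_minimal_indices m (left_nullspace L)
        (mi_spec (m - r) ((r * d - a) div (m - r)) ((r * d - a) mod (m - r)))"
    unfolding left_nullspace_transpose by (rule generic_rows_nullspace_indices[OF Lt rm sumL gLt])
  moreover have "has_minimal_indices n (right_nullspace R)
        (mi_spec (n - r) (a div (n - r)) (a mod (n - r)))"
    by (rule generic_rows_nullspace_indices[OF R rn balanced_sum[OF r, symmetric] gR])
  ultimately show ?thesis unfolding conds_MH_def conds_M_def by blast
qed

text \<open>Both factors move towards their explicit generic examples with the same \<epsilon>,
  chosen outside the finite exceptional sets of both. The product changes by a term of first order
  and one of second order in \<epsilon>.\<close>

lemma factored_balanced_subset_closure: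
  assumes rm: "r < m" and rn: "r < n" and r: "0 < r" and a: "a \<le> r * d"
  shows "factored m n r d (balanced r a) \<subseteq> pm_closure m n d (setMH m n r d a)"
proof
  fix P assume P: "P \<in> factored m n r d (balanced r a)"
  then obtain L R where L: "L \<in> carrier_mat m r" and R: "R \<in> carrier_mat r n" and PLR: "P = L * R"
    and dR: "\<And>i j. i < r \<Longrightarrow> j < n \<Longrightarrow> degree (R $$ (i,j)) \<le> balanced r a i"
    and dL: "\<And>i j. i < r \<Longrightarrow> j < m \<Longrightarrow> degree (L $$ (j,i)) \<le> d - balanced r a i"
    unfolding factored_def by blast
  have sumL: "r * d - a = (\<Sum>i<r. d - balanced r a i)"
    using balanced_le[OF r a] balanced_sum[OF r, of a] by (subst sum_subtractf_nat) auto
  obtain Z where Z: "generic_rows r n (balanced r a) (a div (n - r)) Z"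
    by (rule generic_rows_exist[OF r rn balanced_sum[OF r, symmetric]])
  obtain Y where Y: "generic_rows r m (\<lambda>i. d - balanced r a i) ((r * d - a) div (m - r)) Y"
    by (rule generic_rows_exist[OF r rm sumL])
  define F where "F = {\<epsilon>. \<not> generic_rows r n (balanced r a) (a div (n - r)) (\<lambda>i j. R $$ (i,j) + smult \<epsilon> (Z i j))}
     \<union> {\<epsilon>. \<not> generic_rows r m (\<lambda>i. d - balanced r a i) ((r * d - a) div (m - r)) (\<lambda>i j. L $$ (j,i) + smult \<epsilon> (Y i j))}"
  have F: "finite F" unfolding F_def
    using generic_rows_perturb[OF dR Z] generic_rows_perturb[of r m "\<lambda>i j. L $$ (j,i)", OF dL Y] by simp
  define A where "A t j = (\<Sum>i<r. L $$ (t,i) * Z i j + Y i t * R $$ (i,j))" for t j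
  define B where "B t j = (\<Sum>i<r. Y i t * Z i j)" for t j
  show "P \<in> pm_closure m n d (setMH m n r d a)" unfolding pm_closure_iff
  proof (intro conjI allI impI)
    show "P \<in> pmats m n d" using factored_in_pmats balanced_le[OF r a] P by blast
  next
    fix e :: real assume "e > 0"
    then obtain \<delta> where \<delta>: "\<delta> > 0" and near: "\<And>\<epsilon> P Q. 0 < cmod \<epsilon> \<Longrightarrow> cmod \<epsilon> < \<delta> \<Longrightarrow>
      (\<And>i j. i < m \<Longrightarrow> j < n \<Longrightarrow> Q $$ (i,j) = P $$ (i,j) + smult \<epsilon> (A i j) + smult (\<epsilon>\<^sup>2) (B i j)) \<Longrightarrow>
      coeff_near m n d e P Q"
      using perturbation_near[of e m n A B d] by auto
    obtain \<epsilon> where \<epsilon>: "\<epsilon> \<notin> F" "0 < cmod \<epsilon>" "cmod \<epsilon> < \<delta>" by (rule exists_small_avoiding[OF F \<delta>])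
    define R' where "R' = mat r n (\<lambda>(i,j). R $$ (i,j) + smult \<epsilon> (Z i j))"
    define L' where "L' = mat m r (\<lambda>(j,i). L $$ (j,i) + smult \<epsilon> (Y i j))"
    have L': "L' \<in> carrier_mat m r" and R': "R' \<in> carrier_mat r n" by (simp_all add: L'_def R'_def)
    have "generic_rows r n (balanced r a) (a div (n - r)) (\<lambda>i j. R' $$ (i,j))"
      and "generic_rows r m (\<lambda>i. d - balanced r a i) ((r * d - a) div (m - r)) (\<lambda>i j. L' $$ (j,i))"
      using \<epsilon>(1) generic_rows_cong[of r n "\<lambda>i j. R' $$ (i,j)" "\<lambda>i j. R $$ (i,j) + smult \<epsilon> (Z i j)"]
        generic_rows_cong[of r m "\<lambda>i j. L' $$ (j,i)" "\<lambda>i j. L $$ (j,i) + smult \<epsilon> (Y i j)"]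
      unfolding F_def by (simp_all add: R'_def L'_def)
    then have "conds_MH m n r d a L' R'" by (rule generic_conds_MH[OF rm rn r a L' R'])
    then have "L' * R' \<in> setMH m n r d a" unfolding setMH_def by blast
    moreover have "coeff_near m n d e P (L' * R')"
    proof (rule near[OF \<epsilon>(2,3)])
      fix t j assume tj: "t < m" "j < n"
      have "(L' * R') $$ (t,j) = (\<Sum>i<r. L $$ (t,i) * R $$ (i,j) + smult \<epsilon> (L $$ (t,i) * Z i j + Y i t * R $$ (i,j))
          + smult (\<epsilon>\<^sup>2) (Y i t * Z i j))"
        unfolding index_mult_mat_sum[OF L' R' tj] using tj
        by (intro sum.cong) (auto simp: L'_def R'_def algebra_simps smult_add_right power2_eq_square)
      then show "(L' * R') $$ (t,j) = P $$ (t,j) + smult \<epsilon> (A t j) + smult (\<epsilon>\<^sup>2) (B t j)"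
        unfolding PLR index_mult_mat_sum[OF L R tj] A_def B_def by (simp only: sum.distrib smult_sum2 smult_add_right)
    qed
    ultimately show "\<exists>Q\<in>setMH m n r d a. coeff_near m n d e P Q" by blast
  qed
qed

section \<open>Rank, invariant polynomials and reversal\<close>

lemma fmat_carrier[simp]: "fmat A \<in> carrier_mat m n \<longleftrightarrow> A \<in> carrier_mat m n"
  by (simp add: fmat_def)

lemma fmat_one: "fmat (1\<^sub>m n) = 1\<^sub>m n"
  by (rule eq_matI) (auto simp: fmat_def)

lemma fmat_mult:
  assumes A: "A \<in> carrier_mat m k" and B: "B \<in> carrier_mat k n"
  shows "fmat (A * B) = fmat A * fmat B"
proof (rule eq_matI)
  fix i j assume "i < dim_row (fmat A * fmat B)" "j < dim_col (fmat A * fmat B)"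
  then have ij: "i < m" "j < n" using A B by (auto simp: fmat_def)
  have AB: "fmat A \<in> carrier_mat m k" "fmat B \<in> carrier_mat k n" using A B by simp_all
  have "fmat (A * B) $$ (i,j) = to_fract (\<Sum>l<k. A $$ (i,l) * B $$ (l,j))"
    using A B ij index_mult_mat_sum[OF A B ij] by (simp add: fmat_def)
  also have "\<dots> = (\<Sum>l<k. fmat A $$ (i,l) * fmat B $$ (l,j))"
    unfolding to_fract_sum using A B ij by (intro sum.cong) (auto simp: fmat_def to_fract_mult)
  also have "\<dots> = (fmat A * fmat B) $$ (i,j)" by (rule index_mult_mat_sum[OF AB ij, symmetric])
  finally show "fmat (A * B) $$ (i,j) = (fmat A * fmat B) $$ (i,j)" .
qed (use A B in \<open>auto simp: fmat_def\<close>)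

section \<open>Null spaces and rank of a product of primitive factors\<close>

lemma primitive_rows_right_inverse_mat:
  assumes R: "R \<in> carrier_mat r n" and prim: "primitive_rows r n (\<lambda>i j. R $$ (i,j))"
  obtains X where "X \<in> carrier_mat n r" "R * X = 1\<^sub>m r"
proof -
  obtain X where X: "\<And>i i'. i < r \<Longrightarrow> i' < r \<Longrightarrow> (\<Sum>j<n. R $$ (i,j) * X j i') = of_bool (i = i')"
    by (rule primitive_rows_right_inverse[OF prim]) blast
  define M where "M = mat n r (\<lambda>(j,i). X j i)"
  have M: "M \<in> carrier_mat n r" by (simp add: M_def)
  have "R * M = 1\<^sub>m r"
  proof (rule eq_matI)
    fix i j assume "i < dim_row (1\<^sub>m r)" "j < dim_col (1\<^sub>m r)"
    then have ij: "i < r" "j < r" by simp_all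
    have "(R * M) $$ (i,j) = (\<Sum>l<n. R $$ (i,l) * X l j)"
      unfolding index_mult_mat_sum[OF R M ij] using ij by (intro sum.cong) (auto simp: M_def)
    then show "(R * M) $$ (i,j) = 1\<^sub>m r $$ (i,j)" using X ij by simp
  qed (use R M in auto)
  then show thesis using that M by blast
qed

text \<open>\<open>L\<close> has a polynomial left inverse \<open>Y\<close>, so
  \<open>R = Y * (L * R)\<close>, and each of the two matrices is a left multiple of the
  other.\<close>

lemma right_nullspace_mult:
  assumes L: "L \<in> carrier_mat m r" and R: "R \<in> carrier_mat r n"
    and prim: "primitive_rows r m (\<lambda>i j. L $$ (j,i))"
  shows "right_nullspace (L * R) = right_nullspace R"
proof -
  have Lt: "transpose_mat L \<in> carrier_mat r m" using L by simp
  have "primitive_rows r m (\<lambda>i j. transpose_mat L $$ (i,j))"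
    using prim L by (simp add: primitive_rows_def)
  then obtain X where X: "X \<in> carrier_mat m r" "transpose_mat L * X = 1\<^sub>m r"
    by (rule primitive_rows_right_inverse_mat[OF Lt])
  define Y where "Y = transpose_mat X"
  have Y: "Y \<in> carrier_mat r m" using X by (simp add: Y_def)
  have "Y * L = transpose_mat (transpose_mat L * X)"
    unfolding Y_def using transpose_mult[OF Lt X(1)] L by simp
  then have YL: "Y * L = 1\<^sub>m r" using X by simp
  have LR: "L * R \<in> carrier_mat m n" using L R by simp
  have "R = Y * (L * R)" using YL assoc_mult_mat[OF Y L R] R by simp
  then have fR: "fmat R = fmat Y * fmat (L * R)" using fmat_mult[OF Y LR] by simp
  have fLR: "fmat (L * R) = fmat L * fmat R" by (rule fmat_mult[OF L R])
  have "fmat (L * R) *\<^sub>v x = 0\<^sub>v m \<longleftrightarrow> fmat R *\<^sub>v x = 0\<^sub>v r" if x: "x \<in> carrier_vec n" for x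
  proof
    assume "fmat (L * R) *\<^sub>v x = 0\<^sub>v m"
    moreover have "fmat R *\<^sub>v x = fmat Y *\<^sub>v (fmat (L * R) *\<^sub>v x)"
      unfolding fR by (rule assoc_mult_mat_vec) (use Y LR x in auto)
    ultimately show "fmat R *\<^sub>v x = 0\<^sub>v r" using Y by auto
  next
    assume "fmat R *\<^sub>v x = 0\<^sub>v r"
    moreover have "fmat (L * R) *\<^sub>v x = fmat L *\<^sub>v (fmat R *\<^sub>v x)"
      unfolding fLR by (rule assoc_mult_mat_vec) (use L R x in auto)
    ultimately show "fmat (L * R) *\<^sub>v x = 0\<^sub>v m" using L by auto
  qed
  then show ?thesis unfolding right_nullspace_def using L R by auto
qed

lemma left_nullspace_mult:
  assumes L: "L \<in> carrier_mat m r" and R: "R \<in> carrier_mat r n"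
    and prim: "primitive_rows r n (\<lambda>i j. R $$ (i,j))"
  shows "left_nullspace (L * R) = left_nullspace L"
proof -
  have "primitive_rows r n (\<lambda>i j. transpose_mat R $$ (j,i))"
    using prim R by (simp add: primitive_rows_def)
  then have "right_nullspace (transpose_mat R * transpose_mat L) = right_nullspace (transpose_mat L)"
    using L R by (intro right_nullspace_mult) auto
  then show ?thesis unfolding left_nullspace_transpose using transpose_mult[OF L R] by simp
qed

text \<open>A right inverse of \<open>R\<close> gives \<open>L * R\<close> the same column space as
  \<open>L\<close>, and the columns of \<open>L\<close> are independent because its null space is
  trivial.\<close>

lemma normal_rank_mult:
  assumes L: "L \<in> carrier_mat m r" and R: "R \<in> carrier_mat r n"
    and primL: "primitive_rows r m (\<lambda>i j. L $$ (j,i))" and primR: "primitive_rows r n (\<lambda>i j. R $$ (i,j))"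
  shows "normal_rank (L * R) = r"
proof -
  interpret vec_space "TYPE(complex poly fract)" m .
  obtain X where X: "X \<in> carrier_mat n r" "R * X = 1\<^sub>m r" by (rule primitive_rows_right_inverse_mat[OF R primR])
  have LR: "L * R \<in> carrier_mat m n" using L R by simp
  have fc: "fmat L \<in> carrier_mat m r" "fmat R \<in> carrier_mat r n" "fmat X \<in> carrier_mat n r"
    "fmat (L * R) \<in> carrier_mat m n" using L R X LR by simp_all
  have dims: "dim_row (fmat L) = m" "dim_col (fmat L) = r" "dim_row (fmat (L * R)) = m" "dim_col (fmat (L * R)) = n"
    using fc(1,4)[THEN carrier_matD(1)] fc(1,4)[THEN carrier_matD(2)] by simp_all
  have "L = L * R * X" using assoc_mult_mat[OF L R X(1)] X(2) L by simp
  then have fL: "fmat L = fmat (L * R) * fmat X" using fmat_mult[OF LR X(1)] by simp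
  have fLR: "fmat (L * R) = fmat L * fmat R" by (rule fmat_mult[OF L R])
  have "col_space (fmat (L * R)) = col_space (fmat L)"
    unfolding col_space_eq[OF fc(4)] col_space_eq[OF fc(1)] dims
  proof (intro Collect_cong conj_cong refl iffI)
    fix y assume "\<exists>x\<in>carrier_vec n. fmat (L * R) *\<^sub>v x = y"
    then obtain x where x: "x \<in> carrier_vec n" "fmat (L * R) *\<^sub>v x = y" by blast
    then have "fmat L *\<^sub>v (fmat R *\<^sub>v x) = y"
      unfolding fLR using assoc_mult_mat_vec[OF fc(1,2) x(1)] by simp
    then show "\<exists>x\<in>carrier_vec r. fmat L *\<^sub>v x = y"
      using fc(2) x(1) by (intro bexI[of _ "fmat R *\<^sub>v x"]) auto
  next
    fix y assume "\<exists>x\<in>carrier_vec r. fmat L *\<^sub>v x = y"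
    then obtain x where x: "x \<in> carrier_vec r" "fmat L *\<^sub>v x = y" by blast
    then have "fmat (L * R) *\<^sub>v (fmat X *\<^sub>v x) = y"
      using assoc_mult_mat_vec[OF fc(4,3) x(1)] fL by simp
    then show "\<exists>x\<in>carrier_vec n. fmat (L * R) *\<^sub>v x = y"
      using fc(3) x(1) by (intro bexI[of _ "fmat X *\<^sub>v x"]) auto
  qed
  then have "rank (fmat (L * R)) = rank (fmat L)" unfolding rank_def col_space_def by simp
  also have "rank (fmat L) = r"
  proof -
    have kernel: "v = 0\<^sub>v r" if v: "v \<in> carrier_vec r" "fmat L *\<^sub>v v = 0\<^sub>v m" for v
    proof -
      have one: "right_nullspace (L * 1\<^sub>m r) = right_nullspace (1\<^sub>m r)"
        by (rule right_nullspace_mult[OF L _ primL]) auto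
      have "v \<in> right_nullspace (L * 1\<^sub>m r)" using v L by (simp add: right_nullspace_def)
      then have "v \<in> right_nullspace (1\<^sub>m r)" unfolding one .
      then show ?thesis using v(1) by (simp add: right_nullspace_def fmat_one)
    qed
    \<comment> \<open>\<open>lin_indpt\<close> speaks of the set of columns, so repetitions must be
      excluded; equal columns would put a difference of unit vectors into the kernel.\<close>
    have dist: "distinct (cols (fmat L))"
    proof (rule distinct_conv_nth[THEN iffD2], intro allI impI)
      fix i j assume "i < length (cols (fmat L))" "j < length (cols (fmat L))" "i \<noteq> j"
      then have ij: "i < r" "j < r" "i \<noteq> j" by (auto simp: dims)
      show "cols (fmat L) ! i \<noteq> cols (fmat L) ! j"
      proof
        assume "cols (fmat L) ! i = cols (fmat L) ! j"
        then have "col (fmat L) i = col (fmat L) j" using ij by (simp add: dims)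
        moreover have "fmat L *\<^sub>v unit_vec r k = col (fmat L) k" if "k < r" for k
          using fc(1) that by (intro eq_vecI) (auto simp: dims)
        ultimately have "fmat L *\<^sub>v (unit_vec r i - unit_vec r j) = 0\<^sub>v m"
          using ij fc(1) by (simp add: mult_minus_distrib_mat_vec[of _ m r])
        then have "unit_vec r i - unit_vec r j = (0\<^sub>v r :: complex poly fract vec)" by (intro kernel) auto
        then have "(unit_vec r i - unit_vec r j) $ i = (0\<^sub>v r :: complex poly fract vec) $ i" by simp
        then show False using ij by simp
      qed
    qed
    have "lin_indpt (set (cols (fmat L)))"
      using lin_depE[OF fc(1) _ dist] kernel by blast
    then show ?thesis by (rule lin_indpt_full_rank[OF fc(1) dist])
  qed
  finally show ?thesis unfolding normal_rank_def using L by simp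
qed

section \<open>The Smith form of a product of primitive factors, and the way back\<close>

lemma is_unit_det_of_inverse:
  assumes "V \<in> carrier_mat n n" and "W \<in> carrier_mat n n" and "V * W = 1\<^sub>m n"
  shows "is_unit (det V)"
  using det_mult[OF assms(1,2)] assms(3) by (intro dvdI[of _ _ "det W"]) simp

lemma unimodular_inverse:
  fixes U :: "complex poly mat"
  assumes U: "U \<in> carrier_mat n n" and "is_unit (det U)"
  obtains W where "W \<in> carrier_mat n n" "U * W = 1\<^sub>m n" "W * U = 1\<^sub>m n"
proof -
  obtain c where c: "1 = det U * c" using assms(2) by (rule dvdE)
  define W where "W = c \<cdot>\<^sub>m adj_mat U"
  have W: "W \<in> carrier_mat n n" using adj_mat(1)[OF U] by (simp add: W_def)
  have "U * W = c \<cdot>\<^sub>m (det U \<cdot>\<^sub>m 1\<^sub>m n)"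
    unfolding W_def mult_smult_distrib[OF U adj_mat(1)[OF U]] adj_mat(2)[OF U] by simp
  also have "\<dots> = 1\<^sub>m n" using c by (intro eq_matI) (auto simp: mult.commute)
  finally have 1: "U * W = 1\<^sub>m n" .
  have "W * U = c \<cdot>\<^sub>m (det U \<cdot>\<^sub>m 1\<^sub>m n)"
    unfolding W_def mult_smult_assoc_mat[OF adj_mat(1)[OF U] U] adj_mat(3)[OF U] by simp
  also have "\<dots> = 1\<^sub>m n" using c by (intro eq_matI) (auto simp: mult.commute)
  finally show thesis using that W 1 by blast
qed

text \<open>The unimodular completions bring both factors to identity blocks, whose product is the
  Smith form with all diagonal entries 1.\<close>

lemma invariant_polys_mult:
  assumes L: "L \<in> carrier_mat m r" and R: "R \<in> carrier_mat r n"
    and primL: "primitive_rows r m (\<lambda>i j. L $$ (j,i))" and primR: "primitive_rows r n (\<lambda>i j. R $$ (i,j))"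
  shows "invariant_polys (L * R) (replicate r 1)"
proof -
  have Lt: "transpose_mat L \<in> carrier_mat r m" using L by simp
  obtain V W where V: "V \<in> carrier_mat n n" "W \<in> carrier_mat n n" "V * W = 1\<^sub>m n"
    "R * V = mat r n (\<lambda>(i,j). of_bool (i = j))"
    by (rule primitive_rows_unimodular_completion[OF R primR])
  have "primitive_rows r m (\<lambda>i j. transpose_mat L $$ (i,j))"
    using primL L by (simp add: primitive_rows_def)
  then obtain V2 W2 where V2: "V2 \<in> carrier_mat m m" "W2 \<in> carrier_mat m m" "V2 * W2 = 1\<^sub>m m"
    "transpose_mat L * V2 = mat r m (\<lambda>(i,j). of_bool (i = j))"
    by (rule primitive_rows_unimodular_completion[OF Lt])
  define U where "U = transpose_mat V2"
  have U: "U \<in> carrier_mat m m" using V2 by (simp add: U_def)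
  have "U * L = transpose_mat (transpose_mat L * V2)"
    unfolding U_def using transpose_mult[OF Lt V2(1)] L by simp
  then have UL: "U * L = mat m r (\<lambda>(i,j). of_bool (i = j))" unfolding V2(4) by (intro eq_matI) auto
  have "U * (L * R) * V = (U * L) * (R * V)"
    using assoc_mult_mat[OF U L R] assoc_mult_mat[of "U * L" m r R n V n] U L R V by simp
  also have "\<dots> = mat m n (\<lambda>(i,j). if i = j \<and> i < r then 1 else 0)"
  proof (rule eq_matI)
    fix i j assume "i < dim_row (mat m n (\<lambda>(i,j). if i = j \<and> i < r then 1 else 0 :: complex poly))"
      "j < dim_col (mat m n (\<lambda>(i,j). if i = j \<and> i < r then 1 else 0 :: complex poly))"
    then have ij: "i < m" "j < n" by simp_all
    have ULc: "U * L \<in> carrier_mat m r" and RVc: "R * V \<in> carrier_mat r n" using U L R V by auto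
    have "((U * L) * (R * V)) $$ (i,j) = (\<Sum>k<r. if k = i then of_bool (i = j) else 0)"
      unfolding index_mult_mat_sum[OF ULc RVc ij] using ij by (intro sum.cong) (auto simp: UL V(4))
    then show "((U * L) * (R * V)) $$ (i,j) = mat m n (\<lambda>(i,j). if i = j \<and> i < r then 1 else 0) $$ (i,j)"
      using ij by simp
  qed (use U L R V in auto)
  finally have eq: "U * (L * R) * V = mat m n (\<lambda>(i,j). if i = j \<and> i < length (replicate r (1 :: complex poly)) then replicate r 1 ! i else 0)"
    by (auto intro!: cong_mat)
  have units: "is_unit (det U)" "is_unit (det V)"
    using is_unit_det_of_inverse[OF V(1-3)] is_unit_det_of_inverse[OF V2(1-3)] det_transpose[OF V2(1)]
    by (simp_all add: U_def)
  have "r \<le> min m n" using primitive_rows_le[OF primL] primitive_rows_le[OF primR] by simp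
  then show ?thesis unfolding invariant_polys_def using L R U V(1) units eq by auto
qed

lemma right_inverse_primitive:
  assumes X: "\<And>i i'. i < r \<Longrightarrow> i' < r \<Longrightarrow> (\<Sum>j<n. R i j * X j i') = of_bool (i = i')"
  shows "primitive_rows r n R"
  unfolding primitive_rows_def
proof (intro allI impI)
  fix z and c :: "nat \<Rightarrow> complex" and i
  assume c: "\<forall>j<n. (\<Sum>i<r. c i * poly (R i j) z) = 0" and i: "i < r"
  have "0 = (\<Sum>j<n. (\<Sum>i'<r. c i' * poly (R i' j) z) * poly (X j i) z)" using c by simp
  also have "\<dots> = (\<Sum>i'<r. c i' * poly (\<Sum>j<n. R i' j * X j i) z)"
    unfolding sum_distrib_right poly_sum sum_distrib_left by (subst sum.swap) (simp add: mult.assoc)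
  also have "\<dots> = (\<Sum>i'<r. if i' = i then c i else 0)" using X i by (intro sum.cong) auto
  also have "\<dots> = c i" using i by simp
  finally show "c i = 0" by simp
qed

text \<open>Inverting the two transformations of the Smith form leaves primitive outer factors. The
  list stays general because the one belonging to the reversal is not known in advance to have
  length \<open>r\<close>.\<close>

lemma invariant_polys_factor:
  assumes P: "P \<in> carrier_mat m n" and inv: "invariant_polys P es"
  obtains A B where "\<forall>j<m. \<forall>k<n. P $$ (j,k) = (\<Sum>i<length es. A j i * es ! i * B i k)"
    and "primitive_rows (length es) m (\<lambda>i j. A j i)" and "primitive_rows (length es) n B"
proof -
  have len: "length es \<le> m" "length es \<le> n" using inv P unfolding invariant_polys_def by auto
  obtain U V where U: "U \<in> carrier_mat m m" "is_unit (det U)" and V: "V \<in> carrier_mat n n" "is_unit (det V)"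
    and eq: "U * P * V = mat m n (\<lambda>(i,j). if i = j \<and> i < length es then es ! i else 0)"
    using inv P unfolding invariant_polys_def by auto
  obtain U' where U': "U' \<in> carrier_mat m m" "U * U' = 1\<^sub>m m" "U' * U = 1\<^sub>m m" by (rule unimodular_inverse[OF U])
  obtain V' where V': "V' \<in> carrier_mat n n" "V * V' = 1\<^sub>m n" "V' * V = 1\<^sub>m n" by (rule unimodular_inverse[OF V])
  define E where "E = mat m n (\<lambda>(i,j). if i = j \<and> i < length es then es ! i else 0)"
  have E: "E \<in> carrier_mat m n" by (simp add: E_def)
  have UP: "U * P \<in> carrier_mat m n" using U P by simp
  have "E * V' = U * P" unfolding E_def eq[symmetric] using assoc_mult_mat[OF UP V(1) V'(1)] V'(2) right_mult_one_mat[OF UP] by simp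
  then have "U' * (E * V') = P" using assoc_mult_mat[OF U'(1) U(1) P] U'(3) P by simp
  then have PE: "P = U' * (E * V')" by simp
  have EV: "E * V' \<in> carrier_mat m n" using E V' by simp
  have PU: "P $$ (j,k) = (\<Sum>i<length es. U' $$ (j,i) * es ! i * V' $$ (i,k))"
    if jk: "j < m" "k < n" for j k
  proof -
    have EVi: "(E * V') $$ (i,k) = (if i < length es then es ! i * V' $$ (i,k) else 0)" if i: "i < m" for i
    proof -
      have "(E * V') $$ (i,k) = (\<Sum>l<n. if l = i then (if i < length es then es ! i * V' $$ (i,k) else 0) else 0)"
        unfolding index_mult_mat_sum[OF E V'(1) i jk(2)] using i by (intro sum.cong) (auto simp: E_def)
      then show ?thesis using len by auto
    qed
    have "P $$ (j,k) = (\<Sum>i<m. U' $$ (j,i) * (E * V') $$ (i,k))"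
      using index_mult_mat_sum[OF U'(1) EV jk] PE by simp
    also have "\<dots> = (\<Sum>i<m. if i < length es then U' $$ (j,i) * es ! i * V' $$ (i,k) else 0)"
      using EVi by (intro sum.cong) auto
    also have "\<dots> = (\<Sum>i<length es. U' $$ (j,i) * es ! i * V' $$ (i,k))"
      using len by (intro sum.mono_neutral_cong_right) auto
    finally show ?thesis .
  qed
  show thesis
  proof (rule that)
    show "\<forall>j<m. \<forall>k<n. P $$ (j,k) = (\<Sum>i<length es. U' $$ (j,i) * es ! i * V' $$ (i,k))"
      using PU by blast
  next
    show "primitive_rows (length es) m (\<lambda>i j. U' $$ (j,i))"
    proof (rule right_inverse_primitive)
      fix i i' assume i: "i < length es" "i' < length es"
      then have im: "i' < m" "i < m" using len by auto
      have "(\<Sum>j<m. U' $$ (j,i) * U $$ (i',j)) = (U * U') $$ (i',i)"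
        unfolding index_mult_mat_sum[OF U(1) U'(1) im] by (simp add: mult.commute)
      then show "(\<Sum>j<m. U' $$ (j,i) * U $$ (i',j)) = of_bool (i = i')" using im by (auto simp: U'(2))
    qed
    show "primitive_rows (length es) n (\<lambda>i j. V' $$ (i,j))"
    proof (rule right_inverse_primitive)
      fix i i' assume i: "i < length es" "i' < length es"
      then have im: "i < n" "i' < n" using len by auto
      have "(\<Sum>j<n. V' $$ (i,j) * V $$ (j,i')) = (V' * V) $$ (i,i')"
        unfolding index_mult_mat_sum[OF V'(1) V(1) im] by simp
      then show "(\<Sum>j<n. V' $$ (i,j) * V $$ (j,i')) = of_bool (i = i')" using im by (auto simp: V'(3))
    qed
  qed
qed

text \<open>A right inverse \<open>Y\<close> of \<open>B\<close> gives
  \<open>A = L * (R * Y)\<close>, so the independent columns of \<open>A\<close> pass through width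
  \<open>q\<close>. Applied to values at a point, this transfers full rank from one polynomial
  factorization to another.\<close>

lemma rank_factorization_compare:
  fixes L R A B :: "nat \<Rightarrow> nat \<Rightarrow> complex"
  assumes eq: "\<And>j k. j < m \<Longrightarrow> k < n \<Longrightarrow> (\<Sum>i<q. L j i * R i k) = (\<Sum>i<p. A j i * B i k)"
    and A: "\<And>c i. (\<forall>j<m. (\<Sum>i<p. c i * A j i) = 0) \<Longrightarrow> i < p \<Longrightarrow> c i = 0"
    and B: "\<And>c i. (\<forall>k<n. (\<Sum>i<p. c i * B i k) = 0) \<Longrightarrow> i < p \<Longrightarrow> c i = 0"
  shows "p \<le> q" and "q \<le> p \<Longrightarrow> (\<forall>j<m. (\<Sum>i<q. c i * L j i) = 0) \<Longrightarrow> i < q \<Longrightarrow> c i = 0"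
proof -
  have "\<exists>Y. \<forall>i\<in>{..<p}. \<forall>i'\<in>{..<p}. (\<Sum>k<n. B i k * Y k i') = of_bool (i = i')"
  proof (rule independent_rows_right_inverse)
    fix c i assume "\<And>k. k \<in> {..<n} \<Longrightarrow> (\<Sum>i<p. c i * B i k) = 0" and "i \<in> {..<p}"
    then show "c i = 0" using B[of c i] by simp
  qed auto
  then obtain Y where Y: "\<And>i i'. i < p \<Longrightarrow> i' < p \<Longrightarrow> (\<Sum>k<n. B i k * Y k i') = of_bool (i = i')" by auto
  define t where "t i' i = (\<Sum>k<n. R i k * Y k i')" for i' i
  have Lt: "(\<Sum>i<q. L j i * t i' i) = A j i'" if "j < m" "i' < p" for j i'
  proof -
    have "(\<Sum>i<q. L j i * t i' i) = (\<Sum>k<n. (\<Sum>i<q. L j i * R i k) * Y k i')"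
      unfolding t_def sum_distrib_left sum_distrib_right by (subst sum.swap) (simp add: mult.assoc)
    also have "\<dots> = (\<Sum>k<n. (\<Sum>i<p. A j i * B i k) * Y k i')" using eq that by (intro sum.cong) auto
    also have "\<dots> = (\<Sum>i<p. A j i * (\<Sum>k<n. B i k * Y k i'))"
      unfolding sum_distrib_left sum_distrib_right by (subst sum.swap) (simp add: mult.assoc)
    also have "\<dots> = (\<Sum>i<p. if i = i' then A j i' else 0)" using Y that by (intro sum.cong) auto
    finally show ?thesis using that by simp
  qed
  \<comment> \<open>A relation among the columns of \<open>R * Y\<close> and a kernel vector
    \<open>c\<close> of \<open>L\<close> becomes, after multiplication by \<open>L\<close>, a
    relation among the columns of \<open>A\<close>.\<close>
  have xz: "x i' = 0"
    if comb: "\<And>i. i < q \<Longrightarrow> (\<Sum>i'<p. x i' * t i' i) + y * c i = 0"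
      and c: "\<forall>j<m. (\<Sum>i<q. c i * L j i) = 0" and i': "i' < p" for x y c i'
  proof (rule A[OF _ i'], intro allI impI)
    fix j assume j: "j < m"
    have "0 = (\<Sum>i<q. L j i * ((\<Sum>i'<p. x i' * t i' i) + y * c i))" using comb by simp
    also have "\<dots> = (\<Sum>i<q. \<Sum>i'<p. x i' * (L j i * t i' i)) + y * (\<Sum>i<q. c i * L j i)"
      by (simp add: distrib_left sum.distrib sum_distrib_left ac_simps)
    also have "(\<Sum>i<q. \<Sum>i'<p. x i' * (L j i * t i' i)) = (\<Sum>i'<p. x i' * (\<Sum>i<q. L j i * t i' i))"
      by (subst sum.swap) (simp add: sum_distrib_left)
    also have "\<dots> = (\<Sum>i'<p. x i' * A j i')" using Lt j by simp
    finally show "(\<Sum>i<p. x i * A j i) = 0" using c j by simp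
  qed
  show "p \<le> q"
  proof (rule ccontr)
    assume "\<not> p \<le> q"
    then obtain x where x: "\<exists>i'\<in>{..<p}. x i' \<noteq> 0" "\<forall>i\<in>{..<q}. (\<Sum>i'<p. x i' * t i' i) = 0"
      using homogeneous_system_nontrivial[of "{..<q}" "{..<p}" t] by auto
    then show False using xz[of x 0 "\<lambda>_. 0"] by auto
  qed
  show "c i = 0" if "q \<le> p" and c: "\<forall>j<m. (\<Sum>i<q. c i * L j i) = 0" and i: "i < q"
  proof (rule ccontr)
    assume ci: "c i \<noteq> 0"
    \<comment> \<open>The \<open>p\<close> columns of \<open>R * Y\<close> together with
      \<open>c\<close> are \<open>Suc p\<close> vectors of length \<open>q \<le> p\<close>, hence
      dependent.\<close>
    define v where "v s = (if s < p then t s else c)" for s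
    obtain x where x: "\<exists>s\<in>{..<Suc p}. x s \<noteq> 0" "\<forall>i\<in>{..<q}. (\<Sum>s<Suc p. x s * v s i) = 0"
      using homogeneous_system_nontrivial[of "{..<q}" "{..<Suc p}" v] \<open>q \<le> p\<close> by auto
    have comb: "(\<Sum>i'<p. x i' * t i' i) + x p * c i = 0" if "i < q" for i
      using x(2) that by (simp add: v_def)
    have x0: "x i' = 0" if "i' < p" for i' by (rule xz[OF comb c that])
    then have "x p * c i = 0" using comb[OF i] by simp
    then have "x p = 0" using ci by simp
    then show False using x(1) x0 by (auto simp: less_Suc_eq)
  qed
qed

text \<open>The predictable degree property of Forney: at the largest value of
  \<open>degree (w i) + dd i\<close> the top terms cannot cancel, because the coefficients at
  \<open>dd\<close> are independent.\<close>

lemma predictable_degree: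
  assumes min: "minimal_rows r n dd R" and deg: "\<And>t. t < n \<Longrightarrow> degree (\<Sum>i<r. w i * R i t) \<le> d"
    and i: "i < r" and wi: "w i \<noteq> 0"
  shows "degree (w i) + dd i \<le> d"
proof -
  define S where "S = {i. i < r \<and> w i \<noteq> 0}"
  define M where "M = Max ((\<lambda>i. degree (w i) + dd i) ` S)"
  have S: "finite S" "S \<noteq> {}" using i wi by (auto simp: S_def)
  have le: "degree (w i) + dd i \<le> M" if "i \<in> S" for i
    unfolding M_def using that S by (intro Max_ge) auto
  have "M \<in> (\<lambda>i. degree (w i) + dd i) ` S" unfolding M_def using S by (intro Max_in) auto
  then obtain i0 where i0: "i0 \<in> S" "M = degree (w i0) + dd i0" by blast
  have "M \<le> d"
  proof (rule ccontr)
    assume Md: "\<not> M \<le> d"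
    define c where "c i = (if w i = 0 then 0 else coeff (w i) (M - dd i))" for i
    have degR: "degree (R i t) \<le> dd i" if "i < r" "t < n" for i t
      using min that unfolding minimal_rows_def by blast
    have "(\<Sum>i<r. c i * coeff (R i t) (dd i)) = 0" if t: "t < n" for t
    proof -
      have "coeff (w i * R i t) M = c i * coeff (R i t) (dd i)" if "i < r" for i
      proof (cases "w i = 0")
        case False
        then have "degree (w i) + dd i \<le> M" using le that by (simp add: S_def)
        then have "degree (w i) \<le> M - dd i" "M = (M - dd i) + dd i" by auto
        then show ?thesis using coeff_mult_at_bounds[OF _ degR[OF that t], of "w i" "M - dd i"] False
          by (simp add: c_def)
      qed (simp add: c_def)
      then have "(\<Sum>i<r. c i * coeff (R i t) (dd i)) = coeff (\<Sum>i<r. w i * R i t) M"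
        by (simp add: coeff_sum)
      also have "\<dots> = 0" using deg[OF t] Md by (intro coeff_eq_0) simp
      finally show ?thesis .
    qed
    then have "c i0 = 0" using min i0(1) unfolding minimal_rows_def leading_independent_def S_def by blast
    then show False using i0 by (simp add: c_def S_def)
  qed
  then show ?thesis using le i wi by (auto simp: S_def intro: order.trans)
qed

section \<open>Reversal and the behaviour at infinity\<close>

lemma coeff_rev_poly: "coeff (rev_poly d p) k = (if k \<le> d then coeff p (d - k) else 0)"
proof -
  have "coeff (rev_poly d p) k = (\<Sum>i\<le>d. if d - i = k then coeff p i else 0)"
    by (simp add: rev_poly_def coeff_sum)
  also have "\<dots> = (\<Sum>i\<le>d. if i = d - k then (if k \<le> d then coeff p (d - k) else 0) else 0)"
    by (intro sum.cong) auto
  finally show ?thesis by simp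
qed

lemma rev_poly_sum: "rev_poly d (\<Sum>i\<in>I. f i) = (\<Sum>i\<in>I. rev_poly d (f i))"
  by (rule poly_eqI) (simp add: coeff_rev_poly coeff_sum)

lemma poly_rev_poly:
  assumes "degree p \<le> d" and "x \<noteq> 0"
  shows "poly (rev_poly d p) x = x ^ d * poly p (1 / x)"
proof -
  have "poly p (1 / x) = (\<Sum>i\<le>d. coeff p i * (1 / x) ^ i)"
    unfolding poly_altdef using assms(1) by (intro sum.mono_neutral_left) (auto simp: coeff_eq_0)
  then have "x ^ d * poly p (1 / x) = (\<Sum>i\<le>d. coeff p i * (x ^ d * (1 / x) ^ i))"
    by (simp add: sum_distrib_left ac_simps)
  also have "\<dots> = (\<Sum>i\<le>d. coeff p i * x ^ (d - i))"
    using assms(2) by (intro sum.cong) (auto simp: power_diff power_one_over divide_simps)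
  finally show ?thesis by (simp add: rev_poly_def poly_sum poly_monom)
qed

lemma poly_rev_poly_0: "poly (rev_poly d p) 0 = coeff p d"
  by (simp add: poly_0_coeff_0 coeff_rev_poly)

lemma poly_eqI_nonzero:
  fixes p q :: "complex poly"
  assumes "\<And>x. x \<noteq> 0 \<Longrightarrow> poly p x = poly q x"
  shows "p = q"
proof -
  have "\<forall>x. poly ([:0, 1:] * (p - q)) x = 0" using assms by auto
  then have "[:0, 1:] * (p - q) = 0" using poly_all_0_iff_0 by blast
  then show ?thesis by simp
qed

lemma rev_poly_mult:
  fixes f g :: "complex poly"
  assumes "degree f \<le> a" and "degree g \<le> b"
  shows "rev_poly (a + b) (f * g) = rev_poly a f * rev_poly b g"
proof (rule poly_eqI_nonzero)
  fix x :: complex assume "x \<noteq> 0"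
  then show "poly (rev_poly (a + b) (f * g)) x = poly (rev_poly a f * rev_poly b g) x"
    using degree_mult_le_bounds[OF assms] assms by (simp add: poly_rev_poly power_add)
qed

text \<open>At 0 the reversed rows are the coefficients at \<open>dd\<close>; at
  \<open>z \<noteq> 0\<close> they are the rows at \<open>1 / z\<close> scaled by powers of
  \<open>z\<close>. Each part of \<open>minimal_rows\<close> settles one case.\<close>

lemma minimal_rows_rev_primitive:
  assumes min: "minimal_rows r n dd R"
  shows "primitive_rows r n (\<lambda>i j. rev_poly (dd i) (R i j))"
  unfolding primitive_rows_def
proof (intro allI impI)
  fix z and c :: "nat \<Rightarrow> complex" and i
  assume c: "\<forall>j<n. (\<Sum>i<r. c i * poly (rev_poly (dd i) (R i j)) z) = 0" and i: "i < r"
  have deg: "degree (R i j) \<le> dd i" if "i < r" "j < n" for i j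
    using min that unfolding minimal_rows_def by blast
  show "c i = 0"
  proof (cases "z = 0")
    case True
    then have "\<forall>j<n. (\<Sum>i<r. c i * coeff (R i j) (dd i)) = 0" using c by (simp add: poly_rev_poly_0)
    then show ?thesis using min i unfolding minimal_rows_def leading_independent_def by blast
  next
    case False
    define c' where "c' i = c i * z ^ dd i" for i
    have "(\<Sum>i<r. c' i * poly (R i j) (1 / z)) = 0" if "j < n" for j
    proof -
      have "(\<Sum>i<r. c' i * poly (R i j) (1 / z)) = (\<Sum>i<r. c i * poly (rev_poly (dd i) (R i j)) z)"
        using deg that False by (intro sum.cong) (auto simp: poly_rev_poly c'_def)
      then show ?thesis using c that by simp
    qed
    then have "c' i = 0" using min i unfolding minimal_rows_def primitive_rows_def by blast
    then show ?thesis using False by (simp add: c'_def)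
  qed
qed

text \<open>Column \<open>i\<close> of \<open>L\<close> and row \<open>i\<close> of \<open>R\<close>
  have complementary degree bounds, so reversing the product reverses each factor with respect to
  its own bound.\<close>

lemma pm_rev_mult:
  assumes L: "L \<in> carrier_mat m r" and R: "R \<in> carrier_mat r n" and dd: "\<And>i. i < r \<Longrightarrow> dd i \<le> d"
    and dR: "\<And>i j. i < r \<Longrightarrow> j < n \<Longrightarrow> degree (R $$ (i,j)) \<le> dd i"
    and dL: "\<And>i j. i < r \<Longrightarrow> j < m \<Longrightarrow> degree (L $$ (j,i)) \<le> d - dd i"
    and jk: "j < m" "k < n"
  shows "pm_rev d (L * R) $$ (j,k)
    = (\<Sum>i<r. rev_poly (d - dd i) (L $$ (j,i)) * rev_poly (dd i) (R $$ (i,k)))"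
proof -
  have "pm_rev d (L * R) $$ (j,k) = (\<Sum>i<r. rev_poly d (L $$ (j,i) * R $$ (i,k)))"
    using L R jk index_mult_mat_sum[OF L R jk] by (simp add: pm_rev_def rev_poly_sum)
  also have "\<dots> = (\<Sum>i<r. rev_poly (d - dd i) (L $$ (j,i)) * rev_poly (dd i) (R $$ (i,k)))"
  proof (rule sum.cong[OF refl])
    fix i assume "i \<in> {..<r}"
    then have i: "i < r" by simp
    show "rev_poly d (L $$ (j,i) * R $$ (i,k)) = rev_poly (d - dd i) (L $$ (j,i)) * rev_poly (dd i) (R $$ (i,k))"
      using rev_poly_mult[OF dL[OF i jk(1)] dR[OF i jk(2)]] dd[OF i] by simp
  qed
  finally show ?thesis .
qed

section \<open>The inclusions\<close>

lemma primitive_rowsD: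
  assumes "primitive_rows r n R" and "\<And>j. j < n \<Longrightarrow> (\<Sum>i<r. c i * poly (R i j) z) = 0" and "i < r"
  shows "c i = 0"
  using assms unfolding primitive_rows_def by blast

lemma minimal_rows_cong:
  assumes "\<And>i j. i < r \<Longrightarrow> j < n \<Longrightarrow> R i j = R' i j" and "\<And>i. i < r \<Longrightarrow> dd i = dd' i"
  shows "minimal_rows r n dd R \<longleftrightarrow> minimal_rows r n dd' R'"
  unfolding minimal_rows_def primitive_rows_def leading_independent_def using assms
  by (simp cong: conj_cong)

lemma minimal_basis_rows_minimal_rows:
  assumes R: "R \<in> carrier_mat r n" and min: "is_minimal_basis_list n (rows R)"
    and deg: "\<And>i. i < r \<Longrightarrow> vdeg (row R i) = ereal (real (dd i))"
  shows "minimal_rows r n dd (\<lambda>i j. R $$ (i,j))"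
proof -
  have len: "length (rows R) = r" using R by simp
  have "minimal_rows r n (\<lambda>i. ndeg (rows R ! i)) (\<lambda>i t. rows R ! i $ t)"
    using minimal_basis_minimal_rows[OF min[unfolded is_minimal_basis_list_def]] unfolding len .
  then show ?thesis
    using R vdeg_eq_imp_ndeg[OF deg] by (subst minimal_rows_cong[of r n]) auto
qed

theorem setMH_subset_setO:
  assumes r: "0 < r" and a: "a \<le> r * d"
  shows "setMH m n r d a \<subseteq> setO m n r d a"
proof
  fix P assume "P \<in> setMH m n r d a"
  then obtain L R where P: "P = L * R" and MH: "conds_MH m n r d a L R" unfolding setMH_def by blast
  then have M: "conds_M m n r d a L R"
    and iL: "has_minimal_indices m (left_nullspace L)
        (mi_spec (m - r) ((r * d - a) div (m - r)) ((r * d - a) mod (m - r)))"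
    and iR: "has_minimal_indices n (right_nullspace R) (mi_spec (n - r) (a div (n - r)) (a mod (n - r)))"
    unfolding conds_MH_def by blast+
  have B: "conds_B m n r d a L R" and bL: "is_minimal_basis_list m (cols L)" and bR: "is_minimal_basis_list n (rows R)"
    using M unfolding conds_M_def by blast+
  have L: "L \<in> carrier_mat m r" and R: "R \<in> carrier_mat r n" using B unfolding conds_B_def by blast+
  define dd where "dd = balanced r a"
  have dd: "dd i \<le> d" for i unfolding dd_def by (rule balanced_le[OF r a])
  have vR: "vdeg (row R i) = ereal (real (dd i))" if "i < r" for i
    using B that unfolding conds_B_def dd_def balanced_def by blast
  have vL: "vdeg (col L i) = ereal (real (d - dd i))" if "i < r" for i
  proof -
    have "vdeg (col L i) = ereal (real d) - vdeg (row R i)" using B that unfolding conds_B_def by blast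
    then show ?thesis using vR[OF that] dd[of i] by (simp add: of_nat_diff)
  qed
  have Lt: "transpose_mat L \<in> carrier_mat r m" using L by simp
  have mR: "minimal_rows r n dd (\<lambda>i j. R $$ (i,j))" by (rule minimal_basis_rows_minimal_rows[OF R bR vR])
  have "minimal_rows r m (\<lambda>i. d - dd i) (\<lambda>i j. transpose_mat L $$ (i,j))"
    using bL vL L by (intro minimal_basis_rows_minimal_rows[OF Lt]) auto
  then have mL: "minimal_rows r m (\<lambda>i. d - dd i) (\<lambda>i j. L $$ (j,i))"
    using L by (subst minimal_rows_cong[of r m _ "\<lambda>i j. transpose_mat L $$ (i,j)"]) auto
  have primR: "primitive_rows r n (\<lambda>i j. R $$ (i,j))" and primL: "primitive_rows r m (\<lambda>i j. L $$ (j,i))"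
    and dR: "\<And>i j. i < r \<Longrightarrow> j < n \<Longrightarrow> degree (R $$ (i,j)) \<le> dd i"
    and dL: "\<And>i j. i < r \<Longrightarrow> j < m \<Longrightarrow> degree (L $$ (j,i)) \<le> d - dd i"
    using mR mL unfolding minimal_rows_def by blast+
  have "P \<in> pmats m n d" unfolding P by (rule product_in_pmats[OF L R dd dR dL])
  moreover have "normal_rank P = r" unfolding P by (rule normal_rank_mult[OF L R primL primR])
  moreover have "invariant_polys P (replicate r 1)" unfolding P by (rule invariant_polys_mult[OF L R primL primR])
  \<comment> \<open>The reversal is again a product of primitive factors, so its invariant
    polynomials can be taken to be 1, of order 0 at 0.\<close>
  moreover have "partial_mults_infty d P (map (order 0) (replicate r (1 :: complex poly)))"
  proof -
    define L' where "L' = mat m r (\<lambda>(j,i). rev_poly (d - dd i) (L $$ (j,i)))"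
    define R' where "R' = mat r n (\<lambda>(i,k). rev_poly (dd i) (R $$ (i,k)))"
    have L': "L' \<in> carrier_mat m r" and R': "R' \<in> carrier_mat r n" by (simp_all add: L'_def R'_def)
    have "pm_rev d P = L' * R'"
    proof (rule eq_matI)
      fix j k assume "j < dim_row (L' * R')" "k < dim_col (L' * R')"
      then have jk: "j < m" "k < n" using L' R' by auto
      have "pm_rev d P $$ (j,k) = (\<Sum>i<r. rev_poly (d - dd i) (L $$ (j,i)) * rev_poly (dd i) (R $$ (i,k)))"
        unfolding P by (rule pm_rev_mult[OF L R _ _ _ jk]) (use dd dR dL in auto)
      then show "pm_rev d P $$ (j,k) = (L' * R') $$ (j,k)"
        unfolding index_mult_mat_sum[OF L' R' jk] using jk by (simp add: L'_def R'_def)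
    qed (use L R L' R' in \<open>auto simp: pm_rev_def P\<close>)
    moreover have "primitive_rows r m (\<lambda>i j. L' $$ (j,i))"
      using minimal_rows_rev_primitive[OF mL] by (simp add: primitive_rows_def L'_def)
    moreover have "primitive_rows r n (\<lambda>i j. R' $$ (i,j))"
      using minimal_rows_rev_primitive[OF mR] by (simp add: primitive_rows_def R'_def)
    ultimately have "invariant_polys (pm_rev d P) (replicate r 1)"
      using invariant_polys_mult[OF L' R'] by simp
    then show ?thesis unfolding partial_mults_infty_def partial_mults_def
      by (intro exI[of _ "replicate r 1"] conjI refl)
  qed
  moreover have "\<forall>x\<in>set (map (order 0) (replicate r (1 :: complex poly))). x = 0"
    by (auto simp: order_0I)
  moreover have "left_nullspace P = left_nullspace L" unfolding P by (rule left_nullspace_mult[OF L R primR])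
  moreover have "right_nullspace P = right_nullspace R" unfolding P by (rule right_nullspace_mult[OF L R primL])
  ultimately show "P \<in> setO m n r d a" unfolding setO_def using iL iR by auto
qed

text \<open>The prescribed indices sum to \<open>a\<close>, and the degree sum of \<open>M\<close>
  is at most that of the null space basis. An inequality is enough: applied to both factors of a
  matrix in \<open>setO\<close>, whose degrees are complementary, it becomes an equality.\<close>

lemma nullspace_index_sum:
  assumes M: "M \<in> carrier_mat r n" and min: "minimal_rows r n dd (\<lambda>i j. M $$ (i,j))" and rn: "r < n"
    and idx: "has_minimal_indices n (right_nullspace M) (mi_spec (n - r) (a div (n - r)) (a mod (n - r)))"
  shows "(\<Sum>i<r. dd i) \<le> a"
proof -
  define l where "l = n - r"
  define q where "q = a div l"
  define s where "s = a mod l"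
  have l: "0 < l" "n = l + r" using rn by (auto simp: l_def)
  have s: "s < l" "a = l * q + s" using l by (auto simp: s_def q_def)
  obtain N where N: "is_minimal_basis n (right_nullspace M) N" and "mset (map vdeg N) = mi_spec l q s"
    using idx unfolding has_minimal_indices_def l_def q_def s_def by blast
  \<comment> \<open>This undoes the embedding of natural numbers into \<open>ereal\<close>, so that
    degrees can be read off the multiset.\<close>
  define h where "h x = nat \<lfloor>real_of_ereal x\<rfloor>" for x
  have h: "h (ereal (real k)) = k" for k by (simp add: h_def)
  have basis: "is_poly_basis n (right_nullspace M) N" using N unfolding is_minimal_basis_def by blast
  have "mset (map ndeg N) = image_mset h (mset (map vdeg N))"
  proof -
    have "map ndeg N = map h (map vdeg N)"
      using poly_basis_vdeg[OF basis] by (intro nth_equalityI) (auto simp: h)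
    then show ?thesis by (metis mset_map)
  qed
  also have "\<dots> = replicate_mset s (q + 1) + replicate_mset (l - s) q"
    unfolding \<open>mset (map vdeg N) = mi_spec l q s\<close> mi_spec_def
    by (simp only: image_mset_union image_replicate_mset h)
  finally have ms: "mset (map ndeg N) = replicate_mset s (q + 1) + replicate_mset (l - s) q" .
  have len: "length N = l" using arg_cong[OF ms, of size] s by simp
  have "(\<Sum>j<l. ndeg (N ! j)) = sum_list (map ndeg N)"
    by (simp add: sum_list_sum_nth len atLeast0LessThan)
  also have "\<dots> = s * (q + 1) + (l - s) * q"
    using arg_cong[OF ms, of sum_mset] by (simp only: sum_mset_sum_list sum_mset.union sum_mset_replicate_mset of_nat_id)
  also have "\<dots> = a" using s by (simp add: algebra_simps diff_mult_distrib)
  finally have sum: "(\<Sum>j<l. ndeg (N ! j)) = a" .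
  have "(\<Sum>i<r. dd i) \<le> (\<Sum>j<l. ndeg (N ! j))"
  proof (rule kernel_degree_sum_ge[OF min])
    fix j i assume "j < l" "i < r"
    then show "(\<Sum>t<n. M $$ (i,t) * N ! j $ t) = 0"
      using poly_basis_nth_in[OF basis, of j] len by (intro right_nullspace_fvec[OF M]) auto
  next
    fix j t assume "j < l" "t < n"
    then show "degree (N ! j $ t) \<le> ndeg (N ! j)"
      using carrier_vecD[OF poly_basis_nth_in(2)[OF basis, of j]] len by (intro degree_le_ndeg) auto
  next
    show "poly_independent l n (\<lambda>j t. N ! j $ t)"
      using lin_indep_fvec_poly_independent[of n N] basis len unfolding is_poly_basis_def by auto
  qed (use l in auto)
  then show ?thesis using sum by simp
qed

text \<open>The coordinates in the minimal basis are only known to be rational functions here; a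
  polynomial right inverse of that basis later shows that they are polynomials.\<close>

lemma primitive_rows_minimal_span:
  assumes "primitive_rows r n B"
  obtains bs where "length bs = r" and "minimal_rows r n (\<lambda>i. ndeg (bs ! i)) (\<lambda>i t. bs ! i $ t)"
    and "\<And>i. i < r \<Longrightarrow> \<exists>c. \<forall>t<n. to_fract (B i t) = (\<Sum>k<r. c k * to_fract (bs ! k $ t))"
proof -
  define R where "R = mat r n (\<lambda>(i,j). B i j)"
  have R: "R \<in> carrier_mat r n" by (simp add: R_def)
  define V where "V = span_list n (map fvec (rows R))"
  have "primitive_rows r n (\<lambda>i j. R $$ (i,j))" using assms by (simp add: primitive_rows_def R_def)
  then have basis0: "is_poly_basis n V (rows R)" unfolding V_def by (rule primitive_rows_poly_basis[OF R])
  have len0: "length (rows R) = r" using R by simp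
  obtain bs where bs: "is_minimal_basis n V bs" by (rule minimal_basis_exists[OF basis0])
  then have basis: "is_poly_basis n V bs" unfolding is_minimal_basis_def by blast
  have len: "length bs = r" using poly_basis_length_eq[OF basis basis0] len0 by simp
  have carr: "set bs \<subseteq> carrier_vec n" and span: "span_list n (map fvec bs) = V"
    using basis unfolding is_poly_basis_def by blast+
  show thesis
  proof (rule that[OF len])
    show "minimal_rows r n (\<lambda>i. ndeg (bs ! i)) (\<lambda>i t. bs ! i $ t)"
      using minimal_basis_minimal_rows[OF bs] len by simp
  next
    fix i assume i: "i < r"
    have "fvec (rows R ! i) \<in> span_list n (map fvec bs)"
      unfolding span using poly_basis_nth_in(1)[OF basis0] i len0 by simp
    then obtain c where c: "\<And>t. t < n \<Longrightarrow> fvec (rows R ! i) $ t = (\<Sum>k<length bs. c k * to_fract (bs ! k $ t))"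
      by (rule span_fvec_coordinates[OF carr]) blast
    have "to_fract (B i t) = (\<Sum>k<r. c k * to_fract (bs ! k $ t))" if t: "t < n" for t
      using c[OF t] t i len by (simp add: fvec_def R_def)
    then show "\<exists>c. \<forall>t<n. to_fract (B i t) = (\<Sum>k<r. c k * to_fract (bs ! k $ t))" by blast
  qed
qed

text \<open>The Smith form gives a product \<open>A * B\<close> of primitive factors. The rows of
  \<open>B\<close> are replaced by a minimal basis of their span, and comparing the two
  factorizations at each point shows that the new left factor is still primitive.\<close>

lemma primitive_factor_through_minimal:
  assumes P: "P \<in> carrier_mat m n" and inv: "invariant_polys P (replicate r 1)"
  obtains L R dd where "L \<in> carrier_mat m r" and "R \<in> carrier_mat r n" and "P = L * R"
    and "minimal_rows r n dd (\<lambda>i j. R $$ (i,j))" and "primitive_rows r m (\<lambda>i j. L $$ (j,i))"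
proof -
  obtain A B where PAB: "\<forall>j<m. \<forall>k<n. P $$ (j,k) = (\<Sum>i<length (replicate r (1::complex poly)). A j i * replicate r 1 ! i * B i k)"
    and "primitive_rows (length (replicate r (1::complex poly))) m (\<lambda>i j. A j i)"
    and "primitive_rows (length (replicate r (1::complex poly))) n B"
    by (rule invariant_polys_factor[OF P inv])
  then have A: "primitive_rows r m (\<lambda>i j. A j i)" and B: "primitive_rows r n B" by simp_all
  have PAB: "P $$ (j,k) = (\<Sum>i<r. A j i * B i k)" if "j < m" "k < n" for j k
    using PAB that by simp
  obtain bs where len: "length bs = r" and min: "minimal_rows r n (\<lambda>i. ndeg (bs ! i)) (\<lambda>i t. bs ! i $ t)"
    and Bspan: "\<And>i. i < r \<Longrightarrow> \<exists>c. \<forall>t<n. to_fract (B i t) = (\<Sum>k<r. c k * to_fract (bs ! k $ t))"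
    by (rule primitive_rows_minimal_span[OF B]) blast
  have prim: "primitive_rows r n (\<lambda>i t. bs ! i $ t)" using min unfolding minimal_rows_def by blast
  obtain X where X: "\<And>i i'. i < r \<Longrightarrow> i' < r \<Longrightarrow> (\<Sum>j<n. bs ! i $ j * X j i') = of_bool (i = i')"
    by (rule primitive_rows_right_inverse[OF prim]) blast
  define R where "R = mat r n (\<lambda>(i,t). bs ! i $ t)"
  \<comment> \<open>As \<open>X\<close> is a right inverse of \<open>R\<close>, the equation
    \<open>P = L * R\<close> forces \<open>L = P * X\<close>.\<close>
  define L where "L = mat m r (\<lambda>(j,i). \<Sum>t<n. P $$ (j,t) * X t i)"
  have R: "R \<in> carrier_mat r n" and L: "L \<in> carrier_mat m r" by (simp_all add: R_def L_def)
  have minR: "minimal_rows r n (\<lambda>i. ndeg (bs ! i)) (\<lambda>i j. R $$ (i,j))"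
    using min by (subst minimal_rows_cong[of r n _ "\<lambda>i t. bs ! i $ t"]) (auto simp: R_def)
  have B': "B i t = (\<Sum>k<r. (\<Sum>t'<n. B i t' * X t' k) * bs ! k $ t)" if i: "i < r" and t: "t < n" for i t
  proof -
    obtain c where c: "\<forall>t<n. to_fract (B i t) = (\<Sum>k<r. c k * to_fract (bs ! k $ t))" using Bspan[OF i] by blast
    \<comment> \<open>Multiplication by the right inverse \<open>X\<close> identifies the rational
      coordinates with polynomials.\<close>
    have ck: "to_fract (\<Sum>t'<n. B i t' * X t' k) = c k" if k: "k < r" for k
    proof -
      have "to_fract (\<Sum>t'<n. B i t' * X t' k) = (\<Sum>t'<n. (\<Sum>k'<r. c k' * to_fract (bs ! k' $ t')) * to_fract (X t' k))"
        unfolding to_fract_sum to_fract_mult using c by (intro sum.cong) auto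
      also have "\<dots> = (\<Sum>k'<r. c k' * to_fract (\<Sum>t'<n. bs ! k' $ t' * X t' k))"
        unfolding sum_distrib_right to_fract_sum to_fract_mult sum_distrib_left
        by (subst sum.swap) (simp add: mult.assoc)
      also have "\<dots> = (\<Sum>k'<r. if k' = k then c k else 0)" using X k by (intro sum.cong) auto
      finally show ?thesis using k by simp
    qed
    have "to_fract (B i t) = to_fract (\<Sum>k<r. (\<Sum>t'<n. B i t' * X t' k) * bs ! k $ t)"
      using c t ck by (simp only: to_fract_sum[of _ "{..<r}"] to_fract_mult) simp
    then show ?thesis by (simp only: to_fract_eq_iff)
  qed
  have "P = L * R"
  proof (rule eq_matI)
    fix j t assume "j < dim_row (L * R)" "t < dim_col (L * R)"
    then have jt: "j < m" "t < n" using L R by auto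
    have "(L * R) $$ (j,t) = (\<Sum>k<r. (\<Sum>t'<n. (\<Sum>i<r. A j i * B i t') * X t' k) * bs ! k $ t)"
      unfolding index_mult_mat_sum[OF L R jt] using jt PAB by (intro sum.cong) (auto simp: L_def R_def)
    also have "\<dots> = (\<Sum>k<r. \<Sum>i<r. A j i * ((\<Sum>t'<n. B i t' * X t' k) * bs ! k $ t))"
    proof (rule sum.cong[OF refl])
      fix k assume "k \<in> {..<r}"
      have "(\<Sum>t'<n. (\<Sum>i<r. A j i * B i t') * X t' k) = (\<Sum>i<r. A j i * (\<Sum>t'<n. B i t' * X t' k))"
        unfolding sum_distrib_right sum_distrib_left by (subst sum.swap) (simp add: mult.assoc)
      then show "(\<Sum>t'<n. (\<Sum>i<r. A j i * B i t') * X t' k) * bs ! k $ t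
          = (\<Sum>i<r. A j i * ((\<Sum>t'<n. B i t' * X t' k) * bs ! k $ t))"
        by (simp add: sum_distrib_right mult.assoc)
    qed
    also have "\<dots> = (\<Sum>i<r. A j i * (\<Sum>k<r. (\<Sum>t'<n. B i t' * X t' k) * bs ! k $ t))"
      by (subst sum.swap) (simp add: sum_distrib_left)
    also have "\<dots> = (\<Sum>i<r. A j i * B i t)"
    proof (rule sum.cong[OF refl])
      fix i assume "i \<in> {..<r}"
      then have "i < r" by simp
      show "A j i * (\<Sum>k<r. (\<Sum>t'<n. B i t' * X t' k) * bs ! k $ t) = A j i * B i t"
        unfolding B'[OF \<open>i < r\<close> jt(2), symmetric] ..
    qed
    finally show "P $$ (j,t) = (L * R) $$ (j,t)" using PAB jt by simp
  qed (use P L R in auto)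
  moreover have "primitive_rows r m (\<lambda>i j. L $$ (j,i))" unfolding primitive_rows_def
  proof (intro allI impI)
    fix z and c :: "nat \<Rightarrow> complex" and i
    assume c: "\<forall>j<m. (\<Sum>i<r. c i * poly (L $$ (j,i)) z) = 0" and i: "i < r"
    have eq: "(\<Sum>i<r. poly (L $$ (j,i)) z * poly (R $$ (i,k)) z) = (\<Sum>i<r. poly (A j i) z * poly (B i k) z)"
      if "j < m" "k < n" for j k
    proof -
      have "poly ((L * R) $$ (j,k)) z = poly (\<Sum>i<r. A j i * B i k) z" using \<open>P = L * R\<close> PAB[OF that] by simp
      then show ?thesis unfolding index_mult_mat_sum[OF L R that] by (simp add: poly_sum)
    qed
    show "c i = 0"
    proof (rule rank_factorization_compare(2)[where q = r and p = r and L = "\<lambda>j i. poly (L $$ (j,i)) z"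
          and A = "\<lambda>j i. poly (A j i) z", OF eq])
      fix c i assume "\<forall>j<m. (\<Sum>i<r. c i * poly (A j i) z) = 0" "i < r"
      then show "c i = 0" using A unfolding primitive_rows_def by blast
    next
      fix c i assume "\<forall>k<n. (\<Sum>i<r. c i * poly (B i k) z) = 0" "i < r"
      then show "c i = 0" using B unfolding primitive_rows_def by blast
    qed (use c i in auto)
  qed
  ultimately show thesis using that[OF L R _ minR] by blast
qed

text \<open>At 0 the reversal of \<open>L * R\<close> is the product of the coefficient matrices of
  \<open>L\<close> and \<open>R\<close> at their degree bounds. Its invariant polynomials do not
  vanish at 0, so this product has rank \<open>p \<ge> r\<close>, which forces the coefficient
  matrix of \<open>L\<close> to have independent columns.\<close>

lemma no_infinite_multiplicity_leading_independent:
  assumes L: "L \<in> carrier_mat m r" and R: "R \<in> carrier_mat r n" and dd: "\<And>i. i < r \<Longrightarrow> dd i \<le> d"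
    and minR: "minimal_rows r n dd (\<lambda>i j. R $$ (i,j))" and primL: "primitive_rows r m (\<lambda>i j. L $$ (j,i))"
    and dL: "\<And>i j. i < r \<Longrightarrow> j < m \<Longrightarrow> degree (L $$ (j,i)) \<le> d - dd i"
    and inf: "partial_mults_infty d (L * R) ms" "\<forall>x\<in>set ms. x = 0"
  shows "leading_independent r m (\<lambda>i. d - dd i) (\<lambda>i j. L $$ (j,i))"
proof -
  have primR: "primitive_rows r n (\<lambda>i j. R $$ (i,j))" and dR: "\<And>i j. i < r \<Longrightarrow> j < n \<Longrightarrow> degree (R $$ (i,j)) \<le> dd i"
    using minR unfolding minimal_rows_def by blast+
  obtain es where es: "invariant_polys (pm_rev d (L * R)) es" "ms = map (order 0) es"
    using inf(1) unfolding partial_mults_infty_def partial_mults_def by blast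
  define p where "p = length es"
  have Q: "pm_rev d (L * R) \<in> carrier_mat m n" using L R by (simp add: pm_rev_def)
  obtain A B where QAB: "\<forall>j<m. \<forall>k<n. pm_rev d (L * R) $$ (j,k) = (\<Sum>i<p. A j i * es ! i * B i k)"
    and A: "primitive_rows p m (\<lambda>i j. A j i)" and B: "primitive_rows p n B"
    unfolding p_def by (rule invariant_polys_factor[OF Q es(1)])
  have es0: "poly (es ! i) 0 \<noteq> 0" if "i < p" for i
  proof -
    have "es ! i \<in> set es" using that by (simp add: p_def)
    then have "es ! i \<noteq> 0" "order 0 (es ! i) = 0" using es inf(2) unfolding invariant_polys_def by auto
    then show ?thesis by (simp add: order_root)
  qed
  have ev: "(\<Sum>i<r. poly (rev_poly (d - dd i) (L $$ (j,i))) z * poly (rev_poly (dd i) (R $$ (i,k))) z)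
      = (\<Sum>i<p. poly (A j i) z * poly (es ! i) z * poly (B i k) z)" if jk: "j < m" "k < n" for j k z
  proof -
    have "(\<Sum>i<r. rev_poly (d - dd i) (L $$ (j,i)) * rev_poly (dd i) (R $$ (i,k))) = (\<Sum>i<p. A j i * es ! i * B i k)"
      using pm_rev_mult[where dd = dd, OF L R dd dR dL jk] QAB jk by simp
    from arg_cong[OF this, of "\<lambda>f. poly f z"] show ?thesis by (simp add: poly_sum)
  qed
  \<comment> \<open>The reversal does not change values at 1, which gives \<open>r \<le> p\<close>; at 0 it gives the leading coefficients.\<close>
  have "r \<le> p"
  proof (rule rank_factorization_compare(1)[where m = m and n = n
        and L = "\<lambda>j i. poly (A j i) 1 * poly (es ! i) 1" and R = "\<lambda>i k. poly (B i k) 1"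
        and A = "\<lambda>j i. poly (L $$ (j,i)) 1" and B = "\<lambda>i k. poly (R $$ (i,k)) 1"])
    fix j k assume jk: "j < m" "k < n"
    have "(\<Sum>i<r. poly (L $$ (j,i)) 1 * poly (R $$ (i,k)) 1)
        = (\<Sum>i<r. poly (rev_poly (d - dd i) (L $$ (j,i))) 1 * poly (rev_poly (dd i) (R $$ (i,k))) 1)"
      using dL dR jk by (intro sum.cong) (auto simp: poly_rev_poly)
    then show "(\<Sum>i<p. poly (A j i) 1 * poly (es ! i) 1 * poly (B i k) 1)
        = (\<Sum>i<r. poly (L $$ (j,i)) 1 * poly (R $$ (i,k)) 1)"
      using ev[OF jk, of 1] by simp
  next
    fix c i assume "\<forall>j<m. (\<Sum>i<r. c i * poly (L $$ (j,i)) 1) = 0" "i < r"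
    then show "c i = 0" using primL unfolding primitive_rows_def by blast
  next
    fix c i assume "\<forall>k<n. (\<Sum>i<r. c i * poly (R $$ (i,k)) 1) = 0" "i < r"
    then show "c i = 0" using primR unfolding primitive_rows_def by blast
  qed
  show ?thesis unfolding leading_independent_def
  proof (intro allI impI)
    fix c :: "nat \<Rightarrow> complex" and i
    assume c: "\<forall>j<m. (\<Sum>i<r. c i * coeff (L $$ (j,i)) (d - dd i)) = 0" and i: "i < r"
    show "c i = 0"
    proof (rule rank_factorization_compare(2)[where q = r and p = p and m = m and n = n
          and L = "\<lambda>j i. poly (rev_poly (d - dd i) (L $$ (j,i))) 0" and R = "\<lambda>i k. poly (rev_poly (dd i) (R $$ (i,k))) 0"
          and A = "\<lambda>j i. poly (A j i) 0 * poly (es ! i) 0" and B = "\<lambda>i k. poly (B i k) 0", OF ev])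
      fix c i assume h: "\<forall>j<m. (\<Sum>i<p. c i * (poly (A j i) 0 * poly (es ! i) 0)) = 0" and i: "i < p"
      have "\<forall>j<m. (\<Sum>i<p. (c i * poly (es ! i) 0) * poly (A j i) 0) = 0"
        using h by (simp add: ac_simps)
      then have "c i * poly (es ! i) 0 = 0"
        using A[unfolded primitive_rows_def, rule_format, of "\<lambda>i. c i * poly (es ! i) 0" 0 i] i by simp
      then show "c i = 0" using es0[OF i] by simp
    next
      fix c i assume "\<forall>k<n. (\<Sum>i<p. c i * poly (B i k) 0) = 0" "i < p"
      then show "c i = 0" using B unfolding primitive_rows_def by blast
    qed (use c i \<open>r \<le> p\<close> in \<open>auto simp: poly_rev_poly_0\<close>)
  qed
qed

theorem setO_subset_setA:
  assumes rm: "r < m" and rn: "r < n" and a: "a \<le> r * d"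
  shows "setO m n r d a \<subseteq> setA m n r d a"
proof
  fix P assume "P \<in> setO m n r d a"
  then have Pd: "P \<in> pmats m n d" and inv: "invariant_polys P (replicate r 1)"
    and iL: "has_minimal_indices m (left_nullspace P)
        (mi_spec (m - r) ((r * d - a) div (m - r)) ((r * d - a) mod (m - r)))"
    and iR: "has_minimal_indices n (right_nullspace P) (mi_spec (n - r) (a div (n - r)) (a mod (n - r)))"
    unfolding setO_def by blast+
  obtain ms where ms: "partial_mults_infty d P ms" "\<forall>x\<in>set ms. x = 0"
    using \<open>P \<in> setO m n r d a\<close> unfolding setO_def by blast
  have P: "P \<in> carrier_mat m n" using Pd by (simp add: pmats_def)
  obtain L R dd where L: "L \<in> carrier_mat m r" and R: "R \<in> carrier_mat r n" and PLR: "P = L * R"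
    and minR: "minimal_rows r n dd (\<lambda>i j. R $$ (i,j))" and primL: "primitive_rows r m (\<lambda>i j. L $$ (j,i))"
    by (rule primitive_factor_through_minimal[OF P inv])
  have primR: "primitive_rows r n (\<lambda>i j. R $$ (i,j))" using minR unfolding minimal_rows_def by blast
  \<comment> \<open>Row \<open>j\<close> of \<open>P\<close> is a combination of the rows of
    \<open>R\<close> without cancellation of degrees, so the bound \<open>d\<close> on
    \<open>P\<close> limits every term.\<close>
  have pd: "degree (L $$ (j,i)) + dd i \<le> d" if "i < r" "j < m" "L $$ (j,i) \<noteq> 0" for i j
  proof (rule predictable_degree[OF minR _ that(1), of "\<lambda>i. L $$ (j,i)"])
    fix t assume t: "t < n"
    have "degree (P $$ (j,t)) \<le> d" using Pd that(2) t by (simp add: pmats_def)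
    then show "degree (\<Sum>i<r. L $$ (j,i) * R $$ (i,t)) \<le> d"
      using index_mult_mat_sum[OF L R that(2) t] PLR by simp
  qed (rule that(3))
  \<comment> \<open>Primitivity provides a nonzero entry in column \<open>i\<close> of
    \<open>L\<close>; this is what keeps \<open>d - dd i\<close> from being truncated.\<close>
  have dd: "dd i \<le> d" if i: "i < r" for i
  proof -
    have "\<exists>j<m. L $$ (j,i) \<noteq> 0"
    proof (rule ccontr)
      assume neg: "\<not> ?thesis"
      have zero: "(\<Sum>i'<r. of_bool (i' = i) * poly (L $$ (j,i')) 0) = 0" if "j < m" for j
        using neg that by (intro sum.neutral) auto
      have "of_bool (i = i) = (0 :: complex)"
        by (rule primitive_rowsD[OF primL _ i, where c = "\<lambda>i'. of_bool (i' = i)" and z = 0]) (rule zero)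
      then show False by simp
    qed
    then show ?thesis using pd[OF i] add_leD2 by blast
  qed
  have dL: "degree (L $$ (j,i)) \<le> d - dd i" if "i < r" "j < m" for i j
    using pd[OF that] by (cases "L $$ (j,i) = 0") auto
  have lead: "leading_independent r m (\<lambda>i. d - dd i) (\<lambda>i j. L $$ (j,i))"
    using no_infinite_multiplicity_leading_independent[OF L R dd minR primL dL] ms unfolding PLR by blast
  have Lt: "transpose_mat L \<in> carrier_mat r m" using L by simp
  have "minimal_rows r m (\<lambda>i. d - dd i) (\<lambda>i j. L $$ (j,i))"
    unfolding minimal_rows_def using dL primL lead by blast
  then have minL: "minimal_rows r m (\<lambda>i. d - dd i) (\<lambda>i j. transpose_mat L $$ (i,j))"
    using L by (subst minimal_rows_cong[of r m _ "\<lambda>i j. L $$ (j,i)"]) auto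
  have nR: "right_nullspace P = right_nullspace R" unfolding PLR by (rule right_nullspace_mult[OF L R primL])
  have nL: "left_nullspace P = right_nullspace (transpose_mat L)"
    unfolding PLR left_nullspace_mult[OF L R primR] by (rule left_nullspace_transpose)
  have le1: "(\<Sum>i<r. dd i) \<le> a" by (rule nullspace_index_sum[OF R minR rn iR[unfolded nR]])
  have le2: "(\<Sum>i<r. d - dd i) \<le> r * d - a" by (rule nullspace_index_sum[OF Lt minL rm iL[unfolded nL]])
  \<comment> \<open>The two degree sums add up to \<open>r * d\<close>, and so do their bounds
    \<open>r * d - a\<close> and \<open>a\<close>; hence both bounds are attained.\<close>
  have "(\<Sum>i<r. d - dd i) + (\<Sum>i<r. dd i) = (\<Sum>i<r. d)"
    unfolding sum.distrib[symmetric] using dd by (intro sum.cong) auto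
  then have sum: "(\<Sum>i<r. dd i) = a" using le1 le2 a by simp
  have vR: "vdeg (row R i) = ereal (real (dd i))" if "i < r" for i
    by (rule minimal_rows_row_degree[OF R minR that])
  have vL: "vdeg (col L i) = ereal (real (d - dd i))" if "i < r" for i
    using minimal_rows_row_degree[OF Lt minL that] that L by simp
  have "vdeg (col L i) + vdeg (row R i) = ereal (real d)" if "i < r" for i
    using vR[OF that] vL[OF that] dd[OF that] by simp
  moreover have "(\<Sum>i<r. vdeg (row R i)) = ereal (real a)"
  proof -
    have "(\<Sum>i<r. vdeg (row R i)) = (\<Sum>i<r. ereal (real (dd i)))" using vR by (intro sum.cong) auto
    then show ?thesis using sum by (simp flip: of_nat_sum)
  qed
  ultimately show "P \<in> setA m n r d a" unfolding setA_def using L R PLR by blast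
qed

section \<open>Approximation of the factored products by \<open>setMH\<close>\<close>

lemma setA_subset_closure:
  assumes rm: "r < m" and rn: "r < n" and r: "0 < r" and a: "a \<le> r * d"
  shows "setA m n r d a \<subseteq> pm_closure m n d (setMH m n r d a)"
proof
  fix P assume "P \<in> setA m n r d a"
  then obtain L R where P: "P = L * R" and L: "L \<in> carrier_mat m r" and R: "R \<in> carrier_mat r n"
    and deg: "\<And>i. i < r \<Longrightarrow> vdeg (col L i) + vdeg (row R i) = ereal (real d)"
    and sum: "(\<Sum>i<r. vdeg (row R i)) = ereal (real a)"
    unfolding setA_def by blast
  have nz: "\<exists>k<dim_vec v. v $ k \<noteq> 0" if "vdeg v \<noteq> - \<infinity>" for v
  proof (rule ccontr)
    assume "\<not> ?thesis"
    then have e: "{i. i < dim_vec v \<and> v $ i \<noteq> 0} = {}" by auto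
    show False using that unfolding vdeg_def e by (simp add: bot_ereal_def)
  qed
  \<comment> \<open>A sum equal to the finite number \<open>d\<close> excludes zero rows and
    columns, so all degrees are natural numbers.\<close>
  have nd: "vdeg (col L i) = ereal (real (ndeg (col L i)))" "vdeg (row R i) = ereal (real (ndeg (row R i)))"
    "ndeg (col L i) + ndeg (row R i) = d" if i: "i < r" for i
  proof -
    have fin: "vdeg (col L i) \<noteq> - \<infinity>" "vdeg (row R i) \<noteq> - \<infinity>" using deg[OF i]
      by (cases "vdeg (col L i)"; cases "vdeg (row R i)"; simp)+
    show 1: "vdeg (col L i) = ereal (real (ndeg (col L i)))" "vdeg (row R i) = ereal (real (ndeg (row R i)))"
      using nz[OF fin(1)] nz[OF fin(2)] vdeg_eq_ndeg by blast+
    then show "ndeg (col L i) + ndeg (row R i) = d" using deg[OF i] by simp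
  qed
  define dd where "dd i = ndeg (row R i)" for i
  have dd: "dd i \<le> d" if "i < r" for i using nd(3)[OF that] by (simp add: dd_def)
  have "(\<Sum>i<r. vdeg (row R i)) = (\<Sum>i<r. ereal (real (dd i)))" using nd(2) by (simp add: dd_def)
  then have "ereal (real (\<Sum>i<r. dd i)) = ereal (real a)" using sum by simp
  then have sumdd: "(\<Sum>i<r. dd i) = (\<Sum>i<r. balanced r a i)"
    unfolding balanced_sum[OF r] ereal.inject of_nat_eq_iff .
  have "degree (R $$ (i,j)) \<le> dd i" if "i < r" "j < n" for i j
    using degree_le_ndeg[of j "row R i"] that R by (simp add: dd_def)
  moreover have "degree (L $$ (j,i)) \<le> d - dd i" if "i < r" "j < m" for i j
  proof -
    have "degree (L $$ (j,i)) \<le> ndeg (col L i)" using degree_le_ndeg[of j "col L i"] that L by simp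
    then show ?thesis using nd(3)[OF that(1)] by (simp add: dd_def)
  qed
  ultimately have "P \<in> factored m n r d dd" unfolding factored_def using P L R by blast
  moreover have "factored m n r d dd \<subseteq> pm_closure m n d (factored m n r d (balanced r a))"
    by (rule factored_balance[OF dd sumdd]) (auto simp: balanced_def)
  moreover have "pm_closure m n d (factored m n r d (balanced r a)) \<subseteq> pm_closure m n d (setMH m n r d a)"
    by (rule pm_closure_trans[OF factored_balanced_subset_closure[OF rm rn r a]])
  ultimately show "P \<in> pm_closure m n d (setMH m n r d a)" by blast
qed

lemma setC_subset_closure:
  assumes rm: "r < m" and rn: "r < n" and r: "0 < r" and a: "a \<le> r * d"
  shows "setC m n r d a \<subseteq> pm_closure m n d (setMH m n r d a)"
proof
  fix P assume "P \<in> setC m n r d a"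
  then obtain L R where P: "P = L * R" and L: "L \<in> carrier_mat m r" and R: "R \<in> carrier_mat r n"
    and C: "\<And>i. i < r \<Longrightarrow> (i < a mod r \<longrightarrow> vdeg (row R i) \<le> ereal (real (a div r + 1)) \<and>
              vdeg (col L i) \<le> ereal (real d - real (a div r) - 1)) \<and>
            (a mod r \<le> i \<longrightarrow> vdeg (row R i) \<le> ereal (real (a div r)) \<and>
              vdeg (col L i) \<le> ereal (real d - real (a div r)))"
    unfolding setC_def by blast
  have bnd: "vdeg (row R i) \<le> ereal (real (balanced r a i))" "vdeg (col L i) \<le> ereal (real (d - balanced r a i))"
    if i: "i < r" for i
  proof -
    show "vdeg (row R i) \<le> ereal (real (balanced r a i))" using C[OF i] by (simp add: balanced_def)
    \<comment> \<open>The bounds of \<open>setC\<close> are differences of reals; they agree with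
      truncated subtraction because balanced degrees do not exceed \<open>d\<close>.\<close>
    have "real (d - balanced r a i) = real d - real (balanced r a i)"
      by (rule of_nat_diff) (rule balanced_le[OF r a])
    then show "vdeg (col L i) \<le> ereal (real (d - balanced r a i))"
      using C[OF i] by (auto simp: balanced_def diff_diff_eq add.commute)
  qed
  have "degree (R $$ (i,j)) \<le> balanced r a i" if "i < r" "j < n" for i j
    using bnd(1)[OF that(1)] that R unfolding vdeg_le_iff by simp
  moreover have "degree (L $$ (j,i)) \<le> d - balanced r a i" if "i < r" "j < m" for i j
    using bnd(2)[OF that(1)] that L unfolding vdeg_le_iff by simp
  ultimately have "P \<in> factored m n r d (balanced r a)" unfolding factored_def using P L R by blast
  then show "P \<in> pm_closure m n d (setMH m n r d a)" using factored_balanced_subset_closure[OF rm rn r a] by blast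
qed

lemma setB_subset_setC: "setB m n r d a \<subseteq> setC m n r d a"
proof
  fix P assume "P \<in> setB m n r d a"
  then obtain L R where P: "P = L * R" and B: "conds_B m n r d a L R" unfolding setB_def by blast
  have "vdeg (row R i) = ereal (real (if i < a mod r then a div r + 1 else a div r))"
    "vdeg (col L i) = ereal (real d) - vdeg (row R i)" if "i < r" for i
    using B that unfolding conds_B_def by blast+
  then have "(i < a mod r \<longrightarrow> vdeg (row R i) \<le> ereal (real (a div r + 1)) \<and>
          vdeg (col L i) \<le> ereal (real d - real (a div r) - 1)) \<and>
        (a mod r \<le> i \<longrightarrow> vdeg (row R i) \<le> ereal (real (a div r)) \<and>
          vdeg (col L i) \<le> ereal (real d - real (a div r)))" if "i < r" for i
    using that by auto
  moreover have "L \<in> carrier_mat m r" "R \<in> carrier_mat r n" using B unfolding conds_B_def by blast+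
  ultimately show "P \<in> setC m n r d a" unfolding setC_def using P by blast
qed

theorem theorem4p17:
  fixes m n r d a :: nat
  assumes "2 \<le> m" and "2 \<le> n" and "1 \<le> d" and "0 < r" and "r < min m n"
    and "a \<le> r * d"
  shows "setO m n r d a \<subseteq> setA m n r d a \<and>
         setMH m n r d a \<subseteq> setO m n r d a \<and>
         pm_closure m n d (setO m n r d a) = pm_closure m n d (setMH m n r d a) \<and>
         pm_closure m n d (setMH m n r d a) = pm_closure m n d (setM m n r d a) \<and>
         pm_closure m n d (setM m n r d a) = pm_closure m n d (setB m n r d a) \<and>
         pm_closure m n d (setB m n r d a) = pm_closure m n d (setC m n r d a) \<and>
         pm_closure m n d (setC m n r d a) = pm_closure m n d (setA m n r d a)"
proof -
  have rm: "r < m" and rn: "r < n" using assms(5) by auto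
  have OA: "setO m n r d a \<subseteq> setA m n r d a" by (rule setO_subset_setA[OF rm rn assms(6)])
  have MHO: "setMH m n r d a \<subseteq> setO m n r d a" by (rule setMH_subset_setO[OF assms(4,6)])
  have MHM: "setMH m n r d a \<subseteq> setM m n r d a" unfolding setMH_def setM_def conds_MH_def by blast
  have MB: "setM m n r d a \<subseteq> setB m n r d a" unfolding setM_def setB_def conds_M_def by blast
  note BC = setB_subset_setC[of m n r d a]
  note A = setA_subset_closure[OF rm rn assms(4,6)] and C = setC_subset_closure[OF rm rn assms(4,6)]
  \<comment> \<open>Each of the sets lies between \<open>setMH\<close> and the closure of
    \<open>setMH\<close>, so all closures coincide.\<close>
  have eq: "pm_closure m n d S = pm_closure m n d (setMH m n r d a)"
    if "setMH m n r d a \<subseteq> S" "S \<subseteq> pm_closure m n d (setMH m n r d a)" for S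
    using pm_closure_mono[OF that(1)] pm_closure_trans[OF that(2)] by (rule equalityI[rotated])
  have "pm_closure m n d (setO m n r d a) = pm_closure m n d (setMH m n r d a)"
    "pm_closure m n d (setA m n r d a) = pm_closure m n d (setMH m n r d a)"
    "pm_closure m n d (setM m n r d a) = pm_closure m n d (setMH m n r d a)"
    "pm_closure m n d (setB m n r d a) = pm_closure m n d (setMH m n r d a)"
    "pm_closure m n d (setC m n r d a) = pm_closure m n d (setMH m n r d a)"
    by (rule eq; use OA MHO MHM MB BC A C in blast)+
  then show ?thesis using OA MHO by simp
qed

end
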